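(* Let $m\le n$, let $\Xi$ be a compact metric space, and for each $q\in\Xi$ and $j\in\mathbb N$ let $\mathbf X_h^{j,q}=(X_1^{j,q},\dots,X_m^{j,q})$ and $\mathbf X_h^q=(X_1^q,\dots,X_m^q)$ be two frames of vector fields on the Euclidean ball $B_{\rm E}(x_0,R_0)\subset\mathbb R^n$ satisfying Chow's condition. Assume that all partial derivatives $$B_{\rm E}(x_0,R_0)\times\Xi\ni(x,q)\mapsto\partial_x^\alpha X_i^q(x)\quad\text{and}\quad B_{\rm E}(x_0,R_0)\times\Xi\ni(x,q)\mapsto\partial_x^\alpha X_i^{j,q}(x)$$ are continuous for every $i=1,\dots,m$, every $j\in\mathbb N$ and every multi-index $\alpha\in\mathbb N^n$. Suppose also that for each $i=1,\dots,m$ the vector field $X_i^{j,q}$ converges to $X_i^q$ in $B_{\rm E}(x_0,R_0)$ with respect to the $C^\infty_{\rm loc}$-topology as $j\to\infty$, uniformly with respect to $q\in\Xi$. Then there exists $0<r_0<R_0$ such that the sub-Riemannian distance $d_q^j$ associated with $\mathbf X_h^{j,q}$ on $B_{\rm E}(x_0,R_0)$ converges to the sub-Riemannian distance $d_q$ associated with $\mathbf X_h^q$ on $B_{\rm E}(x_0,R_0)$ in the topology of $L^\infty(B_{\rm E}(x_0,r_0)\times B_{\rm E}(x_0,r_0))$ as $j\to\infty$, uniformly with respect to $q\in\Xi$.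
   Context: $B_{\rm E}(x,r)$ is the open Euclidean ball in $\mathbb R^n$. A frame $(X_1,\dots,X_m)$ on an open connected set $\Omega\subset\mathbb R^n$ is an ordered collection of everywhere linearly independent smooth vector fields on $\Omega$; it satisfies Chow's condition if the iterated Lie brackets of $X_1,\dots,X_m$ (up to some degree of iteration) span $\mathbb R^n$ at every point of $\Omega$. The associated sub-Riemannian distance on $\Omega$ between $x,y\in\Omega$ is the infimum of $\|h\|_\infty$, the $L^\infty$ norm of $t\mapsto\sqrt{\sum_{j=1}^mh_j(t)^2}$, over all absolutely continuous curves $\gamma\colon[0,1]\to\Omega$ (contained in $\Omega$) with $\gamma(0)=x$, $\gamma(1)=y$ and $\gamma'(t)=\sum_{j=1}^mh_j(t)X_j(\gamma(t))$ for a.e. $t\in[0,1]$. Convergence in the $C^\infty_{\rm loc}$-topology means uniform convergence of all partial derivatives on compact subsets. *)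

theory Defs
  imports "HOL-Analysis.Analysis" "HOL-Probability.Essential_Supremum"
begin

definition partial_deriv ::
    "'n \<Rightarrow> (real^'n \<Rightarrow> 'b::real_normed_vector) \<Rightarrow> real^'n \<Rightarrow> 'b"
  where "partial_deriv i f x = vector_derivative (\<lambda>t. f (x + t *\<^sub>R axis i 1)) (at 0)"

text \<open>
  Partial derivatives of higher order are indexed by finite words of coordinate directions: the word
  \<open>[i\<^sub>1, \<dots>, i\<^sub>k]\<close> stands for \<open>\<partial>\<^bsub>i\<^sub>1\<^esub> \<dots> \<partial>\<^bsub>i\<^sub>k\<^esub>\<close>. For smooth functions the order of the
  letters is irrelevant (Schwarz), so ranging over all words is the same as ranging over all
  multi-indices \<open>\<alpha>\<close>, where \<open>\<alpha> i\<close> is the number of occurrences of \<open>i\<close>.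
\<close>

definition iter_partial ::
    "'n list \<Rightarrow> (real^'n \<Rightarrow> 'b::real_normed_vector) \<Rightarrow> real^'n \<Rightarrow> 'b"
  where "iter_partial w f = foldr partial_deriv w f"

definition smooth_on :: "(real^'n) set \<Rightarrow> (real^'n \<Rightarrow> 'b::real_normed_vector) \<Rightarrow> bool"
  where "smooth_on \<Omega> f \<longleftrightarrow> (\<forall>w. \<forall>x\<in>\<Omega>. iter_partial w f differentiable (at x))"

definition is_frame :: "nat \<Rightarrow> (real^'n) set \<Rightarrow> (nat \<Rightarrow> real^'n \<Rightarrow> real^'n) \<Rightarrow> bool"
  where "is_frame m \<Omega> X \<longleftrightarrow> open \<Omega> \<and> connected \<Omega> \<and>
    (\<forall>i\<in>{1..m}. smooth_on \<Omega> (X i)) \<and>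
    (\<forall>x\<in>\<Omega>. inj_on (\<lambda>i. X i x) {1..m} \<and> independent ((\<lambda>i. X i x) ` {1..m}))"

definition lie_bracket ::
    "(real^'n \<Rightarrow> real^'n) \<Rightarrow> (real^'n \<Rightarrow> real^'n) \<Rightarrow> real^'n \<Rightarrow> real^'n"
  where "lie_bracket Y Z x =
    frechet_derivative Z (at x) (Y x) - frechet_derivative Y (at x) (Z x)"

primrec iterated_brackets ::
    "nat \<Rightarrow> (nat \<Rightarrow> real^'n \<Rightarrow> real^'n) \<Rightarrow> nat \<Rightarrow> (real^'n \<Rightarrow> real^'n) set"
  where
    "iterated_brackets m X 0 = X ` {1..m}"
  | "iterated_brackets m X (Suc k) = iterated_brackets m X k \<union>
      {lie_bracket Y Z | Y Z. Y \<in> iterated_brackets m X k \<and> Z \<in> iterated_brackets m X k}"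

text \<open>The degree of iteration needed to span may depend on the point.\<close>

definition chow_condition :: "nat \<Rightarrow> (real^'n) set \<Rightarrow> (nat \<Rightarrow> real^'n \<Rightarrow> real^'n) \<Rightarrow> bool"
  where "chow_condition m \<Omega> X \<longleftrightarrow>
    (\<forall>x\<in>\<Omega>. \<exists>k. span ((\<lambda>Y. Y x) ` iterated_brackets m X k) = UNIV)"

definition absolutely_continuous_on :: "real set \<Rightarrow> (real \<Rightarrow> 'b::metric_space) \<Rightarrow> bool"
  where "absolutely_continuous_on S \<gamma> \<longleftrightarrow>
    (\<forall>\<epsilon>>0. \<exists>\<delta>>0. \<forall>I. finite I \<and> (\<forall>(a, b)\<in>I. a \<le> b \<and> {a..b} \<subseteq> S) \<and>
        disjoint_family_on (\<lambda>(a, b). {a<..<b}) I \<and> (\<Sum>(a, b)\<in>I. b - a) < \<delta> \<longrightarrow>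
        (\<Sum>(a, b)\<in>I. dist (\<gamma> a) (\<gamma> b)) < \<epsilon>)"

definition control_norm :: "nat \<Rightarrow> (nat \<Rightarrow> real \<Rightarrow> real) \<Rightarrow> ereal"
  where "control_norm m h =
    esssup (lebesgue_on {0..1}) (\<lambda>t. ereal (sqrt (\<Sum>j=1..m. (h j t)\<^sup>2)))"

definition horizontal_curve ::
    "nat \<Rightarrow> (real^'n) set \<Rightarrow> (nat \<Rightarrow> real^'n \<Rightarrow> real^'n) \<Rightarrow> real^'n \<Rightarrow> real^'n \<Rightarrow>
     (real \<Rightarrow> real^'n) \<Rightarrow> (nat \<Rightarrow> real \<Rightarrow> real) \<Rightarrow> bool"
  where "horizontal_curve m \<Omega> X x y \<gamma> h \<longleftrightarrow>
    absolutely_continuous_on {0..1} \<gamma> \<and> \<gamma> ` {0..1} \<subseteq> \<Omega> \<and> \<gamma> 0 = x \<and> \<gamma> 1 = y \<and>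
    (\<forall>j\<in>{1..m}. h j \<in> borel_measurable (lebesgue_on {0..1})) \<and>
    (AE t in lebesgue_on {0..1}.
      (\<gamma> has_vector_derivative (\<Sum>j=1..m. h j t *\<^sub>R X j (\<gamma> t))) (at t within {0..1}))"

text \<open>The infimum is taken in \<^typ>\<open>ereal\<close>, so that it is \<open>\<infinity>\<close> if no horizontal curve joins the points.\<close>

definition sr_dist ::
    "nat \<Rightarrow> (real^'n) set \<Rightarrow> (nat \<Rightarrow> real^'n \<Rightarrow> real^'n) \<Rightarrow> real^'n \<Rightarrow> real^'n \<Rightarrow> ereal"
  where "sr_dist m \<Omega> X x y = Inf {control_norm m h | \<gamma> h. horizontal_curve m \<Omega> X x y \<gamma> h}"

text \<open>
  The functions are \<^typ>\<open>ereal\<close>-valued. In \<^typ>\<open>ereal\<close> the absolute value of every difference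
  involving an infinite value, including \<open>\<infinity> - \<infinity>\<close>, is \<open>\<infinity>\<close>; hence a finite \<open>Linf_norm S (f - g)\<close>
  means that \<open>f\<close> and \<open>g\<close> are finite almost everywhere on \<open>S\<close>.
\<close>

definition Linf_norm :: "'a::euclidean_space set \<Rightarrow> ('a \<Rightarrow> ereal) \<Rightarrow> ereal"
  where "Linf_norm S f = esssup (lebesgue_on S) (\<lambda>z. \<bar>f z\<bar>)"

definition in_Linf :: "'a::euclidean_space set \<Rightarrow> ('a \<Rightarrow> ereal) \<Rightarrow> bool"
  where "in_Linf S f \<longleftrightarrow> f \<in> borel_measurable (lebesgue_on S) \<and> Linf_norm S f < \<infinity>"

definition Linf_convergent_uniformly ::
    "'a::euclidean_space set \<Rightarrow> 'q set \<Rightarrow> (nat \<Rightarrow> 'q \<Rightarrow> 'a \<Rightarrow> ereal) \<Rightarrow> ('q \<Rightarrow> 'a \<Rightarrow> ereal) \<Rightarrow> bool"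
  where "Linf_convergent_uniformly S Q F f \<longleftrightarrow>
    (\<forall>q\<in>Q. in_Linf S (f q) \<and> (\<forall>j. in_Linf S (F j q))) \<and>
    (\<forall>\<epsilon>>0. \<exists>J. \<forall>j\<ge>J. \<forall>q\<in>Q. Linf_norm S (\<lambda>z. F j q z - f q z) < ereal \<epsilon>)"

end

theory Submission
  imports Defs
begin

text \<open>
  The comparison of the two distances rests on transporting controls. Let \<open>h\<close> be a control whose
  curve in the frame \<open>X q\<close> leads from \<open>x\<close> to \<open>y\<close> and whose norm is almost the distance. The same
  control in the frame \<open>Xj j q\<close> leads from \<open>x\<close> to a point \<open>z\<close>, and by Gronwall's inequality \<open>z\<close> is
  close to \<open>y\<close>, uniformly in \<open>q\<close> (\<open>solution_transfer\<close>). The remaining gap from \<open>z\<close> to \<open>y\<close> is bridged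
  by a curve of \<open>Xj j q\<close> of small length, because nearby points are at small distance with a modulus
  that depends neither on \<open>q\<close> nor on the large index \<open>j\<close> (\<open>uniform_local_controllability\<close>). Hence the
  second distance exceeds the first by an arbitrarily small amount (\<open>sr_dist_le_perturbed\<close>), and the
  roles of the two frames can be exchanged. The radius \<open>r0\<close> is chosen so small that all the distances
  involved are too short for an almost minimising curve to leave the ball of radius \<open>R0 / 2\<close>; on this
  compact ball the fields have common bounds and a common Lipschitz constant.

  The modulus comes from a stable form of Chow's theorem (\<open>stable_local_controllability\<close>): around a
  point \<open>p\<close> at which the brackets of \<open>X\<close> span, any two points are joined by a curve of length at most
  \<open>\<epsilon>\<close>, for every Lipschitz frame that is uniformly close to \<open>X\<close> near \<open>p\<close>. Closeness in the uniform norm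
  suffices because the argument is topological. Call \<open>V\<close> steerable if there is a finite sequence of
  flows of the fields \<open>X i\<close>, with times that depend continuously on \<open>t\<close> and have small sum, whose
  composition moves \<open>x\<close> to \<open>x + t V x\<close> up to an error that is small compared with \<open>t\<close>, locally
  uniformly in \<open>x\<close>. The fields of the frame are steerable, and steerable fields form a vector space.
  If \<open>\<Phi> t\<close> steers along \<open>V\<close>, then the flow of \<open>X i\<close> for a time \<open>s\<close>, followed by \<open>\<Phi> \<sigma>\<close>, by the
  backward flow of \<open>X i\<close> for the time \<open>s\<close> and by \<open>\<Phi> (- \<sigma>)\<close>, moves \<open>x\<close> approximately by
  \<open>s \<sigma> [X i, V] x\<close>; with \<open>s\<close> small but fixed and \<open>\<sigma>\<close> tending to \<open>0\<close>, the errors are small compared with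
  \<open>s \<sigma>\<close> (\<open>commutator_estimate\<close>). So brackets with \<open>X i\<close> are again steerable, and by the Jacobi
  identity all iterated brackets are. Under the bracket condition one can therefore steer from \<open>p\<close> to
  \<open>p + v\<close> for all small \<open>v\<close>, up to an error of a quarter of the radius of the ball of the vectors \<open>v\<close>.
  The endpoint is a continuous function of \<open>v\<close>, and it changes little if the frame and the starting
  point are perturbed, so Brouwer's fixed point theorem shows that every point near \<open>p\<close> is an endpoint.
  Compactness of \<open>\<Xi>\<close> and of the ball makes the modulus uniform.

  Horizontal curves are absolutely continuous and their controls are only measurable. They are
  traded for solutions of an integral equation with a pointwise bounded control (\<open>reach\<close>); one
  direction needs the fundamental theorem of calculus for absolutely continuous functions, the other
  one the Lebesgue differentiation theorem.
\<close>

section \<open>Integral equations\<close>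

text \<open>
  The function \<open>exp (- L * t) * (a + L * integral {0..t} u)\<close> is nonincreasing.
\<close>

lemma integral_gronwall:
  fixes u :: "real \<Rightarrow> real"
  assumes cont: "continuous_on {0..1} u" and L: "0 \<le> L"
    and le: "\<And>t. t \<in> {0..1} \<Longrightarrow> u t \<le> a + L * integral {0..t} u"
    and t: "t \<in> {0..1}"
  shows "u t \<le> a * exp (L * t)"
proof -
  define U where "U t = a + L * integral {0..t} u" for t
  have int: "u integrable_on {0..1}"
    using cont by (rule integrable_continuous_real)
  have dI: "((\<lambda>s. integral {0..s} u) has_real_derivative u s) (at s)"
    if "0 < s" "s < 1" for s
  proof -
    have "((\<lambda>s. integral {0..s} u) has_real_derivative u s) (at s within {0..1})"
      using integral_has_vector_derivative[OF cont, of s] that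
      by (simp add: has_real_derivative_iff_has_vector_derivative)
    then show ?thesis
      using that at_within_Icc_at[of 0 s 1] by simp
  qed
  have "exp (- L * 0) * U 0 \<ge> exp (- L * t) * U t"
  proof (rule DERIV_nonpos_imp_decreasing_open[of 0 t "\<lambda>s. exp (- L * s) * U s"])
    show "0 \<le> t" using t by simp
  next
    fix s assume s: "0 < s" "s < t"
    then have s1: "s < 1" and sin: "s \<in> {0..1}" using t by auto
    have "((\<lambda>s. exp (- L * s) * U s) has_real_derivative
        (exp (- L * s) * (- L)) * U s + exp (- L * s) * (L * u s)) (at s)"
      unfolding U_def
      by (rule derivative_eq_intros dI refl s s1 | simp add: algebra_simps)+
    moreover have "(exp (- L * s) * (- L)) * U s + exp (- L * s) * (L * u s)
        = exp (- L * s) * L * (u s - U s)"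
      by (simp add: algebra_simps)
    moreover have "exp (- L * s) * L * (u s - U s) \<le> 0"
      using le[OF sin] L by (intro mult_nonneg_nonpos) (auto simp: U_def)
    ultimately show "\<exists>y. ((\<lambda>s. exp (- L * s) * U s) has_real_derivative y) (at s) \<and> y \<le> 0"
      by metis
  next
    have "continuous_on {0..1} (\<lambda>s. integral {0..s} u)"
      using indefinite_integral_continuous_1[OF int] .
    then have "continuous_on {0..t} (\<lambda>s. integral {0..s} u)"
      by (rule continuous_on_subset) (use t in auto)
    then show "continuous_on {0..t} (\<lambda>s. exp (- L * s) * U s)"
      unfolding U_def by (intro continuous_intros)
  qed
  then have "U t \<le> a * exp (L * t)"
    by (simp add: U_def exp_minus field_simps)
  with le[OF t] show ?thesis by (simp add: U_def)
qed

text \<open>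
  The Caratheodory solutions of an ordinary differential equation on the unit interval. The
  integral equation at time \<open>0\<close> contains the initial condition, and the integrability of the right-hand
  side along the curve is part of it.
\<close>

definition solves :: "(real \<Rightarrow> real^'n \<Rightarrow> real^'n) \<Rightarrow> real^'n \<Rightarrow> (real \<Rightarrow> real^'n) \<Rightarrow> bool"
  where "solves F x \<gamma> \<longleftrightarrow> continuous_on {0..1} \<gamma> \<and>
    (\<forall>t\<in>{0..1}. ((\<lambda>s. F s (\<gamma> s)) has_integral (\<gamma> t - x)) {0..t})"

lemma solves_start: "solves F x \<gamma> \<Longrightarrow> \<gamma> 0 = x"
  unfolding solves_def by (auto dest!: bspec[of _ _ 0] has_integral_unique[OF _ has_integral_refl(2)])

lemma solves_between:
  assumes "solves F x \<gamma>" "0 \<le> s" "s \<le> t" "t \<le> 1"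
  shows "((\<lambda>r. F r (\<gamma> r)) has_integral (\<gamma> t - \<gamma> s)) {s..t}"
proof -
  have t: "((\<lambda>r. F r (\<gamma> r)) has_integral (\<gamma> t - x)) {0..t}"
    and s: "((\<lambda>r. F r (\<gamma> r)) has_integral (\<gamma> s - x)) {0..s}"
    using assms unfolding solves_def by auto
  have "(\<lambda>r. F r (\<gamma> r)) integrable_on {s..t}"
    using integrable_subinterval_real[of _ 0 t s t] t assms by (auto simp: has_integral_iff)
  then obtain j where j: "((\<lambda>r. F r (\<gamma> r)) has_integral j) {s..t}"
    by (auto simp: integrable_on_def)
  have "((\<lambda>r. F r (\<gamma> r)) has_integral (\<gamma> s - x + j)) {0..t}"
    by (rule has_integral_combine[OF _ _ s j]) (use assms in auto)
  with t have "\<gamma> s - x + j = \<gamma> t - x" by (rule has_integral_unique[symmetric])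
  then have "j = \<gamma> t - \<gamma> s" by (simp add: algebra_simps)
  with j show ?thesis by simp
qed

text \<open>
  Picard iteration. With the weight \<open>exp (- 2 * K * t)\<close>, where \<open>L \<le> K\<close>, the integral operator is a
  contraction of factor \<open>1/2\<close> on the whole interval, so no subdivision is needed. Functions on
  \<open>{0..1}\<close> are represented by bounded continuous functions on the line that are constant outside.
\<close>

lemma solution_exists:
  fixes F :: "real \<Rightarrow> real^'n \<Rightarrow> real^'n"
  assumes int: "\<And>\<gamma>. continuous_on {0..1} \<gamma> \<Longrightarrow> (\<lambda>s. F s (\<gamma> s)) integrable_on {0..1}"
    and lip: "\<And>s x y. s \<in> {0..1} \<Longrightarrow> norm (F s x - F s y) \<le> L * norm (x - y)"
    and L: "0 \<le> L"
  shows "\<exists>\<gamma>. solves F x \<gamma>"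
proof -
  define K where "K = L + 1"
  have K: "0 < K" "L \<le> K" using L by (auto simp: K_def)
  define W where "W u s = F s (exp (2 * K * s) *\<^sub>R u s)" for u :: "real \<Rightarrow> real^'n" and s
  define P where "P u t = exp (- 2 * K * t) *\<^sub>R (x + integral {0..t} (W u))" for u t
  have Wint: "W u integrable_on {0..1}" if "continuous_on {0..1} u" for u
    unfolding W_def by (intro int continuous_intros that)
  have Pcont: "continuous_on {0..1} (P u)" if "continuous_on {0..1} u" for u
    unfolding P_def
    by (intro continuous_intros indefinite_integral_continuous_1 Wint that)
  have "\<exists>v::real \<Rightarrow>\<^sub>C (real^'n). \<forall>t. v t = P (apply_bcontfun u) (clamp 0 1 t)" for u :: "real \<Rightarrow>\<^sub>C (real^'n)"
  proof -
    have "continuous_on (cbox 0 1) (P (apply_bcontfun u))"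
      using Pcont[of "apply_bcontfun u"] by simp
    then obtain g :: "real \<Rightarrow>\<^sub>C (real^'n)" where "\<And>t. g t = P (apply_bcontfun u) (clamp 0 1 t)"
      by (rule continuous_on_cbox_bcontfunE) auto
    then show ?thesis by blast
  qed
  then obtain T :: "(real \<Rightarrow>\<^sub>C (real^'n)) \<Rightarrow> (real \<Rightarrow>\<^sub>C (real^'n))"
    where T: "\<And>u t. T u t = P (apply_bcontfun u) (clamp 0 1 t)"
    by metis
  have contr: "dist (T u) (T v) \<le> (1/2) * dist u v" for u v
  proof (rule dist_bound)
    fix t0 :: real
    define t where "t = clamp 0 1 t0"
    have "clamp 0 1 t0 \<in> cbox 0 (1::real)" by (rule clamp_in_interval) auto
    then have t: "t \<in> {0..1}" by (simp add: t_def)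
    define d where "d = dist u v"
    have d: "norm (u s - v s) \<le> d" for s
      using dist_bounded[of u s v] by (simp add: d_def dist_norm)
    have sub: "W w integrable_on {0..t}" if "w = apply_bcontfun w'" for w w'
      using integrable_subinterval_real[OF Wint[of w], of 0 t] t that by auto
    have g: "((\<lambda>s. K * exp (2 * K * s) * d) has_integral (exp (2 * K * t) * d / 2 - exp (2 * K * 0) * d / 2)) {0..t}"
      by (rule fundamental_theorem_of_calculus)
        (use t in \<open>auto intro!: derivative_eq_intros simp flip: has_real_derivative_iff_has_vector_derivative\<close>)
    have "norm (integral {0..t} (W u) - integral {0..t} (W v)) = norm (integral {0..t} (\<lambda>s. W u s - W v s))"
      using sub by (simp add: integral_diff)
    also have "\<dots> \<le> integral {0..t} (\<lambda>s. K * exp (2 * K * s) * d)"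
    proof (rule integral_norm_bound_integral)
      show "(\<lambda>s. W u s - W v s) integrable_on {0..t}"
        using sub by (intro integrable_diff) auto
      show "(\<lambda>s. K * exp (2 * K * s) * d) integrable_on {0..t}"
        using g by (auto simp: integrable_on_def)
      fix s assume s: "s \<in> {0..t}"
      have "norm (W u s - W v s) \<le> L * norm (exp (2 * K * s) *\<^sub>R u s - exp (2 * K * s) *\<^sub>R v s)"
        unfolding W_def by (rule lip) (use s t in auto)
      also have "\<dots> = L * (exp (2 * K * s) * norm (u s - v s))"
        by (simp flip: scaleR_diff_right)
      also have "\<dots> \<le> K * (exp (2 * K * s) * d)"
        by (intro mult_mono d order_refl) (use K L d in auto)
      finally show "norm (W u s - W v s) \<le> K * exp (2 * K * s) * d" by (simp add: mult.assoc)
    qed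
    also have "\<dots> = (exp (2 * K * t) - 1) * d / 2"
      by (simp only: integral_unique[OF g]) (simp add: algebra_simps diff_divide_distrib)
    finally have b: "norm (integral {0..t} (W u) - integral {0..t} (W v)) \<le> (exp (2 * K * t) - 1) * d / 2" .
    have "dist (T u t0) (T v t0) = exp (- 2 * K * t) * norm (integral {0..t} (W u) - integral {0..t} (W v))"
      unfolding T t_def[symmetric] P_def dist_norm by (simp flip: scaleR_diff_right)
    also have "\<dots> \<le> exp (- 2 * K * t) * ((exp (2 * K * t) - 1) * d / 2)"
      by (rule mult_left_mono[OF b]) simp
    also have "\<dots> = (1 - exp (- 2 * K * t)) * d / 2"
      by (simp add: exp_minus field_simps)
    also have "\<dots> \<le> d / 2"
      by (simp add: algebra_simps d_def)
    finally show "dist (T u t0) (T v t0) \<le> 1/2 * dist u v" by (simp add: d_def)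
  qed
  have "\<exists>!u. T u = u"
    by (rule banach_fix_type[of "1/2"]) (use contr in auto)
  then obtain u where u: "T u = u" by blast
  define \<gamma> where "\<gamma> t = exp (2 * K * t) *\<^sub>R u t" for t
  have \<gamma>: "continuous_on {0..1} \<gamma>" unfolding \<gamma>_def by (intro continuous_intros) auto
  have "((\<lambda>s. F s (\<gamma> s)) has_integral (\<gamma> t - x)) {0..t}" if t: "t \<in> {0..1}" for t
  proof -
    have "clamp 0 1 t = t" using t by simp
    then have "u t = P u t" using u T by metis
    then have "\<gamma> t - x = integral {0..t} (\<lambda>s. F s (\<gamma> s))"
      by (simp add: \<gamma>_def P_def W_def[abs_def] flip: exp_add)
    moreover have "(\<lambda>s. F s (\<gamma> s)) integrable_on {0..t}"
      using integrable_subinterval_real[OF int[OF \<gamma>], of 0 t] t by auto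
    ultimately show ?thesis by (simp add: has_integral_iff)
  qed
  with \<gamma> show ?thesis unfolding solves_def by blast
qed

text \<open>
  Gronwall's inequality for solutions of two equations. Both conditions on the right-hand sides are
  required only along the given curves, so that it applies to fields that are controlled on a ball.
\<close>

lemma solutions_close:
  assumes \<gamma>: "solves F x \<gamma>" and \<delta>: "solves G y \<delta>"
    and lip: "\<And>s. s \<in> {0..1} \<Longrightarrow> norm (F s (\<gamma> s) - F s (\<delta> s)) \<le> L * norm (\<gamma> s - \<delta> s)"
    and close: "\<And>s. s \<in> {0..1} \<Longrightarrow> norm (F s (\<delta> s) - G s (\<delta> s)) \<le> \<eta>"
    and L: "0 \<le> L" and t: "t \<in> {0..1}"
  shows "norm (\<gamma> t - \<delta> t) \<le> (norm (x - y) + \<eta>) * exp L"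
proof -
  define u where "u t = norm (\<gamma> t - \<delta> t)" for t
  have \<eta>: "0 \<le> \<eta>" using close[of 0] norm_ge_zero order_trans by (metis atLeastAtMost_iff order_refl zero_le_one)
  have ucont: "continuous_on {0..1} u"
    using \<gamma> \<delta> unfolding u_def solves_def by (intro continuous_intros) auto
  have "u t \<le> (norm (x - y) + \<eta>) * exp (L * t)"
  proof (rule integral_gronwall[OF ucont L _ t])
    fix t :: real assume t: "t \<in> {0..1}"
    have i: "((\<lambda>s. F s (\<gamma> s) - G s (\<delta> s)) has_integral ((\<gamma> t - x) - (\<delta> t - y))) {0..t}"
      using \<gamma> \<delta> t unfolding solves_def by (intro has_integral_diff) auto
    have "continuous_on {0..t} u" using ucont by (rule continuous_on_subset) (use t in auto)
    then have ui: "u integrable_on {0..t}" by (rule integrable_continuous_real)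
    then have gi: "((\<lambda>s. L * u s + \<eta>) has_integral (L * integral {0..t} u + t * \<eta>)) {0..t}"
      using t by (intro has_integral_add has_integral_mult_right integrable_integral)
         (use has_integral_const_real[of \<eta> 0 t] in auto)
    have "norm ((\<gamma> t - x) - (\<delta> t - y)) \<le> L * integral {0..t} u + t * \<eta>"
    proof -
      have "norm (integral {0..t} (\<lambda>s. F s (\<gamma> s) - G s (\<delta> s))) \<le> integral {0..t} (\<lambda>s. L * u s + \<eta>)"
      proof (rule integral_norm_bound_integral)
        show "(\<lambda>s. F s (\<gamma> s) - G s (\<delta> s)) integrable_on {0..t}" "(\<lambda>s. L * u s + \<eta>) integrable_on {0..t}"
          using i gi by (auto simp: integrable_on_def)
        fix s assume s: "s \<in> {0..t}"
        then have s: "s \<in> {0..1}" using t by auto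
        have "norm (F s (\<gamma> s) - G s (\<delta> s)) \<le> norm (F s (\<gamma> s) - F s (\<delta> s)) + norm (F s (\<delta> s) - G s (\<delta> s))"
          using norm_triangle_ineq[of "F s (\<gamma> s) - F s (\<delta> s)" "F s (\<delta> s) - G s (\<delta> s)"] by simp
        also have "\<dots> \<le> L * u s + \<eta>" using lip[OF s] close[OF s] by (simp add: u_def)
        finally show "norm (F s (\<gamma> s) - G s (\<delta> s)) \<le> L * u s + \<eta>" .
      qed
      then show ?thesis using i gi by (simp add: integral_unique)
    qed
    moreover have "u t \<le> norm ((\<gamma> t - x) - (\<delta> t - y)) + norm (x - y)"
      unfolding u_def using norm_triangle_ineq[of "(\<gamma> t - x) - (\<delta> t - y)" "x - y"] by (simp add: algebra_simps)
    moreover have "t * \<eta> \<le> \<eta>" using t \<eta> by (simp add: mult_left_le_one_le)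
    ultimately show "u t \<le> norm (x - y) + \<eta> + L * integral {0..t} u" by linarith
  qed
  also have "\<dots> \<le> (norm (x - y) + \<eta>) * exp L"
    using t L \<eta> by (intro mult_left_mono) (auto simp: mult_left_le)
  finally show ?thesis by (simp add: u_def)
qed


section \<open>Absolutely continuous functions and their derivatives\<close>

text \<open>
  The gauge of the Henstock integral does all the work. At a point outside the null set it is taken
  from differentiability, exactly as in the classical fundamental theorem. At the points of the null
  set \<open>N\<close> the integrand may be replaced by \<open>0\<close>, and the gauge is an open set \<open>U\<close> containing \<open>N\<close>
  of measure less than the \<open>\<delta>\<close> of absolute continuity: the intervals tagged in \<open>N\<close> are disjoint and lie
  in \<open>U\<close>, so the increments of \<open>\<gamma>\<close> over them have a small sum.
\<close>

lemma absolutely_continuous_has_integral: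
  fixes \<gamma> g :: "real \<Rightarrow> 'b::euclidean_space"
  assumes ac: "absolutely_continuous_on {a..b} \<gamma>" and ab: "a \<le> b" and N: "negligible N"
    and der: "\<And>t. t \<in> {a..b} - N \<Longrightarrow> (\<gamma> has_vector_derivative g t) (at t within {a..b})"
  shows "(g has_integral (\<gamma> b - \<gamma> a)) {a..b}"
proof -
  define g' where "g' t = (if t \<in> N then 0 else g t)" for t
  have "(g' has_integral (\<gamma> b - \<gamma> a)) {a..b}"
    unfolding has_integral_real
  proof (intro allI impI)
    fix e :: real assume e: "e > 0"
    define e1 where "e1 = e / (2 * (b - a + 1))"
    have e1: "e1 > 0" using e ab by (simp add: e1_def)
    have "\<forall>x. \<exists>d>0. x \<in> {a..b} - N \<longrightarrow>
         (\<forall>y\<in>{a..b}. norm (y-x) < d \<longrightarrow> norm (\<gamma> y - \<gamma> x - (y-x) *\<^sub>R g x) \<le> e1 * norm (y-x))"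
      using der[unfolded has_vector_derivative_def has_derivative_within_alt] e1
      by (metis zero_less_one)
    then obtain d where d: "\<And>x. 0 < d x"
      "\<And>x y. \<lbrakk>x \<in> {a..b} - N; y \<in> {a..b}; norm (y-x) < d x\<rbrakk>
          \<Longrightarrow> norm (\<gamma> y - \<gamma> x - (y-x) *\<^sub>R g x) \<le> e1 * norm (y-x)"
      by metis
    have "e / 2 > 0" using e by simp
    from ac[unfolded absolutely_continuous_on_def, THEN spec, THEN mp, OF this]
    obtain \<delta> where \<delta>: "\<delta> > 0" and acd: "\<forall>I. finite I \<and> (\<forall>(a', b')\<in>I. a' \<le> b' \<and> {a'..b'} \<subseteq> {a..b}) \<and>
        disjoint_family_on (\<lambda>(a, b). {a<..<b}) I \<and> (\<Sum>(a, b)\<in>I. b - a) < \<delta> \<longrightarrow>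
        (\<Sum>(a, b)\<in>I. dist (\<gamma> a) (\<gamma> b)) < e / 2"
      by (elim exE conjE)
    obtain U where U: "open U" "N \<subseteq> U" "U - N \<in> lmeasurable" "emeasure lebesgue (U - N) < ennreal \<delta>"
      using sets_lebesgue_outer_open[OF negligible_imp_sets[OF N] \<delta>] by blast
    have "U = (U - N) \<union> N" using U by auto
    have Um: "U \<in> lmeasurable"
      using U negligible_imp_measurable[OF N] fmeasurable.Un[of "U - N" lebesgue N] \<open>U = (U - N) \<union> N\<close> by simp
    have "measure lebesgue U = measure lebesgue (U - N)"
      using N Um by (metis measure_Diff_null_set negligible_iff_null_sets fmeasurableD)
    also have "\<dots> < \<delta>"
      using U(3,4) \<delta> by (simp add: emeasure_eq_measure2 ennreal_less_iff)
    finally have mU: "measure lebesgue U < \<delta>" .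
    define G where "G x = (if x \<in> N then U else ball x (d x))" for x
    show "\<exists>\<gamma>'. gauge \<gamma>' \<and> (\<forall>\<D>. \<D> tagged_division_of {a..b} \<and> \<gamma>' fine \<D> \<longrightarrow>
        norm ((\<Sum>(x, k)\<in>\<D>. measure lborel k *\<^sub>R g' x) - (\<gamma> b - \<gamma> a)) < e)"
    proof (intro exI[of _ G] conjI allI impI)
      show "gauge G" using U(1,2) d(1) by (auto simp: G_def gauge_def)
      fix p assume "p tagged_division_of {a..b} \<and> G fine p"
      then have ptag: "p tagged_division_of {a..b}" and fin: "G fine p" by auto
      note p = tagged_division_ofD[OF ptag]
      have len: "b - a = (\<Sum>(x,K)\<in>p. Sup K - Inf K)" "\<gamma> b - \<gamma> a = (\<Sum>(x,K)\<in>p. \<gamma>(Sup K) - \<gamma>(Inf K))"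
        using additive_tagged_division_1[OF ab ptag, of "\<lambda>x. x"] additive_tagged_division_1[OF ab ptag, of \<gamma>] by auto
      have shape: "Inf K \<le> Sup K \<and> K = {Inf K..Sup K} \<and> measure lborel K = Sup K - Inf K
          \<and> Inf K \<in> K \<and> Sup K \<in> K \<and> K \<subseteq> {a..b} \<and> x \<in> K \<and> K \<subseteq> G x \<and> Inf K \<le> x \<and> x \<le> Sup K" if xK: "(x,K) \<in> p" for x K
      proof -
        obtain u v where K: "K = cbox u v" using p(4)[OF xK] by blast
        have x: "x \<in> K" "K \<subseteq> {a..b}" using p(2,3)[OF xK] by simp_all
        then have "u \<le> v" using K by auto
        moreover have "K \<subseteq> G x" using fin xK by (auto simp: fine_def)
        ultimately show ?thesis using K x by auto
      qed
      define pN where "pN = {(x,K) \<in> p. x \<in> N}"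
      define T where "T = (\<lambda>(x,K). measure lborel K *\<^sub>R g' x - (\<gamma> (Sup K) - \<gamma> (Inf K)))"
      have finp: "finite p" by (rule p(1))
      have pNp: "pN \<subseteq> p" by (auto simp: pN_def)
      have "(\<Sum>(x, k)\<in>p. measure lborel k *\<^sub>R g' x) - (\<gamma> b - \<gamma> a) = sum T p"
        by (simp add: len T_def sum_subtractf split_def)
      also have "\<dots> = sum T (p - pN) + sum T pN"
        by (rule sum.subset_diff[OF pNp finp])
      finally have split: "(\<Sum>(x, k)\<in>p. measure lborel k *\<^sub>R g' x) - (\<gamma> b - \<gamma> a) = sum T (p - pN) + sum T pN" .
      have "norm (sum T (p - pN)) \<le> (\<Sum>(x,K)\<in>p - pN. e1 * (Sup K - Inf K))"
      proof (rule sum_norm_le)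
        fix z assume z: "z \<in> p - pN"
        obtain x K where zz: "z = (x,K)" by fastforce
        have xK: "(x,K) \<in> p" "(x,K) \<notin> pN" using z zz by auto
        then have xN: "x \<notin> N" by (auto simp: pN_def)
        note sh = shape[OF xK(1)]
        have ball: "y \<in> K \<Longrightarrow> norm (y - x) < d x" for y
          using sh xN by (auto simp: G_def dist_norm norm_minus_commute subset_eq)
        have u: "norm (\<gamma> (Inf K) - \<gamma> x - (Inf K-x) *\<^sub>R g x) \<le> e1 * norm (Inf K-x)"
          using sh xN by (intro d(2) ball) auto
        have v: "norm (\<gamma> (Sup K) - \<gamma> x - (Sup K-x) *\<^sub>R g x) \<le> e1 * norm (Sup K-x)"
          using sh xN by (intro d(2) ball) auto
        have "T (x,K) = (\<gamma> (Inf K) - \<gamma> x - (Inf K-x) *\<^sub>R g x) - (\<gamma> (Sup K) - \<gamma> x - (Sup K-x) *\<^sub>R g x)"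
        proof -
          have c: "measure lborel K = Sup K - Inf K" using sh by blast
          show ?thesis using xN unfolding T_def g'_def prod.case c by (simp add: scaleR_left_diff_distrib)
        qed
        then have "norm (T (x,K)) \<le> e1 * norm (Inf K-x) + e1 * norm (Sup K-x)"
          using u v norm_triangle_ineq4 by (smt (verit))
        also have "norm (Inf K - x) = x - Inf K" using sh by simp
        also have "norm (Sup K - x) = Sup K - x" using sh by simp
        finally show "norm (T z) \<le> (case z of (x,K) \<Rightarrow> e1 * (Sup K - Inf K))"
          unfolding zz by (simp add: algebra_simps)
      qed
      also have "\<dots> \<le> (\<Sum>(x,K)\<in>p. e1 * (Sup K - Inf K))"
        by (rule sum_mono2[OF finp]) (use shape e1 in auto)
      also have "\<dots> = e1 * (b - a)"
        by (simp add: len sum_distrib_left split_def)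
      also have "\<dots> < e1 * (b - a + 1)" using e1 by simp
      also have "\<dots> = e / 2" using ab by (simp add: e1_def field_simps)
      finally have A: "norm (sum T (p - pN)) < e / 2" .
      \<comment> \<open>Degenerate intervals are dropped, so that an interval determines its tag.\<close>
      define q where "q = {(x,K) \<in> pN. Inf K < Sup K}"
      define I where "I = (\<lambda>(x,K). (Inf K, Sup K)) ` q"
      have qp: "q \<subseteq> p" using pNp by (auto simp: q_def)
      have finq: "finite q" using finite_subset[OF qp finp] .
      have inj: "inj_on (\<lambda>(x,K). (Inf K, Sup K :: real)) q"
      proof (rule inj_onI)
        fix z z' assume z: "z \<in> q" "z' \<in> q" "(\<lambda>(x,K). (Inf K, Sup K :: real)) z = (\<lambda>(x,K). (Inf K, Sup K)) z'"
        obtain x K x' K' where zz: "z = (x,K)" "z' = (x',K')" by fastforce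
        have h: "(x,K) \<in> q" "(x',K') \<in> q" "Inf K = Inf K'" "Sup K = Sup K'" using z zz by auto
        then have "K = K'" using shape qp by (metis subsetD)
        moreover have "Inf K < Sup K" "K = {Inf K..Sup K}" using h(1) shape[of x K] qp by (auto simp: q_def)
        then have "interior K \<noteq> {}"
          by (metis interior_atLeastAtMost_real greaterThanLessThan_empty_iff leD)
        ultimately show "z = z'" unfolding zz using p(5)[of x K x' K'] h(1,2) qp by auto
      qed
      have Idisj: "disjoint_family_on (\<lambda>(a, b). {a<..<b}) I"
        unfolding disjoint_family_on_def
      proof (intro ballI impI)
        fix i j assume "i \<in> I" "j \<in> I" and ne: "i \<noteq> j"
        then obtain x K x' K' where h: "(x,K) \<in> q" "(x',K') \<in> q" "i = (Inf K, Sup K)" "j = (Inf K', Sup K')"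
          unfolding I_def by auto
        then have "interior K \<inter> interior K' = {}" using p(5)[of x K x' K'] qp ne by auto
        moreover have "K = {Inf K..Sup K}" "K' = {Inf K'..Sup K'}" using h shape qp by (meson subsetD)+
        ultimately have "{Inf K<..<Sup K} \<inter> {Inf K'<..<Sup K'} = {}"
          by (metis interior_atLeastAtMost_real)
        then show "(case i of (a, b) \<Rightarrow> {a<..<b}) \<inter> (case j of (a, b) \<Rightarrow> {a<..<b}) = {}"
          using h by simp
      qed
      have finI: "finite I" using finq by (simp add: I_def)
      have Iab: "\<forall>(a', b')\<in>I. a' \<le> b' \<and> {a'..b'} \<subseteq> {a..b}"
        using shape qp unfolding I_def by fastforce
      have "(\<Sum>(a, b)\<in>I. b - a) = (\<Sum>i\<in>I. measure lebesgue ((\<lambda>(a, b). {a<..<b}) i))"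
        by (rule sum.cong) (use Iab in auto)
      also have "\<dots> = measure lebesgue (\<Union>i\<in>I. (\<lambda>(a, b). {a<..<b}) i)"
        by (rule measure_finite_Union[symmetric, OF finI _ Idisj]) (use Iab in auto)
      also have "\<dots> \<le> measure lebesgue U"
      proof (rule measure_mono_fmeasurable[OF _ _ Um])
        show "(\<Union>i\<in>I. (\<lambda>(a, b). {a<..<b}) i) \<subseteq> U"
        proof
          fix y assume "y \<in> (\<Union>i\<in>I. (\<lambda>(a, b). {a<..<b}) i)"
          then obtain u v where "(u,v) \<in> I" "y \<in> {u<..<v}" by auto
          then obtain x K where xK: "(x,K) \<in> q" "u = Inf K" "v = Sup K" by (auto simp: I_def)
          then have "x \<in> N" by (auto simp: q_def pN_def)
          then have "K \<subseteq> U" using shape[of x K] xK qp by (auto simp: G_def)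
          moreover have "y \<in> K" using shape[of x K] xK qp \<open>y \<in> {u<..<v}\<close>
            by (metis greaterThanLessThan_subseteq_atLeastAtMost_iff order_refl subsetD)
          ultimately show "y \<in> U" by blast
        qed
      qed (auto intro!: sets.finite_UN finI)
      also note mU
      finally have "(\<Sum>(a, b)\<in>I. b - a) < \<delta>" .
      from acd[THEN spec, THEN mp, OF conjI[OF finI conjI[OF Iab conjI[OF Idisj this]]]] have I: "(\<Sum>(a, b)\<in>I. dist (\<gamma> a) (\<gamma> b)) < e / 2" .
      have "norm (sum T pN) \<le> (\<Sum>(x,K)\<in>pN. dist (\<gamma> (Inf K)) (\<gamma> (Sup K)))"
        by (rule sum_norm_le) (auto simp: T_def pN_def g'_def dist_norm norm_minus_commute)
      also have "\<dots> = (\<Sum>(x,K)\<in>q. dist (\<gamma> (Inf K)) (\<gamma> (Sup K)))"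
      proof (rule sum.mono_neutral_right)
        show "finite pN" using pNp finp finite_subset by blast
        show "\<forall>i\<in>pN - q. (case i of (x, K) \<Rightarrow> dist (\<gamma> (Inf K)) (\<gamma> (Sup K))) = 0"
          using shape pNp by (auto simp: q_def) (metis antisym_conv2 subsetD)
      qed (auto simp: q_def)
      also have "\<dots> = (\<Sum>(a, b)\<in>I. dist (\<gamma> a) (\<gamma> b))"
        unfolding I_def by (subst sum.reindex[OF inj]) (simp add: split_def)
      finally have B: "norm (sum T pN) < e / 2" using I by linarith
      show "norm ((\<Sum>(x, k)\<in>p. measure lborel k *\<^sub>R g' x) - (\<gamma> b - \<gamma> a)) < e"
        unfolding split using norm_triangle_ineq[of "sum T (p - pN)" "sum T pN"] A B by linarith
    qed
  qed
  then show ?thesis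
    by (rule has_integral_spike[OF N, rotated]) (auto simp: g'_def)
qed

text \<open>
  The differentiation theorem for cubes \<open>{x..x + h}\<close> gives the derivative from the right. Applied to
  the reflected function it gives the derivative from the left.
\<close>

lemma indefinite_integral_has_derivative_ae:
  fixes g :: "real \<Rightarrow> 'b::euclidean_space"
  assumes g: "g integrable_on {a..b}"
  obtains N where "negligible N"
    "\<And>t. t \<in> {a..b} - N \<Longrightarrow> ((\<lambda>s. integral {a..s} g) has_vector_derivative g t) (at t within {a..b})"
proof -
  define f where "f s = (if s \<in> {a..b} then g s else 0)" for s
  have fint: "f integrable_on cbox u v" for u v
    using integrable_altD(1)[OF g] by (simp add: f_def[abs_def])
  have fsub: "integral {u..v} f = integral {u..v} g" if "{u..v} \<subseteq> {a..b}" for u v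
    by (rule integral_cong) (use that in \<open>auto simp: f_def\<close>)
  have frint: "(\<lambda>s. f (- s)) integrable_on cbox u v" for u v
    using fint[of "-v" "-u"] Henstock_Kurzweil_Integration.integrable_reflect_real[of f "-u" "-v"] by (simp add: o_def)
  obtain N1 where N1: "negligible N1" "\<And>x e. \<lbrakk>x \<notin> N1; 0 < e\<rbrakk> \<Longrightarrow>
      \<exists>d>0. \<forall>h. 0 < h \<and> h < d \<longrightarrow> norm(integral {x..x + h} f /\<^sub>R h - f x) < e"
    using integrable_ccontinuous_explicit[of f] fint by auto
  obtain N2 where N2: "negligible N2" "\<And>x e. \<lbrakk>x \<notin> N2; 0 < e\<rbrakk> \<Longrightarrow>
      \<exists>d>0. \<forall>h. 0 < h \<and> h < d \<longrightarrow> norm(integral {x..x + h} (\<lambda>s. f (- s)) /\<^sub>R h - f (- x)) < e"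
    using integrable_ccontinuous_explicit[of "\<lambda>s. f (- s)"] frint by auto
  define N where "N = N1 \<union> uminus ` N2 \<union> {a, b}"
  have "negligible (uminus ` N2)"
    by (rule negligible_differentiable_image_negligible[OF _ N2(1)])
       (auto intro!: derivative_intros simp: differentiable_on_def)
  then have N: "negligible N" using N1(1) by (simp add: N_def)
  have "((\<lambda>s. integral {a..s} g) has_vector_derivative g t) (at t within {a..b})" if t: "t \<in> {a..b} - N" for t
  proof -
    have ti: "a < t" "t < b" "t \<notin> N1" using t by (auto simp: N_def)
    have tN2: "- t \<notin> N2" using t by (force simp: N_def)
    have ft: "f t = g t" using ti by (simp add: f_def)
    show ?thesis unfolding has_vector_derivative_def has_derivative_within_alt
    proof (intro conjI allI impI bounded_linear_scaleR_left)
      fix e :: real assume e: "e > 0"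
      obtain d1 where d1: "d1 > 0" "\<And>h. 0 < h \<Longrightarrow> h < d1 \<Longrightarrow> norm(integral {t..t + h} f /\<^sub>R h - f t) < e"
        using N1(2)[OF ti(3) e] by blast
      obtain d2 where d2: "d2 > 0" "\<And>h. 0 < h \<Longrightarrow> h < d2 \<Longrightarrow> norm(integral {-t..-t + h} (\<lambda>s. f (- s)) /\<^sub>R h - f t) < e"
        using N2(2)[OF tN2 e] by auto
      have key: "norm (I - h *\<^sub>R f t) \<le> e * h" if "norm (I /\<^sub>R h - f t) < e" "h > 0" for I :: 'b and h
      proof -
        have "I - h *\<^sub>R f t = h *\<^sub>R (I /\<^sub>R h - f t)" using that by (simp add: algebra_simps)
        then have "norm (I - h *\<^sub>R f t) = h * norm (I /\<^sub>R h - f t)" using that by simp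
        then show ?thesis using that by (simp add: mult.commute)
      qed
      have comb: "integral {a..u} g + integral {u..v} g = integral {a..v} g" if "a \<le> u" "u \<le> v" "v \<le> b" for u v
        using that integrable_subinterval_real[OF g, of a v]
        by (intro Henstock_Kurzweil_Integration.integral_combine) auto
      show "\<exists>d>0. \<forall>y\<in>{a..b}. norm (y - t) < d \<longrightarrow>
          norm (integral {a..y} g - integral {a..t} g - (y - t) *\<^sub>R g t) \<le> e * norm (y - t)"
      proof (intro exI[of _ "min d1 d2"] conjI ballI impI)
        show "min d1 d2 > 0" using d1 d2 by simp
        fix y assume y: "y \<in> {a..b}" "norm (y - t) < min d1 d2"
        consider "y = t" | "y > t" | "y < t" by linarith
        then show "norm (integral {a..y} g - integral {a..t} g - (y - t) *\<^sub>R g t) \<le> e * norm (y - t)"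
        proof cases
          case 1 then show ?thesis by simp
        next
          case 2
          have "integral {a..y} g - integral {a..t} g = integral {t..y} f"
            using comb[of t y] fsub[of t y] 2 y ti by (auto simp: algebra_simps)
          then show ?thesis using key[OF d1(2)[of "y - t"]] 2 y ft by simp
        next
          case 3
          have "integral {a..t} g - integral {a..y} g = integral {y..t} f"
            using comb[of y t] fsub[of y t] 3 y ti by (auto simp: algebra_simps)
          moreover have "integral {-t..-t + (t - y)} (\<lambda>s. f (- s)) = integral {y..t} f"
            using Henstock_Kurzweil_Integration.integral_reflect_real[of t y f] by simp
          ultimately have "norm ((integral {a..t} g - integral {a..y} g) - (t - y) *\<^sub>R f t) \<le> e * (t - y)"
            using key[OF d2(2)[of "t - y"]] 3 y by simp
          also have "norm ((integral {a..t} g - integral {a..y} g) - (t - y) *\<^sub>R f t)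
             = norm (integral {a..y} g - integral {a..t} g - (y - t) *\<^sub>R g t)"
            unfolding ft by (subst norm_minus_cancel[symmetric]) (simp add: algebra_simps)
          finally show ?thesis using 3 by simp
        qed
      qed
    qed
  qed
  with N that show ?thesis by blast
qed

section \<open>Points reachable with a bounded control\<close>

definition drive :: "nat \<Rightarrow> (nat \<Rightarrow> real^'n \<Rightarrow> real^'n) \<Rightarrow> (nat \<Rightarrow> real \<Rightarrow> real) \<Rightarrow> real \<Rightarrow> real^'n \<Rightarrow> real^'n"
  where "drive m Y h t x = (\<Sum>j=1..m. h j t *\<^sub>R Y j x)"

text \<open>
  The control is bounded by \<open>l\<close> at every time, not only almost everywhere, because it can be changed
  on a null set without affecting the integral equation.
\<close>

definition reach ::
  "nat \<Rightarrow> (real^'n) set \<Rightarrow> (nat \<Rightarrow> real^'n \<Rightarrow> real^'n) \<Rightarrow> real \<Rightarrow> real^'n \<Rightarrow> real^'n \<Rightarrow> bool"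
  where "reach m \<Omega> Y l x y \<longleftrightarrow> (\<exists>\<gamma> h. (\<forall>j\<in>{1..m}. h j integrable_on {0..1}) \<and>
    (\<forall>t\<in>{0..1}. (\<Sum>j=1..m. (h j t)\<^sup>2) \<le> l\<^sup>2) \<and>
    solves (drive m Y h) x \<gamma> \<and> \<gamma> ` {0..1} \<subseteq> \<Omega> \<and> \<gamma> 1 = y)"

lemma control_component_le:
  fixes h :: "nat \<Rightarrow> real"
  assumes "(\<Sum>j=1..m. (h j)\<^sup>2) \<le> l\<^sup>2" "0 \<le> l" "j \<in> {1..m}"
  shows "\<bar>h j\<bar> \<le> l"
proof -
  have "(h j)\<^sup>2 \<le> (\<Sum>j=1..m. (h j)\<^sup>2)"
    by (rule member_le_sum) (use assms in auto)
  then have "(h j)\<^sup>2 \<le> l\<^sup>2" using assms by linarith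
  then show ?thesis using assms(2) by (simp add: abs_le_square_iff[symmetric])
qed

lemma norm_drive_le:
  assumes "(\<Sum>j=1..m. (h j t)\<^sup>2) \<le> l\<^sup>2" "0 \<le> l" "\<And>j. j \<in> {1..m} \<Longrightarrow> norm (Y j x) \<le> M"
  shows "norm (drive m Y h t x) \<le> real m * l * M"
proof -
  have "norm (drive m Y h t x) \<le> (\<Sum>j=1..m. l * M)"
    unfolding drive_def
  proof (rule sum_norm_le)
    fix j assume j: "j \<in> {1..m}"
    have "\<bar>h j t\<bar> * norm (Y j x) \<le> l * M"
      by (rule mult_mono) (use control_component_le[of "\<lambda>j. h j t" m l j] assms j in auto)
    then show "norm (h j t *\<^sub>R Y j x) \<le> l * M" by simp
  qed
  then show ?thesis by simp
qed

lemma norm_drive_diff_le: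
  assumes "(\<Sum>j=1..m. (h j t)\<^sup>2) \<le> l\<^sup>2" "0 \<le> l" "\<And>j. j \<in> {1..m} \<Longrightarrow> norm (Y j x - Z j y) \<le> M"
  shows "norm (drive m Y h t x - drive m Z h t y) \<le> real m * l * M"
proof -
  have "drive m Y h t x - drive m Z h t y = drive m (\<lambda>j _. Y j x - Z j y) h t x"
    by (simp add: drive_def sum_subtractf scaleR_diff_right)
  then show ?thesis using norm_drive_le[of h t m l "\<lambda>j _. Y j x - Z j y" x M] assms by simp
qed

lemma drive_integrable:
  assumes h: "\<And>j. j \<in> {1..m} \<Longrightarrow> h j integrable_on {0..1}"
    and hl: "\<And>t. t \<in> {0..1} \<Longrightarrow> (\<Sum>j=1..m. (h j t)\<^sup>2) \<le> l\<^sup>2" and l: "0 \<le> l"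
    and Y: "\<And>j. j \<in> {1..m} \<Longrightarrow> continuous_on \<Omega> (Y j)"
    and \<gamma>: "continuous_on {0..1} \<gamma>" "\<gamma> ` {0..1} \<subseteq> \<Omega>"
  shows "(\<lambda>s. drive m Y h s (\<gamma> s)) integrable_on {0..1}"
  unfolding drive_def
proof (rule integrable_sum)
  fix j assume j: "j \<in> {1..m}"
  have bl: "bilinear (\<lambda>(c::real) (v::real^'a). c *\<^sub>R v)"
    by (simp add: bilinear_conv_bounded_bilinear bounded_bilinear_scaleR)
  have "(\<lambda>s. h j s *\<^sub>R Y j (\<gamma> s)) absolutely_integrable_on {0..1}"
  proof (rule absolutely_integrable_bounded_measurable_product[OF bl])
    show "h j \<in> borel_measurable (lebesgue_on {0..1})" using h[OF j] by (rule integrable_imp_measurable)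
    show "bounded (h j ` {0..1})"
      unfolding bounded_iff using control_component_le[OF hl l j] by (intro exI[of _ l]) auto
    have "continuous_on {0..1} (\<lambda>s. Y j (\<gamma> s))"
      using continuous_on_compose2[OF Y[OF j] \<gamma>] .
    then show "(\<lambda>s. Y j (\<gamma> s)) absolutely_integrable_on {0..1}"
      by (rule absolutely_integrable_continuous_real)
  qed auto
  then show "(\<lambda>s. h j s *\<^sub>R Y j (\<gamma> s)) integrable_on {0..1}"
    using set_lebesgue_integral_eq_integral(1) by blast
qed auto

lemma solves_lipschitz:
  assumes \<gamma>: "solves F x \<gamma>" and B: "\<And>t. t \<in> {0..1} \<Longrightarrow> norm (F t (\<gamma> t)) \<le> B"
    and st: "0 \<le> s" "s \<le> t" "t \<le> 1"
  shows "norm (\<gamma> t - \<gamma> s) \<le> B * (t - s)"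
proof -
  have "0 \<le> B" using B[of 0] norm_ge_zero order_trans by (metis atLeastAtMost_iff order_refl zero_le_one)
  then have "norm (\<gamma> t - \<gamma> s) \<le> B * measure lborel (cbox s t)"
    by (rule has_integral_bound[where f = "\<lambda>r. F r (\<gamma> r)"])
       (use solves_between[OF \<gamma> st] B st in auto)
  then show ?thesis using st by simp
qed

lemma lipschitz_imp_absolutely_continuous:
  fixes \<gamma> :: "real \<Rightarrow> 'b::real_normed_vector"
  assumes lip: "\<And>s t. 0 \<le> s \<Longrightarrow> s \<le> t \<Longrightarrow> t \<le> 1 \<Longrightarrow> norm (\<gamma> t - \<gamma> s) \<le> B * (t - s)" and B: "0 \<le> B"
  shows "absolutely_continuous_on {0..1} \<gamma>"
  unfolding absolutely_continuous_on_def
proof (intro allI impI)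
  fix e :: real assume e: "0 < e"
  show "\<exists>\<delta>>0. \<forall>I. finite I \<and> (\<forall>(a, b)\<in>I. a \<le> b \<and> {a..b} \<subseteq> {0..1}) \<and>
        disjoint_family_on (\<lambda>(a, b). {a<..<b}) I \<and> (\<Sum>(a, b)\<in>I. b - a) < \<delta> \<longrightarrow>
        (\<Sum>(a, b)\<in>I. dist (\<gamma> a) (\<gamma> b)) < e"
  proof (intro exI[of _ "e / (B + 1)"] conjI allI impI)
    show "e / (B + 1) > 0" using e B by simp
    fix I :: "(real \<times> real) set"
    assume I: "finite I \<and> (\<forall>(a, b)\<in>I. a \<le> b \<and> {a..b} \<subseteq> {0..1}) \<and>
        disjoint_family_on (\<lambda>(a, b). {a<..<b}) I \<and> (\<Sum>(a, b)\<in>I. b - a) < e / (B + 1)"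
    have "(\<Sum>(a, b)\<in>I. dist (\<gamma> a) (\<gamma> b)) \<le> (\<Sum>(a, b)\<in>I. (B + 1) * (b - a))"
    proof (rule sum_mono)
      fix i assume i: "i \<in> I"
      obtain a b where ab: "i = (a,b)" by fastforce
      have "a \<le> b" "{a..b} \<subseteq> {0..1}" using I i ab by auto
      then have "norm (\<gamma> b - \<gamma> a) \<le> B * (b - a)" "b - a \<ge> 0" by (auto intro: lip)
      then show "(case i of (a, b) \<Rightarrow> dist (\<gamma> a) (\<gamma> b)) \<le> (case i of (a, b) \<Rightarrow> (B + 1) * (b - a))"
        by (simp add: ab dist_norm norm_minus_commute algebra_simps)
    qed
    also have "\<dots> = (B + 1) * (\<Sum>(a, b)\<in>I. b - a)" by (simp add: sum_distrib_left split_def)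
    also have "\<dots> < (B + 1) * (e / (B + 1))" using I B by (intro mult_strict_left_mono) auto
    also have "\<dots> = e" using B by simp
    finally show "(\<Sum>(a, b)\<in>I. dist (\<gamma> a) (\<gamma> b)) < e" .
  qed
qed

lemma absolutely_continuous_on_subset:
  assumes "absolutely_continuous_on T \<gamma>" "S \<subseteq> T"
  shows "absolutely_continuous_on S \<gamma>"
  using assms(1) unfolding absolutely_continuous_on_def
  by (elim all_forward imp_forward ex_forward conj_forward) (use assms(2) in fast)+

lemma AE_lebesgue_on_iff_negligible:
  assumes "S \<in> sets lebesgue"
  shows "(AE t in lebesgue_on S. P t) \<longleftrightarrow> (\<exists>N. negligible N \<and> (\<forall>t\<in>S - N. P t))"
proof -
  have "(AE t in lebesgue_on S. P t) \<longleftrightarrow> (AE t in lebesgue. t \<in> S \<longrightarrow> P t)"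
    by (rule AE_restrict_space_iff) (use assms in auto)
  also have "\<dots> \<longleftrightarrow> (\<exists>N. negligible N \<and> {t. \<not> (t \<in> S \<longrightarrow> P t)} \<subseteq> N)"
    by (rule eventually_ae_filter_negligible)
  also have "\<dots> \<longleftrightarrow> (\<exists>N. negligible N \<and> (\<forall>t\<in>S - N. P t))"
    by (intro ex_cong conj_cong) auto
  finally show ?thesis .
qed

text \<open>
  The solution is Lipschitz, hence absolutely continuous, and by the differentiation theorem it has
  the required derivative at almost every time.
\<close>

lemma reach_imp_sr_dist_le:
  assumes r: "reach m \<Omega> Y l x y" and l: "0 \<le> l"
    and Y: "\<And>j. j \<in> {1..m} \<Longrightarrow> continuous_on \<Omega> (Y j)"
  shows "sr_dist m \<Omega> Y x y \<le> ereal l"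
proof -
  obtain \<gamma> h where h: "\<And>j. j \<in> {1..m} \<Longrightarrow> h j integrable_on {0..1}"
    and hl: "\<And>t. t \<in> {0..1} \<Longrightarrow> (\<Sum>j=1..m. (h j t)\<^sup>2) \<le> l\<^sup>2"
    and \<gamma>: "solves (drive m Y h) x \<gamma>" "\<gamma> ` {0..1} \<subseteq> \<Omega>" "\<gamma> 1 = y"
    using r unfolding reach_def by blast
  have cont: "continuous_on {0..1} \<gamma>" using \<gamma>(1) by (simp add: solves_def)
  have "bounded (\<Union>j\<in>{1..m}. (\<lambda>t. Y j (\<gamma> t)) ` {0..1})"
  proof (intro bounded_UN finite_atLeastAtMost ballI compact_imp_bounded compact_continuous_image)
    fix j assume "j \<in> {1..m}"
    then show "continuous_on {0..1} (\<lambda>t. Y j (\<gamma> t))"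
      using continuous_on_compose2[OF Y cont \<gamma>(2)] by blast
  qed auto
  then obtain M where M: "\<And>j t. j \<in> {1..m} \<Longrightarrow> t \<in> {0..1} \<Longrightarrow> norm (Y j (\<gamma> t)) \<le> M" "0 < M"
    unfolding bounded_pos by blast
  have lip: "norm (\<gamma> t - \<gamma> s) \<le> (real m * l * M) * (t - s)" if "0 \<le> s" "s \<le> t" "t \<le> 1" for s t
    by (rule solves_lipschitz[OF \<gamma>(1) _ that]) (intro norm_drive_le hl l M)
  have ac: "absolutely_continuous_on {0..1} \<gamma>"
    by (rule lipschitz_imp_absolutely_continuous[OF lip]) (use l M in auto)
  have "(\<lambda>s. drive m Y h s (\<gamma> s)) integrable_on {0..1}"
    by (rule drive_integrable[OF h hl l Y cont \<gamma>(2)])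
  then obtain N where N: "negligible N" "\<And>t. t \<in> {0..1} - N \<Longrightarrow>
      ((\<lambda>r. integral {0..r} (\<lambda>s. drive m Y h s (\<gamma> s))) has_vector_derivative drive m Y h t (\<gamma> t)) (at t within {0..1})"
    by (rule indefinite_integral_has_derivative_ae) blast
  have "(\<gamma> has_vector_derivative drive m Y h t (\<gamma> t)) (at t within {0..1})" if t: "t \<in> {0..1} - N" for t
  proof (rule has_vector_derivative_transform)
    show "t \<in> {0..1}" using t by simp
    show "((\<lambda>r. x + integral {0..r} (\<lambda>s. drive m Y h s (\<gamma> s))) has_vector_derivative drive m Y h t (\<gamma> t)) (at t within {0..1})"
      using N(2)[OF t] by (auto intro!: derivative_eq_intros)
    fix r :: real assume "r \<in> {0..1}"
    then have "((\<lambda>s. drive m Y h s (\<gamma> s)) has_integral (\<gamma> r - x)) {0..r}"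
      using \<gamma>(1) by (simp add: solves_def)
    then show "\<gamma> r = x + integral {0..r} (\<lambda>s. drive m Y h s (\<gamma> s))"
      by (simp add: integral_unique)
  qed
  then have ae: "AE t in lebesgue_on {0..1}. (\<gamma> has_vector_derivative (\<Sum>j=1..m. h j t *\<^sub>R Y j (\<gamma> t))) (at t within {0..1})"
    using N(1) unfolding drive_def by (subst AE_lebesgue_on_iff_negligible) auto
  have hm: "\<forall>j\<in>{1..m}. h j \<in> borel_measurable (lebesgue_on {0..1})"
    using h integrable_imp_measurable by blast
  have "horizontal_curve m \<Omega> Y x y \<gamma> h"
    unfolding horizontal_curve_def
    using ac \<gamma>(2,3) solves_start[OF \<gamma>(1)] hm ae by blast
  then have "sr_dist m \<Omega> Y x y \<le> control_norm m h"
    unfolding sr_dist_def by (intro Inf_lower) blast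
  also have "control_norm m h \<le> ereal l"
    unfolding control_norm_def
  proof (rule esssup_I)
    have [measurable]: "(\<lambda>t. \<Sum>j=1..m. (h j t)\<^sup>2) \<in> borel_measurable (lebesgue_on {0..1})"
      using hm by (intro borel_measurable_sum borel_measurable_power) auto
    show "(\<lambda>t. ereal (sqrt (\<Sum>j=1..m. (h j t)\<^sup>2))) \<in> borel_measurable (lebesgue_on {0..1})"
      by measurable
    show "AE t in lebesgue_on {0..1}. ereal (sqrt (\<Sum>j=1..m. (h j t)\<^sup>2)) \<le> ereal l"
      by (rule AE_I2) (use hl l in \<open>auto intro: real_le_lsqrt sum_nonneg\<close>)
  qed
  finally show ?thesis .
qed

text \<open>
  The control of a horizontal curve of norm less than \<open>l\<close> is set to \<open>0\<close> at the null set of times at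
  which it exceeds \<open>l\<close>; the fundamental theorem for absolutely continuous functions turns the differential
  equation into the integral equation.
\<close>

lemma sr_dist_less_imp_reach:
  assumes d: "sr_dist m \<Omega> Y x y < ereal l"
  shows "reach m \<Omega> Y l x y"
proof -
  obtain \<gamma> h where hc: "horizontal_curve m \<Omega> Y x y \<gamma> h" and cn: "control_norm m h < ereal l"
    using d unfolding sr_dist_def Inf_less_iff by blast
  have ac: "absolutely_continuous_on {0..1} \<gamma>" and im: "\<gamma> ` {0..1} \<subseteq> \<Omega>" and ends: "\<gamma> 0 = x" "\<gamma> 1 = y"
    and hm: "\<And>j. j \<in> {1..m} \<Longrightarrow> h j \<in> borel_measurable (lebesgue_on {0..1})"
    and ae: "AE t in lebesgue_on {0..1}.
      (\<gamma> has_vector_derivative (\<Sum>j=1..m. h j t *\<^sub>R Y j (\<gamma> t))) (at t within {0..1})"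
    using hc unfolding horizontal_curve_def by blast+
  have "AE t in lebesgue_on {0..1}. ereal (sqrt (\<Sum>j=1..m. (h j t)\<^sup>2)) \<le> control_norm m h"
    unfolding control_norm_def by (rule esssup_AE)
  then have "AE t in lebesgue_on {0..1}. (\<Sum>j=1..m. (h j t)\<^sup>2) \<le> l\<^sup>2"
  proof eventually_elim
    fix t assume "ereal (sqrt (\<Sum>j=1..m. (h j t)\<^sup>2)) \<le> control_norm m h"
    also note cn
    finally have "sqrt (\<Sum>j=1..m. (h j t)\<^sup>2) < l" by simp
    then show "(\<Sum>j=1..m. (h j t)\<^sup>2) \<le> l\<^sup>2"
      by (simp add: sqrt_le_D)
  qed
  with ae have "AE t in lebesgue_on {0..1}. (\<Sum>j=1..m. (h j t)\<^sup>2) \<le> l\<^sup>2 \<and>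
      (\<gamma> has_vector_derivative (\<Sum>j=1..m. h j t *\<^sub>R Y j (\<gamma> t))) (at t within {0..1})"
    by eventually_elim auto
  then obtain N where N: "negligible N" "\<And>t. t \<in> {0..1} - N \<Longrightarrow> (\<Sum>j=1..m. (h j t)\<^sup>2) \<le> l\<^sup>2"
    "\<And>t. t \<in> {0..1} - N \<Longrightarrow> (\<gamma> has_vector_derivative (\<Sum>j=1..m. h j t *\<^sub>R Y j (\<gamma> t))) (at t within {0..1})"
    by (subst (asm) AE_lebesgue_on_iff_negligible) auto
  define k where "k j t = (if (\<Sum>i=1..m. (h i t)\<^sup>2) \<le> l\<^sup>2 then h j t else 0)" for j t
  have kl: "(\<Sum>j=1..m. (k j t)\<^sup>2) \<le> l\<^sup>2" for t
    by (cases "(\<Sum>i=1..m. (h i t)\<^sup>2) \<le> l\<^sup>2") (simp_all only: k_def if_True if_False, simp_all)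
  have kint: "k j integrable_on {0..1}" if j: "j \<in> {1..m}" for j
  proof (rule measurable_bounded_by_integrable_imp_integrable)
    have [measurable]: "h j \<in> borel_measurable (lebesgue_on {0..1})" using hm j by blast
    have [measurable]: "(\<lambda>t. \<Sum>i=1..m. (h i t)\<^sup>2) \<in> borel_measurable (lebesgue_on {0..1})"
      using hm by (intro borel_measurable_sum borel_measurable_power) auto
    show "k j \<in> borel_measurable (lebesgue_on {0..1})"
      unfolding k_def[abs_def] by measurable
    show "(\<lambda>_. \<bar>l\<bar>) integrable_on {0..1::real}" by (rule integrable_const_ivl)
    show "norm (k j t) \<le> \<bar>l\<bar>" for t
      using control_component_le[of "\<lambda>j. k j t" m "\<bar>l\<bar>" j] kl j by simp
  qed auto
  have der: "(\<gamma> has_vector_derivative drive m Y k t (\<gamma> t)) (at t within {0..1})" if "t \<in> {0..1} - N" for t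
    using N(2,3)[OF that] by (simp add: drive_def k_def)
  have acs: "absolutely_continuous_on {0..t} \<gamma>" if "t \<le> 1" for t
    by (rule absolutely_continuous_on_subset[OF ac]) (use that in auto)
  have sol: "((\<lambda>s. drive m Y k s (\<gamma> s)) has_integral (\<gamma> t - x)) {0..t}" if t: "t \<in> {0..1}" for t
    unfolding ends(1)[symmetric]
    by (rule absolutely_continuous_has_integral[OF acs _ N(1)])
       (use t in \<open>auto intro!: has_vector_derivative_within_subset[OF der]\<close>)
  have "(\<lambda>s. drive m Y k s (\<gamma> s)) integrable_on {0..1}"
    using sol[of 1] by (auto simp: integrable_on_def)
  then have "continuous_on {0..1} (\<lambda>t. x + integral {0..t} (\<lambda>s. drive m Y k s (\<gamma> s)))"
    by (intro continuous_intros indefinite_integral_continuous_1)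
  then have "continuous_on {0..1} \<gamma>"
    by (rule continuous_on_eq) (simp add: integral_unique[OF sol])
  with sol have "solves (drive m Y k) x \<gamma>"
    unfolding solves_def by blast
  then show ?thesis
    unfolding reach_def using kint kl im ends(2) by blast
qed

lemma reach_refl: "x \<in> \<Omega> \<Longrightarrow> reach m \<Omega> Y l x x"
  unfolding reach_def
  by (rule exI[of _ "\<lambda>_. x"], rule exI[of _ "\<lambda>_ _. 0"]) (auto simp: solves_def drive_def)

lemma reach_mono:
  assumes "reach m \<Omega> Y l x y" "0 \<le> l" "l \<le> l'"
  shows "reach m \<Omega> Y l' x y"
proof -
  have "l\<^sup>2 \<le> l'\<^sup>2" using assms by (intro power_mono)
  then have "(\<forall>t\<in>{0..1}. (\<Sum>j=1..m. (h j t)\<^sup>2) \<le> l\<^sup>2) \<Longrightarrow> \<forall>t\<in>{0..1}. (\<Sum>j=1..m. (h j t)\<^sup>2) \<le> l'\<^sup>2"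
    for h :: "nat \<Rightarrow> real \<Rightarrow> real"
    by force
  then show ?thesis using assms(1) unfolding reach_def by blast
qed

lemma has_integral_affine_01:
  fixes f :: "real \<Rightarrow> 'b::real_normed_vector"
  assumes "(f has_integral I) {a..b}" "0 < c"
  shows "((\<lambda>s. c *\<^sub>R f (c * s + d)) has_integral I) {(a - d) / c..(b - d) / c}"
  using has_integral_cmul[OF has_integral_affinity'[of f I a b c d], of c] assms
  by (simp add: divide_inverse mult.commute)

text \<open>
  The two curves are run one after the other on the unit interval. Giving the first one the
  fraction \<open>l1 / (l1 + l2)\<close> of the time makes both rescaled controls bounded by \<open>l1 + l2\<close>.
\<close>

lemma reach_trans_pos:
  assumes r1: "reach m \<Omega> Y l1 x y" and r2: "reach m \<Omega> Y l2 y z" and l: "0 < l1" "0 < l2"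
  shows "reach m \<Omega> Y (l1 + l2) x z"
proof -
  obtain \<gamma>1 h1 where h1: "\<And>j. j \<in> {1..m} \<Longrightarrow> h1 j integrable_on {0..1}"
    and hl1: "\<And>t. t \<in> {0..1} \<Longrightarrow> (\<Sum>j=1..m. (h1 j t)\<^sup>2) \<le> l1\<^sup>2"
    and \<gamma>1: "solves (drive m Y h1) x \<gamma>1" "\<gamma>1 ` {0..1} \<subseteq> \<Omega>" "\<gamma>1 1 = y"
    using r1 unfolding reach_def by blast
  obtain \<gamma>2 h2 where h2: "\<And>j. j \<in> {1..m} \<Longrightarrow> h2 j integrable_on {0..1}"
    and hl2: "\<And>t. t \<in> {0..1} \<Longrightarrow> (\<Sum>j=1..m. (h2 j t)\<^sup>2) \<le> l2\<^sup>2"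
    and \<gamma>2: "solves (drive m Y h2) y \<gamma>2" "\<gamma>2 ` {0..1} \<subseteq> \<Omega>" "\<gamma>2 1 = z"
    using r2 unfolding reach_def by blast
  define \<theta> where "\<theta> = l1 / (l1 + l2)"
  \<comment> \<open>\<open>t \<mapsto> c1 * t\<close> maps \<open>{0..\<theta>}\<close> and \<open>t \<mapsto> c2 * t + d2\<close> maps \<open>{\<theta>..1}\<close> onto the unit interval.\<close>
  define c1 where "c1 = (l1 + l2) / l1"
  define c2 where "c2 = (l1 + l2) / l2"
  define d2 where "d2 = - (l1 / l2)"
  have c: "0 < c1" "0 < c2" using l by (auto simp: c1_def c2_def)
  have \<theta>: "0 < \<theta>" "\<theta> < 1" using l by (auto simp: \<theta>_def)
  have lsum: "l1 + l2 \<noteq> 0" "l1 \<noteq> 0" "l2 \<noteq> 0" using l by auto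
  have e3: "c1 * \<theta> = 1" "c2 * \<theta> + d2 = 0" "c2 + d2 = 1"
    using lsum by (simp_all only: c1_def c2_def d2_def \<theta>_def) (simp_all add: divide_simps)
  have e1: "c1 * t \<in> {0..1}" if "t \<in> {0..\<theta>}" for t
    using mult_left_mono[of t \<theta> c1] that c e3 by auto
  have e2: "c2 * t + d2 \<in> {0..1}" if "t \<in> {\<theta>..1}" for t
  proof -
    have "c2 * \<theta> \<le> c2 * t" "c2 * t \<le> c2 * 1" using that c by simp_all
    then show ?thesis using e3 unfolding atLeastAtMost_iff by linarith
  qed
  have e4: "(0 - d2) / c2 = \<theta>" "(1 - d2) / c2 = 1" "1 / c1 = \<theta>"
    using e3 c by (simp_all add: field_simps)
  have e5: "(c2 * t + d2 - d2) / c2 = t" for t using c by simp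
  define h where "h j t = (if t \<le> \<theta> then c1 * h1 j (c1 * t) else c2 * h2 j (c2 * t + d2))" for j t
  define \<gamma> where "\<gamma> t = (if t \<le> \<theta> then \<gamma>1 (c1 * t) else \<gamma>2 (c2 * t + d2))" for t
  have \<gamma>20: "\<gamma>2 0 = y" using solves_start[OF \<gamma>2(1)] .
  have part1: "((\<lambda>s. drive m Y h s (\<gamma> s)) has_integral (\<gamma> t - x)) {0..t}" if t: "t \<in> {0..\<theta>}" for t
  proof -
    have "((\<lambda>s. drive m Y h1 s (\<gamma>1 s)) has_integral (\<gamma>1 (c1 * t) - x)) {0..c1 * t}"
      using \<gamma>1(1) e1[OF t] by (simp add: solves_def)
    from has_integral_affine_01[OF this c(1), of 0]
    have i: "((\<lambda>s. c1 *\<^sub>R drive m Y h1 (c1 * s) (\<gamma>1 (c1 * s))) has_integral (\<gamma>1 (c1 * t) - x)) {0..t}"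
      using c by simp
    moreover have "\<gamma>1 (c1 * t) = \<gamma> t" using t by (simp add: \<gamma>_def)
    moreover have "c1 *\<^sub>R drive m Y h1 (c1 * s) (\<gamma>1 (c1 * s)) = drive m Y h s (\<gamma> s)" if "s \<in> {0..t}" for s
      using that t by (simp add: drive_def h_def \<gamma>_def scaleR_sum_right)
    ultimately show ?thesis using has_integral_eq[OF _ i, of "\<lambda>s. drive m Y h s (\<gamma> s)"] by simp
  qed
  have part2: "((\<lambda>s. drive m Y h s (\<gamma> s)) has_integral (\<gamma> t - y)) {\<theta>..t}" if t: "t \<in> {\<theta>..1}" for t
  proof -
    have "((\<lambda>s. drive m Y h2 s (\<gamma>2 s)) has_integral (\<gamma>2 (c2 * t + d2) - y)) {0..c2 * t + d2}"
      using \<gamma>2(1) e2[OF t] by (simp add: solves_def)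
    from has_integral_affine_01[OF this c(2), of d2]
    have i: "((\<lambda>s. c2 *\<^sub>R drive m Y h2 (c2 * s + d2) (\<gamma>2 (c2 * s + d2))) has_integral (\<gamma>2 (c2 * t + d2) - y)) {\<theta>..t}"
      using e4(1) e5 by simp
    have \<gamma>t: "\<gamma>2 (c2 * t + d2) = \<gamma> t"
      using t e3 \<gamma>1(3) \<gamma>20 by (cases "t = \<theta>") (auto simp: \<gamma>_def)
    have "((\<lambda>s. drive m Y h s (\<gamma> s)) has_integral (\<gamma>2 (c2 * t + d2) - y)) {\<theta>..t}"
      by (rule has_integral_spike[OF _ _ i, of "{\<theta>}"])
         (use t in \<open>auto simp: drive_def h_def \<gamma>_def scaleR_sum_right\<close>)
    then show ?thesis by (simp add: \<gamma>t)
  qed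
  have \<gamma>\<theta>: "\<gamma> \<theta> = y" using e3 \<gamma>1(3) by (simp add: \<gamma>_def)
  have sol: "((\<lambda>s. drive m Y h s (\<gamma> s)) has_integral (\<gamma> t - x)) {0..t}" if t: "t \<in> {0..1}" for t
  proof (cases "t \<le> \<theta>")
    case True then show ?thesis using part1 t by simp
  next
    case False
    have "((\<lambda>s. drive m Y h s (\<gamma> s)) has_integral ((\<gamma> \<theta> - x) + (\<gamma> t - y))) {0..t}"
      by (rule has_integral_combine[OF _ _ part1 part2]) (use False t \<theta> in auto)
    then show ?thesis using \<gamma>\<theta> by simp
  qed
  have im: "\<gamma> ` {0..1} \<subseteq> \<Omega>"
  proof
    fix p assume "p \<in> \<gamma> ` {0..1}"
    then obtain t where t: "t \<in> {0..1}" "p = \<gamma> t" by blast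
    then show "p \<in> \<Omega>"
      using \<gamma>1(2) \<gamma>2(2) e1[of t] e2[of t] by (auto simp: \<gamma>_def)
  qed
  have "continuous_on ({0..\<theta>} \<union> {\<theta>..1}) (\<lambda>t. if t \<le> \<theta> then \<gamma>1 (c1 * t) else \<gamma>2 (c2 * t + d2))"
  proof (rule continuous_on_If)
    show "continuous_on {0..\<theta>} (\<lambda>t. \<gamma>1 (c1 * t))"
      by (rule continuous_on_compose2[of "{0..1}" \<gamma>1]) (use \<gamma>1(1) e1 in \<open>auto simp: solves_def intro!: continuous_intros\<close>)
    show "continuous_on {\<theta>..1} (\<lambda>t. \<gamma>2 (c2 * t + d2))"
      by (rule continuous_on_compose2[of "{0..1}" \<gamma>2]) (use \<gamma>2(1) e2 in \<open>auto simp: solves_def intro!: continuous_intros\<close>)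
  qed (use e3 \<gamma>1(3) \<gamma>20 in auto)
  moreover have "{0..\<theta>} \<union> {\<theta>..1} = {0..1}" using \<theta> by auto
  ultimately have cont: "continuous_on {0..1} \<gamma>" by (simp add: \<gamma>_def[abs_def])
  have hint: "h j integrable_on {0..1}" if j: "j \<in> {1..m}" for j
  proof -
    obtain I1 I2 where I: "(h1 j has_integral I1) {0..1}" "(h2 j has_integral I2) {0..1}"
      using h1[OF j] h2[OF j] by (auto simp: integrable_on_def)
    have "((\<lambda>s. c1 * h1 j (c1 * s)) has_integral I1) {0..\<theta>}"
      using has_integral_affine_01[OF I(1) c(1), of 0] e4 by simp
    then have a: "(h j has_integral I1) {0..\<theta>}"
      by (rule has_integral_eq[rotated]) (auto simp: h_def)
    have "((\<lambda>s. c2 * h2 j (c2 * s + d2)) has_integral I2) {\<theta>..1}"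
      using has_integral_affine_01[OF I(2) c(2), of d2] e4 by simp
    then have b: "(h j has_integral I2) {\<theta>..1}"
      by (rule has_integral_spike[of "{\<theta>}", rotated 2]) (auto simp: h_def)
    have "(h j has_integral (I1 + I2)) {0..1}"
      by (rule has_integral_combine[OF _ _ a b]) (use \<theta> in auto)
    then show ?thesis by (auto simp: integrable_on_def)
  qed
  have hl: "(\<Sum>j=1..m. (h j t)\<^sup>2) \<le> (l1 + l2)\<^sup>2" if t: "t \<in> {0..1}" for t
  proof (cases "t \<le> \<theta>")
    case True
    have "(\<Sum>j=1..m. (h j t)\<^sup>2) = c1\<^sup>2 * (\<Sum>j=1..m. (h1 j (c1 * t))\<^sup>2)"
      using True by (simp add: h_def power_mult_distrib sum_distrib_left)
    also have "\<dots> \<le> c1\<^sup>2 * l1\<^sup>2" using hl1 e1 True t by (intro mult_left_mono) auto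
    also have "\<dots> = (c1 * l1)\<^sup>2" by (simp add: power_mult_distrib)
    also have "c1 * l1 = l1 + l2" using l by (simp add: c1_def)
    finally show ?thesis .
  next
    case False
    have "(\<Sum>j=1..m. (h j t)\<^sup>2) = c2\<^sup>2 * (\<Sum>j=1..m. (h2 j (c2 * t + d2))\<^sup>2)"
      using False by (simp add: h_def power_mult_distrib sum_distrib_left)
    also have "\<dots> \<le> c2\<^sup>2 * l2\<^sup>2" using hl2 e2 False t by (intro mult_left_mono) auto
    also have "\<dots> = (c2 * l2)\<^sup>2" by (simp add: power_mult_distrib)
    also have "c2 * l2 = l1 + l2" using l by (simp add: c2_def)
    finally show ?thesis .
  qed
  have "\<gamma> 1 = z" using \<theta> e3 \<gamma>2(3) by (simp add: \<gamma>_def)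
  then show ?thesis
    unfolding reach_def solves_def using hint hl sol cont im by blast
qed

section \<open>Flows of Lipschitz fields and their compositions\<close>

definition flow_curve :: "(real^'n \<Rightarrow> real^'n) \<Rightarrow> real \<Rightarrow> real^'n \<Rightarrow> real \<Rightarrow> real^'n"
  where "flow_curve Z s x = (SOME \<gamma>. solves (\<lambda>_ y. s *\<^sub>R Z y) x \<gamma>)"

text \<open>
  The flow for the time \<open>s\<close> is the time-one flow of \<open>s Z\<close>, so that negative times need no separate
  treatment.
\<close>

definition flow :: "(real^'n \<Rightarrow> real^'n) \<Rightarrow> real \<Rightarrow> real^'n \<Rightarrow> real^'n"
  where "flow Z s x = flow_curve Z s x 1"

definition lip :: "real \<Rightarrow> (real^'n \<Rightarrow> real^'n) \<Rightarrow> bool"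
  where "lip L Z \<longleftrightarrow> 0 \<le> L \<and> (\<forall>x y. norm (Z x - Z y) \<le> L * norm (x - y))"

lemma lipD: "lip L Z \<Longrightarrow> norm (Z x - Z y) \<le> L * norm (x - y)"
  and lip_nonneg: "lip L Z \<Longrightarrow> 0 \<le> L"
  by (auto simp: lip_def)

lemma lip_imp_continuous_on:
  assumes "lip L Z" shows "continuous_on S Z"
proof -
  have "L-lipschitz_on S Z"
    using assms by (auto simp: lip_def dist_norm intro!: lipschitz_onI)
  then show ?thesis by (rule lipschitz_on_continuous_on)
qed

lemma lip_scaleR_le: "lip L Z \<Longrightarrow> norm (s *\<^sub>R Z x - s *\<^sub>R Z y) \<le> (\<bar>s\<bar> * L) * norm (x - y)"
  using mult_left_mono[OF lipD[of L Z x y], of "\<bar>s\<bar>"] by (simp flip: scaleR_diff_right)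

lemma flow_curve_solves:
  assumes "lip L Z"
  shows "solves (\<lambda>_ y. s *\<^sub>R Z y) x (flow_curve Z s x)"
proof -
  have "\<exists>\<gamma>. solves (\<lambda>_ y. s *\<^sub>R Z y) x \<gamma>"
  proof (rule solution_exists[where L = "\<bar>s\<bar> * L"])
  fix \<gamma> :: "real \<Rightarrow> real^'a" assume "continuous_on {0..1} \<gamma>"
  then have "continuous_on {0..1} (\<lambda>t. s *\<^sub>R Z (\<gamma> t))"
    by (intro continuous_intros continuous_on_compose2[OF lip_imp_continuous_on[OF assms]]) auto
  then show "(\<lambda>t. s *\<^sub>R Z (\<gamma> t)) integrable_on {0..1}" by (rule integrable_continuous_real)
  qed (use lip_scaleR_le[OF assms] lip_nonneg[OF assms] in auto)
  then show ?thesis unfolding flow_curve_def by (rule someI_ex)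
qed

lemma flow_close:
  assumes Z: "lip L Z" and Z': "lip L' Z'" and \<eta>: "\<And>y. norm (s *\<^sub>R Z y - s' *\<^sub>R Z' y) \<le> \<eta>"
  shows "norm (flow Z s x - flow Z' s' x') \<le> (norm (x - x') + \<eta>) * exp (\<bar>s\<bar> * L)"
  unfolding flow_def
  by (rule solutions_close[OF flow_curve_solves[OF Z] flow_curve_solves[OF Z']])
     (use lip_scaleR_le[OF Z] \<eta> lip_nonneg[OF Z] in auto)

lemma flow_unique:
  assumes Z: "lip L Z" and \<gamma>: "solves (\<lambda>_ y. s *\<^sub>R Z y) x \<gamma>" and t: "t \<in> {0..1}"
  shows "\<gamma> t = flow_curve Z s x t"
  using solutions_close[OF \<gamma> flow_curve_solves[OF Z, of s x], of "\<bar>s\<bar> * L" 0 t]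
    lip_scaleR_le[OF Z] lip_nonneg[OF Z] t by simp

lemma flow_curve_move:
  assumes Z: "lip L Z" and M: "\<And>y. norm (Z y) \<le> M" and t: "t \<in> {0..1}"
  shows "norm (flow_curve Z s x t - x) \<le> M * \<bar>s\<bar>"
proof -
  have "norm (flow_curve Z s x t - flow_curve Z s x 0) \<le> (\<bar>s\<bar> * M) * (t - 0)"
    by (rule solves_lipschitz[OF flow_curve_solves[OF Z]]) (use M t in \<open>auto intro: mult_left_mono\<close>)
  also have "\<dots> \<le> (\<bar>s\<bar> * M) * 1"
    using M[of 0] t by (intro mult_left_mono) (auto intro: mult_nonneg_nonneg order_trans[OF norm_ge_zero])
  finally show ?thesis
    using solves_start[OF flow_curve_solves[OF Z, of s x]] by (simp add: mult.commute)
qed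

lemma flow_move:
  assumes "lip L Z" "\<And>y. norm (Z y) \<le> M"
  shows "norm (flow Z s x - x) \<le> M * \<bar>s\<bar>"
  unfolding flow_def by (rule flow_curve_move[OF assms]) simp

lemma flow_first_order:
  assumes Z: "lip L Z" and M: "\<And>y. norm (Z y) \<le> M"
  shows "norm (flow Z s x - x - s *\<^sub>R Z x) \<le> L * M * s\<^sup>2"
proof -
  have "((\<lambda>t. s *\<^sub>R Z (flow_curve Z s x t)) has_integral (flow Z s x - x)) {0..1}"
    using flow_curve_solves[OF Z, of s x] unfolding solves_def flow_def by auto
  from has_integral_diff[OF this has_integral_const_real[of "s *\<^sub>R Z x" 0 1]]
  have i: "((\<lambda>t. s *\<^sub>R Z (flow_curve Z s x t) - s *\<^sub>R Z x) has_integral (flow Z s x - x - s *\<^sub>R Z x)) (cbox 0 1)"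
    by simp
  have M0: "0 \<le> M" using M[of 0] norm_ge_zero order_trans by blast
  have "norm (flow Z s x - x - s *\<^sub>R Z x) \<le> (L * M * s\<^sup>2) * measure lborel (cbox 0 (1::real))"
  proof (rule has_integral_bound[OF _ i])
    show "0 \<le> L * M * s\<^sup>2" using M0 lip_nonneg[OF Z] by simp
    fix t :: real assume t: "t \<in> cbox 0 1"
    have "norm (s *\<^sub>R Z (flow_curve Z s x t) - s *\<^sub>R Z x) \<le> (\<bar>s\<bar> * L) * norm (flow_curve Z s x t - x)"
      by (rule lip_scaleR_le[OF Z])
    also have "\<dots> \<le> (\<bar>s\<bar> * L) * (M * \<bar>s\<bar>)"
      by (rule mult_left_mono[OF flow_curve_move[OF Z M]]) (use t lip_nonneg[OF Z] in auto)
    finally show "norm (s *\<^sub>R Z (flow_curve Z s x t) - s *\<^sub>R Z x) \<le> L * M * s\<^sup>2"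
      by (simp add: power2_eq_square mult_ac)
  qed
  then show ?thesis by simp
qed

text \<open>
  The reversed curve solves the equation of the opposite field.
\<close>

lemma flow_inverse:
  assumes Z: "lip L Z"
  shows "flow Z (- s) (flow Z s x) = x"
proof -
  define \<gamma> where "\<gamma> = flow_curve Z s x"
  have \<gamma>: "solves (\<lambda>_ y. s *\<^sub>R Z y) x \<gamma>" unfolding \<gamma>_def by (rule flow_curve_solves[OF Z])
  have "solves (\<lambda>_ y. (- s) *\<^sub>R Z y) (\<gamma> 1) (\<lambda>t. \<gamma> (1 - t))"
    unfolding solves_def
  proof (intro conjI ballI)
    show "continuous_on {0..1} (\<lambda>t. \<gamma> (1 - t))"
      by (rule continuous_on_compose2[of "{0..1}" \<gamma>]) (use \<gamma> in \<open>auto simp: solves_def intro!: continuous_intros\<close>)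
    fix t :: real assume t: "t \<in> {0..1}"
    have "((\<lambda>r. s *\<^sub>R Z (\<gamma> r)) has_integral (\<gamma> 1 - \<gamma> (1 - t))) (cbox (1 - t) 1)"
      using solves_between[OF \<gamma>, of "1 - t" 1] t by simp
    from has_integral_affinity[OF this, of "-1" 1]
    have "((\<lambda>r. s *\<^sub>R Z (\<gamma> (1 - r))) has_integral (\<gamma> 1 - \<gamma> (1 - t))) ((\<lambda>x. 1 - x) ` {1 - t..1})"
      by simp
    moreover have "(\<lambda>x. 1 - x) ` {1 - t..1} = {0..t}" by simp
    ultimately have "((\<lambda>r. s *\<^sub>R Z (\<gamma> (1 - r))) has_integral (\<gamma> 1 - \<gamma> (1 - t))) {0..t}" by simp
    from has_integral_neg[OF this]
    show "((\<lambda>r. (- s) *\<^sub>R Z (\<gamma> (1 - r))) has_integral (\<gamma> (1 - t) - \<gamma> 1)) {0..t}" by simp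
  qed
  from flow_unique[OF Z this, of 1] have "\<gamma> 0 = flow Z (- s) (\<gamma> 1)" by (simp add: flow_def)
  then show ?thesis using solves_start[OF \<gamma>] by (simp add: \<gamma>_def flow_def)
qed

lemma flow_tendsto:
  assumes Z: "lip L Z" and M: "\<And>y. norm (Z y) \<le> M"
    and f: "(f \<longlongrightarrow> s) F" and g: "(g \<longlongrightarrow> x) F"
  shows "((\<lambda>n. flow Z (f n) (g n)) \<longlongrightarrow> flow Z s x) F"
proof -
  have bound: "norm (flow Z s x - flow Z (f n) (g n)) \<le> (norm (x - g n) + \<bar>s - f n\<bar> * M) * exp (\<bar>s\<bar> * L)" for n
  proof (rule flow_close[OF Z Z])
    fix y show "norm (s *\<^sub>R Z y - f n *\<^sub>R Z y) \<le> \<bar>s - f n\<bar> * M"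
    proof -
      have "norm (s *\<^sub>R Z y - f n *\<^sub>R Z y) = \<bar>s - f n\<bar> * norm (Z y)"
        by (simp flip: scaleR_diff_left)
      then show ?thesis using M[of y] by (simp add: mult_left_mono)
    qed
  qed
  have "((\<lambda>n. (norm (x - g n) + \<bar>s - f n\<bar> * M) * exp (\<bar>s\<bar> * L)) \<longlongrightarrow> (norm (x - x) + \<bar>s - s\<bar> * M) * exp (\<bar>s\<bar> * L)) F"
    by (intro tendsto_intros f g)
  then have "((\<lambda>n. (norm (x - g n) + \<bar>s - f n\<bar> * M) * exp (\<bar>s\<bar> * L)) \<longlongrightarrow> 0) F"
    by simp
  then have "((\<lambda>n. flow Z s x - flow Z (f n) (g n)) \<longlongrightarrow> 0) F"
    by (rule Lim_null_comparison[rotated]) (simp add: bound)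
  from tendsto_diff[OF tendsto_const[of "flow Z s x"] this] show ?thesis by simp
qed

text \<open>
  A word lists indices of fields together with times; its flows are applied from left to right. The
  length of the word bounds the norm of the corresponding control.
\<close>

primrec run :: "(nat \<Rightarrow> real^'n \<Rightarrow> real^'n) \<Rightarrow> (nat \<times> real) list \<Rightarrow> real^'n \<Rightarrow> real^'n"
  where "run Y [] x = x"
  | "run Y (a # w) x = run Y w (flow (Y (fst a)) (snd a) x)"

definition wlen :: "(nat \<times> real) list \<Rightarrow> real"
  where "wlen w = (\<Sum>a\<leftarrow>w. \<bar>snd a\<bar>)"

lemma wlen_simps [simp]: "wlen [] = 0" "wlen (a # w) = \<bar>snd a\<bar> + wlen w" "wlen (v @ w) = wlen v + wlen w"
  by (auto simp: wlen_def)

lemma wlen_nonneg: "0 \<le> wlen w"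
  by (auto simp: wlen_def intro!: sum_list_nonneg)

lemma run_append: "run Y (v @ w) x = run Y w (run Y v x)"
  by (induction v arbitrary: x) auto

text \<open>
  The endpoint depends continuously on the frame in the uniform norm. Errors
  are propagated by the flows of \<open>Y\<close>; the Lipschitz condition on \<open>Z\<close> provides the flows of \<open>Z\<close>.
\<close>

lemma run_close:
  assumes "\<And>a. a \<in> set w \<Longrightarrow> lip L (Y (fst a)) \<and> lip L' (Z (fst a)) \<and> (\<forall>y. norm (Y (fst a) y - Z (fst a) y) \<le> \<eta>)"
    and "0 \<le> \<eta>" "0 \<le> L"
  shows "norm (run Y w x - run Z w x') \<le> (norm (x - x') + \<eta> * wlen w) * exp (L * wlen w)"
  using assms(1)
proof (induction w arbitrary: x x')
  case (Cons a w)
  let ?y = "flow (Y (fst a)) (snd a) x" and ?y' = "flow (Z (fst a)) (snd a) x'"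
  have \<eta>': "norm (snd a *\<^sub>R Y (fst a) y - snd a *\<^sub>R Z (fst a) y) \<le> \<eta> * \<bar>snd a\<bar>" for y
    using Cons.prems[of a] mult_left_mono[of "norm (Y (fst a) y - Z (fst a) y)" \<eta> "\<bar>snd a\<bar>"]
    by (simp flip: scaleR_diff_right add: mult.commute)
  have "norm (?y - ?y') \<le> (norm (x - x') + \<eta> * \<bar>snd a\<bar>) * exp (\<bar>snd a\<bar> * L)"
    by (rule flow_close[OF _ _ \<eta>']) (use Cons.prems[of a] in auto)
  moreover have "norm (run Y w ?y - run Z w ?y') \<le> (norm (?y - ?y') + \<eta> * wlen w) * exp (L * wlen w)"
    by (rule Cons.IH) (use Cons.prems in auto)
  ultimately have "norm (run Y w ?y - run Z w ?y')
      \<le> ((norm (x - x') + \<eta> * \<bar>snd a\<bar>) * exp (\<bar>snd a\<bar> * L) + \<eta> * wlen w) * exp (L * wlen w)"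
    by (elim order_trans) (intro mult_right_mono add_right_mono, auto)
  also have "\<dots> \<le> ((norm (x - x') + \<eta> * \<bar>snd a\<bar>) * exp (\<bar>snd a\<bar> * L) + (\<eta> * wlen w) * exp (\<bar>snd a\<bar> * L)) * exp (L * wlen w)"
  proof (intro mult_right_mono add_left_mono)
    have "(\<eta> * wlen w) * 1 \<le> (\<eta> * wlen w) * exp (\<bar>snd a\<bar> * L)"
      using assms(2,3) wlen_nonneg[of w] by (intro mult_left_mono) auto
    then show "\<eta> * wlen w \<le> (\<eta> * wlen w) * exp (\<bar>snd a\<bar> * L)" by simp
  qed simp
  also have "\<dots> = (norm (x - x') + \<eta> * wlen (a # w)) * exp (L * wlen (a # w))"
    by (simp add: algebra_simps exp_add)
  finally show ?case by simp
qed (use assms in auto)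

definition at_param :: "(nat \<times> ('p \<Rightarrow> real)) list \<Rightarrow> 'p \<Rightarrow> (nat \<times> real) list"
  where "at_param W p = map (\<lambda>a. (fst a, snd a p)) W"

lemma at_param_simps [simp]: "at_param [] p = []" "at_param (a # W) p = (fst a, snd a p) # at_param W p"
  "at_param (V @ W) p = at_param V p @ at_param W p"
  by (auto simp: at_param_def)

lemma continuous_on_run:
  fixes S :: "'p::topological_space set"
  assumes "\<And>a. a \<in> set W \<Longrightarrow> lip L (Y (fst a)) \<and> (\<forall>y. norm (Y (fst a) y) \<le> M) \<and> continuous_on S (snd a)"
    and "continuous_on S f"
  shows "continuous_on S (\<lambda>p. run Y (at_param W p) (f p))"
  using assms
proof (induction W arbitrary: f)
  case (Cons a W)
  have "continuous_on S (\<lambda>p. flow (Y (fst a)) (snd a p) (f p))"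
    unfolding continuous_on_def
  proof
    fix p assume "p \<in> S"
    then show "((\<lambda>p. flow (Y (fst a)) (snd a p) (f p)) \<longlongrightarrow> flow (Y (fst a)) (snd a p) (f p)) (at p within S)"
      using Cons.prems(1)[of a] Cons.prems(2) by (intro flow_tendsto) (auto simp: continuous_on_def)
  qed
  then have "continuous_on S (\<lambda>p. run Y (at_param W p) (flow (Y (fst a)) (snd a p) (f p)))"
    by (rule Cons.IH[rotated]) (use Cons.prems in auto)
  then show ?case by simp
qed simp

text \<open>
  On a closed convex set \<open>K\<close> the nearest-point projection is \<open>1\<close>-Lipschitz. So bounds and Lipschitz
  constants that \<open>Z\<close> has on \<open>K\<close> hold for this extension on the whole space, and its flow exists for all
  times.
\<close>

definition trunc :: "(real^'n) set \<Rightarrow> (real^'n \<Rightarrow> real^'n) \<Rightarrow> real^'n \<Rightarrow> real^'n"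
  where "trunc K Z x = Z (closest_point K x)"

lemma trunc_eq: "x \<in> K \<Longrightarrow> trunc K Z x = Z x"
  by (simp add: trunc_def closest_point_self)

lemma trunc_lip:
  assumes K: "closed K" "convex K" "K \<noteq> {}" and L: "0 \<le> L"
    and Z: "\<And>x y. x \<in> K \<Longrightarrow> y \<in> K \<Longrightarrow> norm (Z x - Z y) \<le> L * norm (x - y)"
  shows "lip L (trunc K Z)"
  unfolding lip_def trunc_def
proof (intro conjI allI L)
  fix x y
  have "norm (Z (closest_point K x) - Z (closest_point K y)) \<le> L * norm (closest_point K x - closest_point K y)"
    by (intro Z closest_point_in_set K)
  also have "\<dots> \<le> L * norm (x - y)"
    using closest_point_lipschitz[OF K(2,1,3), of x y] L by (intro mult_left_mono) (auto simp: dist_norm)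
  finally show "norm (Z (closest_point K x) - Z (closest_point K y)) \<le> L * norm (x - y)" .
qed

lemma trunc_all:
  assumes "closed K" "K \<noteq> {}" "\<And>x. x \<in> K \<Longrightarrow> P (Z x)"
  shows "P (trunc K Z x)"
  using assms closest_point_in_set[of K x] by (simp add: trunc_def)

lemma trunc_diff_le:
  assumes "closed K" "K \<noteq> {}" "\<And>x. x \<in> K \<Longrightarrow> norm (Y x - Z x) \<le> \<eta>"
  shows "norm (trunc K Y x - trunc K Z x) \<le> \<eta>"
  using assms closest_point_in_set[of K x] by (simp add: trunc_def)

lemma reach_0_imp_eq:
  assumes "reach m \<Omega> Y 0 x y" shows "y = x"
proof -
  obtain \<gamma> h where hl: "\<And>t. t \<in> {0..1} \<Longrightarrow> (\<Sum>j=1..m. (h j t)\<^sup>2) \<le> 0\<^sup>2"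
    and \<gamma>: "solves (drive m Y h) x \<gamma>" "\<gamma> 1 = y"
    using assms unfolding reach_def by blast
  have "drive m Y h t z = 0" if "t \<in> {0..1}" for t z
    using control_component_le[OF hl[OF that]] by (auto simp: drive_def intro!: sum.neutral)
  moreover have "((\<lambda>s. drive m Y h s (\<gamma> s)) has_integral (y - x)) {0..1}"
    using \<gamma> by (auto simp: solves_def)
  ultimately have "((\<lambda>s. 0) has_integral (y - x)) {0..1::real}"
    by (metis (no_types, lifting) has_integral_eq)
  then have "y - x = 0" using has_integral_unique[OF _ has_integral_0] by blast
  then show ?thesis by simp
qed

lemma reach_trans:
  assumes "reach m \<Omega> Y l1 x y" "reach m \<Omega> Y l2 y z" "0 \<le> l1" "0 \<le> l2"
  shows "reach m \<Omega> Y (l1 + l2) x z"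
proof (cases "l1 = 0 \<or> l2 = 0")
  case True then show ?thesis using assms reach_0_imp_eq by fastforce
next
  case False
  then have "0 < l1" "0 < l2" using assms by auto
  then show ?thesis by (rule reach_trans_pos[OF assms(1,2)])
qed

lemma reach_flow:
  assumes i: "i \<in> {1..m}" and Z: "lip L (trunc K (Y i))" and M: "\<And>y. norm (trunc K (Y i) y) \<le> M"
    and K: "K \<subseteq> \<Omega>" "cball x (M * \<bar>s\<bar>) \<subseteq> K"
  shows "reach m \<Omega> Y \<bar>s\<bar> x (flow (trunc K (Y i)) s x)"
proof -
  let ?\<gamma> = "flow_curve (trunc K (Y i)) s x"
  define h where "h j t = (if j = i then s else 0)" for j :: nat and t :: real
  have inK: "?\<gamma> t \<in> K" if "t \<in> {0..1}" for t
    using flow_curve_move[OF Z M that, of s x] K(2) by (auto simp: dist_norm norm_minus_commute subset_eq)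
  have dr: "drive m Y h t y = s *\<^sub>R Y i y" for t y
  proof -
    have "drive m Y h t y = (\<Sum>j=1..m. if j = i then s *\<^sub>R Y i y else 0)"
      unfolding drive_def h_def by (intro sum.cong) auto
    then show ?thesis using i by simp
  qed
  have "solves (\<lambda>_ y. s *\<^sub>R trunc K (Y i) y) x ?\<gamma>" by (rule flow_curve_solves[OF Z])
  then have "solves (drive m Y h) x ?\<gamma>"
    unfolding solves_def dr
    by (auto simp: trunc_eq inK elim!: has_integral_eq[rotated])
  moreover have "(\<Sum>j=1..m. (h j t)\<^sup>2) \<le> \<bar>s\<bar>\<^sup>2" for t
  proof -
    have "(\<Sum>j=1..m. (h j t)\<^sup>2) = (\<Sum>j=1..m. if j = i then s\<^sup>2 else 0)"
      unfolding h_def by (intro sum.cong) auto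
    then show ?thesis using i by simp
  qed
  moreover have "h j integrable_on {0..1}" for j
    unfolding h_def by (rule integrable_const_ivl)
  ultimately show ?thesis
    unfolding reach_def flow_def using inK K(1) by blast
qed

text \<open>
  If the ball of radius \<open>M * wlen w\<close> around the starting point lies in \<open>K\<close>, the truncated flows never
  leave \<open>K\<close> and are flows of the original fields.
\<close>

lemma reach_run:
  assumes K: "K \<subseteq> \<Omega>" and M: "0 \<le> M"
    and w: "\<And>a. a \<in> set w \<Longrightarrow> fst a \<in> {1..m} \<and> lip L (trunc K (Y (fst a))) \<and> (\<forall>y. norm (trunc K (Y (fst a)) y) \<le> M)"
    and x: "x \<in> K" "cball x (M * wlen w) \<subseteq> K"
  shows "reach m \<Omega> Y (wlen w) x (run (\<lambda>i. trunc K (Y i)) w x)"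
  using w x
proof (induction w arbitrary: x)
  case Nil
  then show ?case using K by (auto intro: reach_refl)
next
  case (Cons a w)
  let ?y = "flow (trunc K (Y (fst a))) (snd a) x"
  have mv: "norm (?y - x) \<le> M * \<bar>snd a\<bar>"
    using Cons.prems(1)[of a] by (intro flow_move) auto
  have "M * \<bar>snd a\<bar> \<le> M * wlen (a # w)" using wlen_nonneg[of w] M by (intro mult_left_mono) auto
  then have "cball x (M * \<bar>snd a\<bar>) \<subseteq> K" using Cons.prems(3) subset_cball by (meson order_trans)
  then have 1: "reach m \<Omega> Y \<bar>snd a\<bar> x ?y"
    using Cons.prems(1)[of a] K by (intro reach_flow[where M = M and L = L]) auto
  have sub: "cball ?y (M * wlen w) \<subseteq> cball x (M * wlen (a # w))"
  proof
    fix z assume "z \<in> cball ?y (M * wlen w)"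
    then have "norm (?y - z) \<le> M * wlen w" by (simp add: dist_norm)
    then have "norm (x - z) \<le> M * \<bar>snd a\<bar> + M * wlen w"
      using mv norm_triangle_ineq[of "x - ?y" "?y - z"] by (simp add: norm_minus_commute)
    then show "z \<in> cball x (M * wlen (a # w))" by (simp add: dist_norm algebra_simps)
  qed
  have "?y \<in> cball ?y (M * wlen w)" using M wlen_nonneg[of w] by simp
  moreover have subK: "cball ?y (M * wlen w) \<subseteq> K" using sub Cons.prems(3) by (rule order_trans)
  ultimately have "?y \<in> K" by blast
  then have "reach m \<Omega> Y (wlen w) ?y (run (\<lambda>i. trunc K (Y i)) w ?y)"
    using subK Cons.prems(1) by (intro Cons.IH) auto
  from reach_trans[OF 1 this] show ?case using wlen_nonneg[of w] by simp
qed

text \<open>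
  At the first time at which the sphere of radius \<open>R\<close> is reached the curve has moved by at most \<open>B\<close>,
  since up to this time the speed is bounded by \<open>B\<close>.
\<close>

lemma solution_stays_in_ball:
  assumes \<gamma>: "solves F x \<gamma>" and B: "\<And>t y. t \<in> {0..1} \<Longrightarrow> y \<in> cball c R \<Longrightarrow> norm (F t y) \<le> B"
    and x: "norm (x - c) + B < R" and t: "t \<in> {0..1}" and B0: "0 \<le> B"
  shows "norm (\<gamma> t - c) < R"
proof (rule ccontr)
  assume out: "\<not> norm (\<gamma> t - c) < R"
  define S where "S = {s \<in> {0..1}. R \<le> norm (\<gamma> s - c)}"
  have cont: "continuous_on {0..1} \<gamma>" using \<gamma> by (simp add: solves_def)
  have "closed S"
    unfolding S_def by (intro continuous_on_closed_Collect_le continuous_intros cont)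
  moreover have "S \<subseteq> {0..1}" by (auto simp: S_def)
  ultimately have comp: "compact S" by (meson bounded_subset compact_eq_bounded_closed compact_Icc)
  have "S \<noteq> {}" using t out by (auto simp: S_def)
  then obtain \<tau> where \<tau>: "\<tau> \<in> S" "\<And>s. s \<in> S \<Longrightarrow> \<tau> \<le> s"
    using compact_attains_inf[OF comp] by blast
  have \<tau>01: "\<tau> \<in> {0..1}" "R \<le> norm (\<gamma> \<tau> - c)" using \<tau> by (auto simp: S_def)
  have "\<gamma> 0 = x" by (rule solves_start[OF \<gamma>])
  then have "0 \<notin> S" using x B0 by (auto simp: S_def)
  then have \<tau>0: "0 < \<tau>" using \<tau>01 \<tau>(1) by (cases "\<tau> = 0") auto
  have before: "norm (\<gamma> s - c) < R" if "0 \<le> s" "s < \<tau>" for s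
    using \<tau>(2)[of s] that \<tau>01 by (auto simp: S_def not_le[symmetric])
  have i: "((\<lambda>s. F s (\<gamma> s)) has_integral (\<gamma> \<tau> - x)) {0..\<tau>}"
    using \<gamma> \<tau>01 by (auto simp: solves_def)
  have "((\<lambda>s. if s = \<tau> then 0 else F s (\<gamma> s)) has_integral (\<gamma> \<tau> - x)) (cbox 0 \<tau>)"
    unfolding cbox_interval by (rule has_integral_spike[OF _ _ i, of "{\<tau>}"]) auto
  moreover have "norm (if s = \<tau> then 0 else F s (\<gamma> s)) \<le> B" if s: "s \<in> cbox 0 \<tau>" for s
  proof (cases "s = \<tau>")
    case False
    then have "\<gamma> s \<in> cball c R" "s \<in> {0..1}"
      using before[of s] s \<tau>01 by (auto simp: dist_norm norm_minus_commute)
    then show ?thesis using B False by simp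
  qed (use B0 in simp)
  ultimately have "norm (\<gamma> \<tau> - x) \<le> B * measure lborel (cbox 0 \<tau>)"
    by (rule has_integral_bound[OF B0])
  also have "\<dots> \<le> B * 1" using \<tau>01 B0 by (intro mult_left_mono) auto
  finally have "norm (\<gamma> \<tau> - c) < R"
    using x norm_triangle_ineq[of "\<gamma> \<tau> - x" "x - c"] by simp
  then show False using \<tau>01 by simp
qed

section \<open>Smooth fields and their Lie brackets\<close>

abbreviation FD :: "(real^'n \<Rightarrow> 'b::real_normed_vector) \<Rightarrow> real^'n \<Rightarrow> real^'n \<Rightarrow> 'b"
  where "FD f x \<equiv> frechet_derivative f (at x)"

text \<open>
  Iterated directional derivatives along constant vectors. In contrast to iterated partial
  derivatives, this form is stable under the algebraic operations by a plain induction on the order.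
\<close>

primrec cdiff :: "nat \<Rightarrow> (real^'n) set \<Rightarrow> (real^'n \<Rightarrow> 'b::real_normed_vector) \<Rightarrow> bool"
  where "cdiff 0 \<Omega> f \<longleftrightarrow> True"
  | "cdiff (Suc k) \<Omega> f \<longleftrightarrow> (\<forall>x\<in>\<Omega>. f differentiable (at x)) \<and> (\<forall>v. cdiff k \<Omega> (\<lambda>x. FD f x v))"

definition csmooth :: "(real^'n) set \<Rightarrow> (real^'n \<Rightarrow> 'b::real_normed_vector) \<Rightarrow> bool"
  where "csmooth \<Omega> f \<longleftrightarrow> (\<forall>k. cdiff k \<Omega> f)"

lemma FD_works: "f differentiable (at x) \<Longrightarrow> (f has_derivative FD f x) (at x)"
  by (simp add: frechet_derivative_works)

lemma FD_eqI: "(f has_derivative f') (at x) \<Longrightarrow> FD f x = f'"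
  by (rule frechet_derivative_at[symmetric])

lemma cdiff_cong:
  assumes "open \<Omega>" "\<And>x. x \<in> \<Omega> \<Longrightarrow> f x = g x" "cdiff k \<Omega> f"
  shows "cdiff k \<Omega> g"
  using assms(2,3)
proof (induction k arbitrary: f g)
  case (Suc k)
  have d: "(g has_derivative FD f x) (at x)" if "x \<in> \<Omega>" for x
    by (rule has_derivative_transform_within_open[OF FD_works assms(1) that]) (use Suc.prems that in auto)
  then have FDeq: "FD g x = FD f x" if "x \<in> \<Omega>" for x using FD_eqI that by blast
  have "cdiff k \<Omega> (\<lambda>x. FD g x v)" for v
    by (rule Suc.IH[of "\<lambda>x. FD f x v"]) (use Suc.prems FDeq in auto)
  moreover have "g differentiable (at x)" if "x \<in> \<Omega>" for x
    using d[OF that] by (rule differentiableI)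
  ultimately show ?case by simp
qed simp

lemma cdiff_SucI:
  assumes "open \<Omega>" "\<And>x. x \<in> \<Omega> \<Longrightarrow> (f has_derivative f' x) (at x)" "\<And>v. cdiff k \<Omega> (\<lambda>x. f' x v)"
  shows "cdiff (Suc k) \<Omega> f"
proof -
  have "FD f x = f' x" if "x \<in> \<Omega>" for x using assms(2)[OF that] by (rule FD_eqI)
  then have "cdiff k \<Omega> (\<lambda>x. FD f x v)" for v
    by (intro cdiff_cong[OF assms(1) _ assms(3)[of v]]) simp
  then show ?thesis using assms(2) by (auto intro: differentiableI)
qed

lemma cdiff_SucD: "cdiff (Suc k) \<Omega> f \<Longrightarrow> cdiff k \<Omega> f"
  by (induction k arbitrary: f) auto

lemma cdiff_FD: "cdiff (Suc k) \<Omega> f \<Longrightarrow> cdiff k \<Omega> (\<lambda>x. FD f x v)"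
  by simp

lemma cdiff_has_derivative: "cdiff (Suc k) \<Omega> f \<Longrightarrow> x \<in> \<Omega> \<Longrightarrow> (f has_derivative FD f x) (at x)"
  by (auto intro: FD_works)

lemma cdiff_const: "open \<Omega> \<Longrightarrow> cdiff k \<Omega> (\<lambda>_. c)"
proof (induction k arbitrary: c)
  case (Suc k)
  then show ?case by (intro cdiff_SucI[where f' = "\<lambda>_ _. 0"]) auto
qed simp

lemma cdiff_add:
  assumes "open \<Omega>" "cdiff k \<Omega> f" "cdiff k \<Omega> g"
  shows "cdiff k \<Omega> (\<lambda>x. f x + g x)"
  using assms(2,3)
proof (induction k arbitrary: f g)
  case (Suc k)
  show ?case
    by (rule cdiff_SucI[OF assms(1) has_derivative_add])
      (use Suc in \<open>auto intro!: Suc.IH FD_works\<close>)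
qed simp

lemma cdiff_linear:
  assumes "open \<Omega>" "cdiff k \<Omega> f" "bounded_linear h"
  shows "cdiff k \<Omega> (\<lambda>x. h (f x))"
  using assms(2)
proof (induction k arbitrary: f)
  case (Suc k)
  show ?case
    by (rule cdiff_SucI[OF assms(1) bounded_linear.has_derivative[OF assms(3)]])
      (use Suc in \<open>auto intro!: Suc.IH FD_works\<close>)
qed simp

lemma cdiff_scaleR:
  assumes "open \<Omega>" "cdiff k \<Omega> g" "cdiff k \<Omega> f"
  shows "cdiff k \<Omega> (\<lambda>x. (g x :: real) *\<^sub>R f x)"
  using assms(2,3)
proof (induction k arbitrary: f g)
  case (Suc k)
  show ?case
    by (rule cdiff_SucI[OF assms(1) has_derivative_scaleR])
      (use Suc in \<open>auto intro!: Suc.IH cdiff_add[OF assms(1)] dest: cdiff_SucD simp del: cdiff.simps(2)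
         intro: cdiff_has_derivative cdiff_FD\<close>)
qed simp

lemma cdiff_sum:
  assumes "open \<Omega>" "\<And>i. i \<in> I \<Longrightarrow> cdiff k \<Omega> (f i)"
  shows "cdiff k \<Omega> (\<lambda>x. \<Sum>i\<in>I. f i x)"
  using assms(2) by (induction I rule: infinite_finite_induct) (auto intro: cdiff_const cdiff_add assms(1))

lemma FD_expand:
  fixes f :: "real^'n \<Rightarrow> 'b::real_normed_vector"
  assumes "f differentiable (at x)"
  shows "FD f x v = (\<Sum>i\<in>UNIV. v $ i *\<^sub>R FD f x (axis i 1))"
proof -
  have lin: "linear (FD f x)" using assms by (rule linear_frechet_derivative)
  have "FD f x v = FD f x (\<Sum>i\<in>UNIV. v $ i *\<^sub>R axis i 1)"
    using basis_expansion[of v] by (simp add: scalar_mult_eq_scaleR)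
  then show ?thesis by (simp add: linear_sum[OF lin] linear_scale[OF lin])
qed

text \<open>
  In coordinates the derivative in the direction of \<open>g\<close> is a sum of products of the components of \<open>g\<close>
  with partial derivatives of \<open>f\<close>.
\<close>

lemma cdiff_FD_field:
  fixes f :: "real^'n \<Rightarrow> 'b::real_normed_vector"
  assumes "open \<Omega>" "cdiff (Suc k) \<Omega> f" "cdiff k \<Omega> g"
  shows "cdiff k \<Omega> (\<lambda>x. FD f x (g x))"
proof (rule cdiff_cong[OF assms(1)])
  show "(\<Sum>i\<in>UNIV. g x $ i *\<^sub>R FD f x (axis i 1)) = FD f x (g x)" if "x \<in> \<Omega>" for x
    using FD_expand[of f x "g x"] assms(2) that by simp
  show "cdiff k \<Omega> (\<lambda>x. \<Sum>i\<in>UNIV. g x $ i *\<^sub>R FD f x (axis i 1))"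
    by (intro cdiff_sum cdiff_scaleR assms(1) cdiff_linear[OF assms(1,3)] bounded_linear_vec_nth)
       (use assms(2) in auto)
qed

lemma csmooth_FD_field: "open \<Omega> \<Longrightarrow> csmooth \<Omega> f \<Longrightarrow> csmooth \<Omega> g \<Longrightarrow> csmooth \<Omega> (\<lambda>x. FD f x (g x))"
  by (auto simp: csmooth_def simp del: cdiff.simps intro: cdiff_FD_field)

lemma csmooth_cong: "open \<Omega> \<Longrightarrow> (\<And>x. x \<in> \<Omega> \<Longrightarrow> f x = g x) \<Longrightarrow> csmooth \<Omega> f \<Longrightarrow> csmooth \<Omega> g"
  unfolding csmooth_def using cdiff_cong by blast

lemma csmooth_add: "open \<Omega> \<Longrightarrow> csmooth \<Omega> f \<Longrightarrow> csmooth \<Omega> g \<Longrightarrow> csmooth \<Omega> (\<lambda>x. f x + g x)"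
  by (simp add: csmooth_def cdiff_add)

lemma csmooth_scale: "open \<Omega> \<Longrightarrow> csmooth \<Omega> f \<Longrightarrow> csmooth \<Omega> (\<lambda>x. c *\<^sub>R f x)"
  by (simp add: csmooth_def cdiff_linear bounded_linear_scaleR_right)

lemma csmooth_diff: "open \<Omega> \<Longrightarrow> csmooth \<Omega> f \<Longrightarrow> csmooth \<Omega> g \<Longrightarrow> csmooth \<Omega> (\<lambda>x. f x - g x)"
  using csmooth_add[of \<Omega> f "\<lambda>x. (-1) *\<^sub>R g x"] csmooth_scale[of \<Omega> g "-1"] by simp

lemma csmooth_lie_bracket:
  "open \<Omega> \<Longrightarrow> csmooth \<Omega> Y \<Longrightarrow> csmooth \<Omega> Z \<Longrightarrow> csmooth \<Omega> (lie_bracket Y Z)"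
  unfolding lie_bracket_def[abs_def] by (intro csmooth_diff csmooth_FD_field)

lemma csmooth_FD: "csmooth \<Omega> f \<Longrightarrow> csmooth \<Omega> (\<lambda>x. FD f x v)"
  unfolding csmooth_def by (metis cdiff.simps(2))

lemma csmooth_has_derivative: "csmooth \<Omega> f \<Longrightarrow> x \<in> \<Omega> \<Longrightarrow> (f has_derivative FD f x) (at x)"
  unfolding csmooth_def using cdiff_has_derivative by blast

lemma csmooth_differentiable: "csmooth \<Omega> f \<Longrightarrow> x \<in> \<Omega> \<Longrightarrow> f differentiable (at x)"
  using csmooth_has_derivative differentiableI by blast

lemma partial_deriv_eq_FD:
  assumes "f differentiable (at x)"
  shows "partial_deriv i f x = FD f x (axis i 1)"
proof -
  have "((\<lambda>t. x + t *\<^sub>R axis i 1) has_derivative (\<lambda>t. t *\<^sub>R axis i 1)) (at 0)"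
    by (auto intro!: derivative_eq_intros)
  moreover have "(f has_derivative FD f x) (at (x + 0 *\<^sub>R axis i 1))" using FD_works[OF assms] by simp
  ultimately have "((\<lambda>t. f (x + t *\<^sub>R axis i 1)) has_derivative (\<lambda>t. FD f x (t *\<^sub>R axis i 1))) (at 0)"
    by (rule has_derivative_compose)
  then have "((\<lambda>t. f (x + t *\<^sub>R axis i 1)) has_vector_derivative FD f x (axis i 1)) (at 0)"
    by (simp add: has_vector_derivative_def linear_scale[OF linear_frechet_derivative[OF assms]])
  then show ?thesis unfolding partial_deriv_def by (rule vector_derivative_at)
qed

lemma smooth_on_partial_deriv: "smooth_on \<Omega> f \<Longrightarrow> smooth_on \<Omega> (partial_deriv i f)"
proof -
  have "iter_partial w (partial_deriv i f) = iter_partial (w @ [i]) f" for w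
    by (simp add: iter_partial_def)
  then show "smooth_on \<Omega> f \<Longrightarrow> smooth_on \<Omega> (partial_deriv i f)"
    by (simp add: smooth_on_def)
qed

text \<open>
  A directional derivative is a linear combination of partial derivatives, and these are smooth again.
\<close>

lemma smooth_on_imp_csmooth:
  fixes f :: "real^'n \<Rightarrow> 'b::real_normed_vector"
  assumes "open \<Omega>" "smooth_on \<Omega> f"
  shows "csmooth \<Omega> f"
proof -
  have "cdiff k \<Omega> f" for k
    using assms(2)
  proof (induction k arbitrary: f)
    case (Suc k)
    have d: "f differentiable (at x)" if "x \<in> \<Omega>" for x
    proof -
      have "iter_partial [] f differentiable (at x)"
        using Suc.prems that unfolding smooth_on_def by blast
      then show ?thesis by (simp add: iter_partial_def)
    qed
    have "cdiff k \<Omega> (\<lambda>x. FD f x v)" for v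
    proof (rule cdiff_cong[OF assms(1)])
      show "(\<Sum>i\<in>UNIV. v $ i *\<^sub>R partial_deriv i f x) = FD f x v" if "x \<in> \<Omega>" for x
        using FD_expand[OF d[OF that], of v] partial_deriv_eq_FD[OF d[OF that]] by simp
      show "cdiff k \<Omega> (\<lambda>x. \<Sum>i\<in>UNIV. v $ i *\<^sub>R partial_deriv i f x)"
      proof (rule cdiff_sum[OF assms(1)])
        fix i
        have "cdiff k \<Omega> (partial_deriv i f)"
          by (rule Suc.IH[OF smooth_on_partial_deriv[OF Suc.prems]])
        then show "cdiff k \<Omega> (\<lambda>x. v $ i *\<^sub>R partial_deriv i f x)"
          by (rule cdiff_linear[OF assms(1) _ bounded_linear_scaleR_right])
      qed
    qed
    then show ?case using d by simp
  qed simp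
  then show ?thesis by (simp add: csmooth_def)
qed

lemma unit_interval_mean_value:
  fixes \<phi> :: "real \<Rightarrow> 'b::real_normed_vector"
  assumes "\<And>s. s \<in> {0..1} \<Longrightarrow> (\<phi> has_vector_derivative \<phi>' s) (at s)"
    and "\<And>s. s \<in> {0..1} \<Longrightarrow> norm (\<phi>' s - c) \<le> e"
  shows "norm (\<phi> 1 - \<phi> 0 - c) \<le> e"
proof -
  have "norm ((\<lambda>s. \<phi> s - s *\<^sub>R c) 1 - (\<lambda>s. \<phi> s - s *\<^sub>R c) 0) \<le> e * norm (1 - 0 :: real)"
  proof (rule differentiable_bound[of "{0..1}" _ "\<lambda>s t. t *\<^sub>R (\<phi>' s - c)"])
    fix s :: real assume s: "s \<in> {0..1}"
    have "((\<lambda>s. \<phi> s - s *\<^sub>R c) has_vector_derivative (\<phi>' s - c)) (at s within {0..1})"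
      by (rule has_vector_derivative_at_within) (auto intro!: derivative_eq_intros assms(1) s)
    then show "((\<lambda>s. \<phi> s - s *\<^sub>R c) has_derivative (\<lambda>t. t *\<^sub>R (\<phi>' s - c))) (at s within {0..1})"
      by (simp add: has_vector_derivative_def)
    show "onorm (\<lambda>t. t *\<^sub>R (\<phi>' s - c)) \<le> e"
    proof (rule onorm_le)
      fix t :: real
      show "norm (t *\<^sub>R (\<phi>' s - c)) \<le> e * norm t"
        using mult_right_mono[OF assms(2)[OF s], of "\<bar>t\<bar>"] by (simp add: mult.commute)
    qed
  qed auto
  then show ?thesis by (simp add: algebra_simps)
qed

lemma line_has_vector_derivative:
  assumes "(f has_derivative f') (at (a + s *\<^sub>R v))"
  shows "((\<lambda>s. f (a + s *\<^sub>R v)) has_vector_derivative f' v) (at s)"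
proof -
  have "((\<lambda>s. a + s *\<^sub>R v) has_derivative (\<lambda>t. t *\<^sub>R v)) (at s)"
    by (auto intro!: derivative_eq_intros)
  from has_derivative_compose[OF this assms]
  show ?thesis
    by (simp add: has_vector_derivative_def linear_scale[OF has_derivative_linear[OF assms]])
qed

text \<open>
  Two applications of the mean value inequality: first to the second difference as a function of the
  multiple of \<open>w\<close>, then to the derivative in the direction \<open>w\<close> as a function of the multiple of \<open>v\<close>.
\<close>

lemma second_difference_approx:
  fixes f :: "real^'n \<Rightarrow> 'b::real_normed_vector"
  assumes f: "csmooth \<Omega> f" and ball: "ball x \<delta> \<subseteq> \<Omega>"
    and close: "\<And>y. y \<in> ball x \<delta> \<Longrightarrow> norm (FD (\<lambda>z. FD f z w) y v - c) \<le> \<epsilon>"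
    and t: "0 < t" "t * (norm v + norm w) < \<delta>"
  shows "norm (f (x + t *\<^sub>R v + t *\<^sub>R w) - f (x + t *\<^sub>R v) - f (x + t *\<^sub>R w) + f x - t\<^sup>2 *\<^sub>R c) \<le> t\<^sup>2 * \<epsilon>"
proof -
  have du: "dist x (x + u) = norm u" for u :: "real^'n" by (simp add: dist_norm)
  have inb: "x + r *\<^sub>R (t *\<^sub>R v) + s *\<^sub>R (t *\<^sub>R w) \<in> ball x \<delta>" if "r \<in> {0..1}" "s \<in> {0..1}" for r s
  proof -
    have "norm (r *\<^sub>R (t *\<^sub>R v) + s *\<^sub>R (t *\<^sub>R w)) \<le> r * (t * norm v) + s * (t * norm w)"
      using norm_triangle_ineq[of "r *\<^sub>R (t *\<^sub>R v)" "s *\<^sub>R (t *\<^sub>R w)"] that t by simp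
    also have "\<dots> \<le> 1 * (t * norm v) + 1 * (t * norm w)"
      using that t by (intro add_mono mult_right_mono) auto
    also have "\<dots> < \<delta>" using t by (simp add: algebra_simps)
    finally have "dist x (x + (r *\<^sub>R (t *\<^sub>R v) + s *\<^sub>R (t *\<^sub>R w))) < \<delta>" by (simp only: du)
    then show ?thesis by (simp only: mem_ball add.assoc)
  qed
  have inner: "norm (FD f (x + s *\<^sub>R (t *\<^sub>R w) + t *\<^sub>R v) w - FD f (x + s *\<^sub>R (t *\<^sub>R w)) w - t *\<^sub>R c) \<le> t * \<epsilon>"
    if s: "s \<in> {0..1}" for s
  proof -
    define a where "a = x + s *\<^sub>R (t *\<^sub>R w)"
    have "norm ((\<lambda>r. FD f (a + r *\<^sub>R (t *\<^sub>R v)) w) 1 - (\<lambda>r. FD f (a + r *\<^sub>R (t *\<^sub>R v)) w) 0 - t *\<^sub>R c) \<le> t * \<epsilon>"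
    proof (rule unit_interval_mean_value)
      fix r :: real assume r: "r \<in> {0..1}"
      define y where "y = a + r *\<^sub>R (t *\<^sub>R v)"
      have y: "y \<in> ball x \<delta>" using inb[OF r s] by (simp add: y_def a_def algebra_simps)
      then have d: "((\<lambda>z. FD f z w) has_derivative FD (\<lambda>z. FD f z w) y) (at y)"
        using csmooth_has_derivative[OF csmooth_FD[OF f]] ball by blast
      show "((\<lambda>r. FD f (a + r *\<^sub>R (t *\<^sub>R v)) w) has_vector_derivative FD (\<lambda>z. FD f z w) y (t *\<^sub>R v)) (at r)"
        using line_has_vector_derivative[OF d[unfolded y_def]] by (simp add: y_def)
      have "FD (\<lambda>z. FD f z w) y (t *\<^sub>R v) - t *\<^sub>R c = t *\<^sub>R (FD (\<lambda>z. FD f z w) y v - c)"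
        using linear_scale[OF has_derivative_linear[OF d]] by (simp add: algebra_simps)
      then show "norm (FD (\<lambda>z. FD f z w) (a + r *\<^sub>R (t *\<^sub>R v)) (t *\<^sub>R v) - t *\<^sub>R c) \<le> t * \<epsilon>"
        using close[OF y] t by (simp add: y_def)
    qed
    then show ?thesis by (simp add: a_def)
  qed
  have "norm ((\<lambda>s. f (x + t *\<^sub>R v + s *\<^sub>R (t *\<^sub>R w)) - f (x + s *\<^sub>R (t *\<^sub>R w))) 1
      - (\<lambda>s. f (x + t *\<^sub>R v + s *\<^sub>R (t *\<^sub>R w)) - f (x + s *\<^sub>R (t *\<^sub>R w))) 0 - t\<^sup>2 *\<^sub>R c) \<le> t\<^sup>2 * \<epsilon>"
  proof (rule unit_interval_mean_value)
    fix s :: real assume s: "s \<in> {0..1}"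
    define y where "y = x + t *\<^sub>R v + s *\<^sub>R (t *\<^sub>R w)"
    define z where "z = x + s *\<^sub>R (t *\<^sub>R w)"
    have yz: "y \<in> \<Omega>" "z \<in> \<Omega>" using inb[of 1 s] inb[of 0 s] s ball by (auto simp: y_def z_def)
    note dy = csmooth_has_derivative[OF f yz(1)] and dz = csmooth_has_derivative[OF f yz(2)]
    show "((\<lambda>s. f (x + t *\<^sub>R v + s *\<^sub>R (t *\<^sub>R w)) - f (x + s *\<^sub>R (t *\<^sub>R w)))
        has_vector_derivative (FD f y (t *\<^sub>R w) - FD f z (t *\<^sub>R w))) (at s)"
      using line_has_vector_derivative[OF dy[unfolded y_def]] line_has_vector_derivative[OF dz[unfolded z_def]]
      unfolding y_def z_def by (rule has_vector_derivative_diff)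
    have yz': "y = z + t *\<^sub>R v" by (simp add: y_def z_def)
    have "FD f y (t *\<^sub>R w) - FD f z (t *\<^sub>R w) - t\<^sup>2 *\<^sub>R c = t *\<^sub>R (FD f y w - FD f z w - t *\<^sub>R c)"
      using linear_scale[OF has_derivative_linear[OF dy]] linear_scale[OF has_derivative_linear[OF dz]]
      by (simp add: algebra_simps power2_eq_square)
    moreover have "norm (FD f y w - FD f z w - t *\<^sub>R c) \<le> t * \<epsilon>"
      using inner[OF s] by (simp only: yz' z_def)
    ultimately have "norm (FD f y (t *\<^sub>R w) - FD f z (t *\<^sub>R w) - t\<^sup>2 *\<^sub>R c) \<le> t\<^sup>2 * \<epsilon>"
      using mult_left_mono[of "norm (FD f y w - FD f z w - t *\<^sub>R c)" "t * \<epsilon>" t] t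
      by (simp add: power2_eq_square mult.assoc)
    then show "norm (FD f (x + t *\<^sub>R v + s *\<^sub>R (t *\<^sub>R w)) (t *\<^sub>R w) - FD f (x + s *\<^sub>R (t *\<^sub>R w)) (t *\<^sub>R w) - t\<^sup>2 *\<^sub>R c) \<le> t\<^sup>2 * \<epsilon>"
      by (simp only: y_def z_def)
  qed
  then show ?thesis by (simp add: algebra_simps)
qed

text \<open>
  The second difference quotient is symmetric in the two directions, and it is close to each of the
  two mixed derivatives.
\<close>

lemma second_derivative_symmetric:
  fixes f :: "real^'n \<Rightarrow> 'b::real_normed_vector"
  assumes \<Omega>: "open \<Omega>" and f: "csmooth \<Omega> f" and x: "x \<in> \<Omega>"
  shows "FD (\<lambda>z. FD f z w) x v = FD (\<lambda>z. FD f z v) x w"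
proof -
  define c where "c = FD (\<lambda>z. FD f z w) x v"
  define c' where "c' = FD (\<lambda>z. FD f z v) x w"
  have "norm (c - c') \<le> \<epsilon>" if \<epsilon>: "\<epsilon> > 0" for \<epsilon>
  proof -
    have cont: "continuous (at x) (\<lambda>y. FD (\<lambda>z. FD f z w) y v)" for v w
      using csmooth_has_derivative[OF csmooth_FD[OF csmooth_FD[OF f]] x] by (rule has_derivative_continuous)
    obtain d1 where d1: "d1 > 0" "\<And>y. dist y x < d1 \<Longrightarrow> dist (FD (\<lambda>z. FD f z w) y v) c < \<epsilon> / 2"
      using cont[of w v] \<epsilon> unfolding continuous_at_eps_delta c_def by (metis half_gt_zero)
    obtain d2 where d2: "d2 > 0" "\<And>y. dist y x < d2 \<Longrightarrow> dist (FD (\<lambda>z. FD f z v) y w) c' < \<epsilon> / 2"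
      using cont[of v w] \<epsilon> unfolding continuous_at_eps_delta c'_def by (metis half_gt_zero)
    obtain d3 where d3: "d3 > 0" "ball x d3 \<subseteq> \<Omega>" using \<Omega> x open_contains_ball by blast
    define \<delta> where "\<delta> = min d1 (min d2 d3)"
    define N where "N = norm v + norm w + 1"
    define t where "t = \<delta> / (2 * N)"
    have \<delta>: "\<delta> > 0" using d1 d2 d3 by (simp add: \<delta>_def)
    have nn: "N > 0" by (simp add: N_def add_nonneg_pos)
    have t: "t > 0" using \<delta> nn by (simp add: t_def)
    have "t * (norm v + norm w) \<le> t * N" using t by (simp add: N_def)
    also have "\<dots> = \<delta> / 2" using nn by (simp add: t_def)
    also have "\<dots> < \<delta>" using \<delta> by simp
    finally have tl: "t * (norm v + norm w) < \<delta>" .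
    have b: "ball x \<delta> \<subseteq> \<Omega>" using d3 by (auto simp: \<delta>_def)
    define E where "E = f (x + t *\<^sub>R v + t *\<^sub>R w) - f (x + t *\<^sub>R v) - f (x + t *\<^sub>R w) + f x"
    have "norm (E - t\<^sup>2 *\<^sub>R c) \<le> t\<^sup>2 * (\<epsilon> / 2)"
      unfolding E_def
      by (rule second_difference_approx[OF f b _ t tl])
         (use d1(2) in \<open>auto simp: \<delta>_def dist_commute less_imp_le simp flip: dist_norm\<close>)
    moreover have "norm (f (x + t *\<^sub>R w + t *\<^sub>R v) - f (x + t *\<^sub>R w) - f (x + t *\<^sub>R v) + f x - t\<^sup>2 *\<^sub>R c') \<le> t\<^sup>2 * (\<epsilon> / 2)"
      by (rule second_difference_approx[OF f b _ t])
         (use d2(2) tl in \<open>auto simp: \<delta>_def dist_commute less_imp_le add.commute simp flip: dist_norm\<close>)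
    moreover have "f (x + t *\<^sub>R w + t *\<^sub>R v) - f (x + t *\<^sub>R w) - f (x + t *\<^sub>R v) + f x = E"
      by (simp add: E_def algebra_simps)
    ultimately have "norm (t\<^sup>2 *\<^sub>R c - t\<^sup>2 *\<^sub>R c') \<le> t\<^sup>2 * \<epsilon>"
      using norm_triangle_ineq4[of "E - t\<^sup>2 *\<^sub>R c'" "E - t\<^sup>2 *\<^sub>R c"] by simp
    then have "t\<^sup>2 * norm (c - c') \<le> t\<^sup>2 * \<epsilon>" by (simp flip: scaleR_diff_right)
    then show ?thesis using t by simp
  qed
  then have "norm (c - c') \<le> 0" by (rule field_le_epsilon[where y = 0, simplified])
  then show ?thesis by (simp add: c_def c'_def)
qed

lemma FD_field_has_derivative:
  fixes f :: "real^'n \<Rightarrow> 'b::real_normed_vector"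
  assumes \<Omega>: "open \<Omega>" and f: "csmooth \<Omega> f" and g: "csmooth \<Omega> g" and x: "x \<in> \<Omega>"
  shows "((\<lambda>y. FD f y (g y)) has_derivative (\<lambda>w. FD (\<lambda>z. FD f z (g x)) x w + FD f x (FD g x w))) (at x)"
proof -
  have fd: "f differentiable (at y)" if "y \<in> \<Omega>" for y using csmooth_differentiable[OF f that] .
  note d2 = csmooth_has_derivative[OF csmooth_FD[OF f] x]
  have sum1: "((\<lambda>y. \<Sum>i\<in>UNIV. g y $ i *\<^sub>R FD f y (axis i 1)) has_derivative
      (\<lambda>w. \<Sum>i\<in>UNIV. g x $ i *\<^sub>R FD (\<lambda>z. FD f z (axis i 1)) x w + (FD g x w) $ i *\<^sub>R FD f x (axis i 1))) (at x)"
    by (intro has_derivative_sum has_derivative_scaleR d2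
        bounded_linear.has_derivative[OF bounded_linear_vec_nth] csmooth_has_derivative[OF g x])
  have "((\<lambda>y. \<Sum>i\<in>UNIV. g x $ i *\<^sub>R FD f y (axis i 1)) has_derivative
      (\<lambda>w. \<Sum>i\<in>UNIV. g x $ i *\<^sub>R FD (\<lambda>z. FD f z (axis i 1)) x w)) (at x)"
    by (intro has_derivative_sum bounded_linear.has_derivative[OF bounded_linear_scaleR_right] d2)
  then have "((\<lambda>y. FD f y (g x)) has_derivative
      (\<lambda>w. \<Sum>i\<in>UNIV. g x $ i *\<^sub>R FD (\<lambda>z. FD f z (axis i 1)) x w)) (at x)"
    by (rule has_derivative_transform_within_open[OF _ \<Omega> x]) (rule FD_expand[OF fd, symmetric])
  then have e1: "FD (\<lambda>z. FD f z (g x)) x w = (\<Sum>i\<in>UNIV. g x $ i *\<^sub>R FD (\<lambda>z. FD f z (axis i 1)) x w)" for w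
    by (simp add: FD_eqI)
  have e2: "FD f x (FD g x w) = (\<Sum>i\<in>UNIV. (FD g x w) $ i *\<^sub>R FD f x (axis i 1))" for w
    by (rule FD_expand[OF fd[OF x]])
  have "((\<lambda>y. FD f y (g y)) has_derivative
      (\<lambda>w. \<Sum>i\<in>UNIV. g x $ i *\<^sub>R FD (\<lambda>z. FD f z (axis i 1)) x w + (FD g x w) $ i *\<^sub>R FD f x (axis i 1))) (at x)"
    by (rule has_derivative_transform_within_open[OF sum1 \<Omega> x]) (rule FD_expand[OF fd, symmetric])
  then show ?thesis by (simp add: e1 e2 sum.distrib)
qed

lemma FD_lie_bracket:
  assumes \<Omega>: "open \<Omega>" and A: "csmooth \<Omega> A" and B: "csmooth \<Omega> B" and x: "x \<in> \<Omega>"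
  shows "FD (lie_bracket A B) x w =
    FD (\<lambda>z. FD B z (A x)) x w + FD B x (FD A x w) - (FD (\<lambda>z. FD A z (B x)) x w + FD A x (FD B x w))"
  using FD_eqI[OF has_derivative_diff[OF FD_field_has_derivative[OF \<Omega> B A x] FD_field_has_derivative[OF \<Omega> A B x]]]
  unfolding lie_bracket_def[abs_def] by simp

text \<open>
  The second derivatives cancel in pairs by symmetry, and what remains are identical compositions of
  first derivatives.
\<close>

lemma lie_bracket_jacobi:
  assumes \<Omega>: "open \<Omega>" and A: "csmooth \<Omega> A" and B: "csmooth \<Omega> B" and V: "csmooth \<Omega> V" and x: "x \<in> \<Omega>"
  shows "lie_bracket (lie_bracket A B) V x = lie_bracket A (lie_bracket B V) x - lie_bracket B (lie_bracket A V) x"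
proof -
  have lin: "linear (FD F x)" if "csmooth \<Omega> F" for F :: "real^'a \<Rightarrow> real^'a"
    using csmooth_has_derivative[OF that x] by (rule has_derivative_linear)
  note sym = second_derivative_symmetric[OF \<Omega> _ x]
  have 1: "lie_bracket (lie_bracket A B) V x = FD V x (FD B x (A x)) - FD V x (FD A x (B x)) -
      (FD (\<lambda>z. FD B z (A x)) x (V x) + FD B x (FD A x (V x)) - (FD (\<lambda>z. FD A z (B x)) x (V x) + FD A x (FD B x (V x))))"
    using FD_lie_bracket[OF \<Omega> A B x, of "V x"] linear_diff[OF lin[OF V]] by (simp add: lie_bracket_def)
  have 2: "lie_bracket A (lie_bracket B V) x =
      FD (\<lambda>z. FD V z (B x)) x (A x) + FD V x (FD B x (A x)) - (FD (\<lambda>z. FD B z (V x)) x (A x) + FD B x (FD V x (A x)))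
      - (FD A x (FD V x (B x)) - FD A x (FD B x (V x)))"
    using FD_lie_bracket[OF \<Omega> B V x, of "A x"] linear_diff[OF lin[OF A]]
    by (simp add: lie_bracket_def[of A] ) (simp add: lie_bracket_def)
  have 3: "lie_bracket B (lie_bracket A V) x =
      FD (\<lambda>z. FD V z (A x)) x (B x) + FD V x (FD A x (B x)) - (FD (\<lambda>z. FD A z (V x)) x (B x) + FD A x (FD V x (B x)))
      - (FD B x (FD V x (A x)) - FD B x (FD A x (V x)))"
    using FD_lie_bracket[OF \<Omega> A V x, of "B x"] linear_diff[OF lin[OF B]]
    by (simp add: lie_bracket_def[of B] ) (simp add: lie_bracket_def)
  show ?thesis
    unfolding 1 2 3 using sym[OF V, of "A x" "B x"] sym[OF A, of "B x" "V x"] sym[OF B, of "A x" "V x"]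
    by (simp add: algebra_simps)
qed

text \<open>
  The explicit constant matters: it is the same for all fields whose partial derivatives have a
  common bound.
\<close>

lemma FD_bounds_from_partials:
  fixes F :: "real^'n \<Rightarrow> 'b::real_normed_vector"
  assumes F: "csmooth \<Omega> F" and K: "cball p \<rho> \<subseteq> \<Omega>"
    and b: "\<And>i x. x \<in> cball p \<rho> \<Longrightarrow> norm (FD F x (axis i 1)) \<le> b i"
  shows "x \<in> cball p \<rho> \<Longrightarrow> norm (FD F x w) \<le> (\<Sum>i\<in>UNIV. \<bar>b i\<bar>) * norm w"
    and "x \<in> cball p \<rho> \<Longrightarrow> y \<in> cball p \<rho> \<Longrightarrow> norm (F x - F y) \<le> (\<Sum>i\<in>UNIV. \<bar>b i\<bar>) * norm (x - y)"
proof -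
  define C where "C = (\<Sum>i\<in>UNIV. \<bar>b i\<bar>)"
  have bd: "norm (FD F x w) \<le> C * norm w" if x: "x \<in> cball p \<rho>" for x w
  proof -
    have "norm (FD F x w) \<le> (\<Sum>i\<in>UNIV. \<bar>b i\<bar> * norm w)"
      unfolding FD_expand[OF csmooth_differentiable[OF F subsetD[OF K x]], of w]
    proof (rule sum_norm_le)
      fix i
      have "\<bar>w $ i\<bar> * norm (FD F x (axis i 1)) \<le> norm w * \<bar>b i\<bar>"
        using b[OF x, of i] by (intro mult_mono component_le_norm_cart) auto
      then show "norm (w $ i *\<^sub>R FD F x (axis i 1)) \<le> \<bar>b i\<bar> * norm w" by (simp add: mult.commute)
    qed
    then show ?thesis by (simp add: C_def sum_distrib_right)
  qed
  then show "x \<in> cball p \<rho> \<Longrightarrow> norm (FD F x w) \<le> (\<Sum>i\<in>UNIV. \<bar>b i\<bar>) * norm w"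
    by (simp add: C_def)
  assume xy: "x \<in> cball p \<rho>" "y \<in> cball p \<rho>"
  have "norm (F x - F y) \<le> C * norm (x - y)"
  proof (rule differentiable_bound[of "cball p \<rho>" F "FD F" C])
    show "onorm (FD F z) \<le> C" if "z \<in> cball p \<rho>" for z
      by (rule onorm_le) (use bd[OF that] in auto)
    show "(F has_derivative FD F z) (at z within cball p \<rho>)" if "z \<in> cball p \<rho>" for z
      by (rule has_derivative_at_withinI[OF csmooth_has_derivative[OF F subsetD[OF K that]]])
  qed (use xy in auto)
  then show "norm (F x - F y) \<le> (\<Sum>i\<in>UNIV. \<bar>b i\<bar>) * norm (x - y)" by (simp add: C_def)
qed

lemma csmooth_continuous_on:
  assumes "csmooth \<Omega> F" shows "S \<subseteq> \<Omega> \<Longrightarrow> continuous_on S F"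
  using csmooth_has_derivative[OF assms]
  by (meson continuous_at_imp_continuous_on has_derivative_continuous subsetD)

lemma csmooth_bounds_cball:
  fixes F :: "real^'n \<Rightarrow> 'b::real_normed_vector"
  assumes F: "csmooth \<Omega> F" and K: "cball p \<rho> \<subseteq> \<Omega>"
  shows "\<exists>C\<ge>0. \<forall>x\<in>cball p \<rho>. (\<forall>w. norm (FD F x w) \<le> C * norm w) \<and>
    (\<forall>y\<in>cball p \<rho>. norm (F x - F y) \<le> C * norm (x - y))"
proof -
  have "\<exists>b. \<forall>x\<in>cball p \<rho>. norm (FD F x (axis i 1)) \<le> b" for i
    using compact_imp_bounded[OF compact_continuous_image[OF csmooth_continuous_on[OF csmooth_FD[OF F] K] compact_cball]]
    unfolding bounded_iff by fast
  then obtain b where b: "\<And>i x. x \<in> cball p \<rho> \<Longrightarrow> norm (FD F x (axis i 1)) \<le> b i" by metis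
  note bnd = FD_bounds_from_partials[OF F K b]
  show ?thesis
    by (intro exI[of _ "\<Sum>i\<in>UNIV. \<bar>b i\<bar>"] conjI ballI allI) (simp_all only: bnd sum_nonneg abs_ge_zero)
qed

section \<open>Second order estimates for commutators\<close>

text \<open>
  One constant for the size and the Lipschitz norm of a field and of its derivative, together with
  the Taylor estimate that they imply on a convex set.
\<close>

definition c11 :: "real \<Rightarrow> (real^'n) set \<Rightarrow> (real^'n \<Rightarrow> real^'n) \<Rightarrow> bool"
  where "c11 B K Z \<longleftrightarrow> 1 \<le> B \<and> (\<forall>x\<in>K. norm (Z x) \<le> B \<and> (\<forall>w. norm (FD Z x w) \<le> B * norm w) \<and>
    linear (FD Z x) \<and>
    (\<forall>y\<in>K. norm (Z x - Z y) \<le> B * norm (x - y) \<and>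
      (\<forall>w. norm (FD Z x w - FD Z y w) \<le> B * norm (x - y) * norm w) \<and>
      norm (Z y - Z x - FD Z x (y - x)) \<le> B * (norm (y - x))\<^sup>2))"

lemma c11D:
  assumes "c11 B K Z"
  shows "1 \<le> B" "x \<in> K \<Longrightarrow> norm (Z x) \<le> B" "x \<in> K \<Longrightarrow> norm (FD Z x w) \<le> B * norm w"
    "x \<in> K \<Longrightarrow> linear (FD Z x)"
    "x \<in> K \<Longrightarrow> y \<in> K \<Longrightarrow> norm (Z x - Z y) \<le> B * norm (x - y)"
    "x \<in> K \<Longrightarrow> y \<in> K \<Longrightarrow> norm (FD Z x w - FD Z y w) \<le> B * norm (x - y) * norm w"
    "x \<in> K \<Longrightarrow> y \<in> K \<Longrightarrow> norm (Z y - Z x - FD Z x (y - x)) \<le> B * (norm (y - x))\<^sup>2"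
  using assms unfolding c11_def by blast+

lemma c11_mono:
  assumes Z: "c11 B K Z" and le: "B \<le> B'"
  shows "c11 B' K Z"
  unfolding c11_def
proof (intro conjI ballI allI)
  note D = c11D[OF Z]
  show "1 \<le> B'" using D(1) le by simp
  fix x assume x: "x \<in> K"
  show "norm (Z x) \<le> B'" using D(2)[OF x] le by simp
  show "norm (FD Z x w) \<le> B' * norm w" for w
    using D(3)[OF x, of w] mult_right_mono[OF le norm_ge_zero, of w] by linarith
  show "linear (FD Z x)" using D(4)[OF x] .
  fix y assume y: "y \<in> K"
  show "norm (Z x - Z y) \<le> B' * norm (x - y)"
    using D(5)[OF x y] by (rule order_trans) (simp add: mult_right_mono le)
  show "norm (FD Z x w - FD Z y w) \<le> B' * norm (x - y) * norm w" for w
    using D(6)[OF x y] by (rule order_trans) (simp add: mult_right_mono le)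
  show "norm (Z y - Z x - FD Z x (y - x)) \<le> B' * (norm (y - x))\<^sup>2"
    using D(7)[OF x y] by (rule order_trans) (simp add: mult_right_mono le)
qed

lemma csmooth_imp_c11:
  assumes Z: "csmooth \<Omega> Z" and K: "cball p \<rho> \<subseteq> \<Omega>"
  shows "\<exists>B. c11 B (cball p \<rho>) Z"
proof -
  obtain C where C: "0 \<le> C" "\<And>x w. x \<in> cball p \<rho> \<Longrightarrow> norm (FD Z x w) \<le> C * norm w"
    "\<And>x y. x \<in> cball p \<rho> \<Longrightarrow> y \<in> cball p \<rho> \<Longrightarrow> norm (Z x - Z y) \<le> C * norm (x - y)"
    using csmooth_bounds_cball[OF Z K] by blast
  have "\<exists>c\<ge>0. \<forall>x\<in>cball p \<rho>. \<forall>y\<in>cball p \<rho>. norm (FD Z x (axis i 1) - FD Z y (axis i 1)) \<le> c * norm (x - y)" for i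
    using csmooth_bounds_cball[OF csmooth_FD[OF Z, of "axis i 1"] K] by blast
  then obtain c where c: "\<And>i. 0 \<le> c i"
    "\<And>i x y. x \<in> cball p \<rho> \<Longrightarrow> y \<in> cball p \<rho> \<Longrightarrow> norm (FD Z x (axis i 1) - FD Z y (axis i 1)) \<le> c i * norm (x - y)"
    by metis
  have "continuous_on (cball p \<rho>) Z"
    using csmooth_has_derivative[OF Z] K
    by (meson continuous_at_imp_continuous_on has_derivative_continuous subsetD)
  then have "bounded (Z ` cball p \<rho>)"
    by (rule compact_imp_bounded[OF compact_continuous_image[OF _ compact_cball]])
  then obtain M where M: "\<And>x. x \<in> cball p \<rho> \<Longrightarrow> norm (Z x) \<le> M"
    unfolding bounded_iff by blast
  define S where "S = (\<Sum>i\<in>UNIV. c i)"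
  have S0: "0 \<le> S" using c by (simp add: S_def sum_nonneg)
  define B where "B = 1 + \<bar>M\<bar> + C + S"
  have B: "1 \<le> B" "M \<le> B" "C \<le> B" "S \<le> B" using S0 C(1) by (auto simp: B_def)
  have L: "norm (FD Z x w - FD Z y w) \<le> B * norm (x - y) * norm w" if xy: "x \<in> cball p \<rho>" "y \<in> cball p \<rho>" for x y w
  proof -
    have "FD Z x w - FD Z y w = (\<Sum>i\<in>UNIV. w $ i *\<^sub>R (FD Z x (axis i 1) - FD Z y (axis i 1)))"
      using FD_expand[OF csmooth_differentiable[OF Z subsetD[OF K xy(1)]], of w]
        FD_expand[OF csmooth_differentiable[OF Z subsetD[OF K xy(2)]], of w]
      by (simp add: sum_subtractf scaleR_diff_right)
    also have "norm \<dots> \<le> (\<Sum>i\<in>UNIV. norm w * (c i * norm (x - y)))"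
    proof (rule sum_norm_le)
      fix i
      have "\<bar>w $ i\<bar> * norm (FD Z x (axis i 1) - FD Z y (axis i 1)) \<le> norm w * (c i * norm (x - y))"
        by (intro mult_mono component_le_norm_cart c xy) auto
      then show "norm (w $ i *\<^sub>R (FD Z x (axis i 1) - FD Z y (axis i 1))) \<le> norm w * (c i * norm (x - y))" by simp
    qed
    also have "\<dots> = S * norm (x - y) * norm w"
      by (simp add: S_def sum_distrib_left sum_distrib_right mult_ac)
    also have "\<dots> \<le> B * norm (x - y) * norm w"
      using B by (intro mult_right_mono) auto
    finally show ?thesis .
  qed
  have T: "norm (Z y - Z x - FD Z x (y - x)) \<le> B * (norm (y - x))\<^sup>2" if xy: "x \<in> cball p \<rho>" "y \<in> cball p \<rho>" for x y
  proof -
    have "norm ((\<lambda>s. Z (x + s *\<^sub>R (y - x))) 1 - (\<lambda>s. Z (x + s *\<^sub>R (y - x))) 0 - FD Z x (y - x)) \<le> B * (norm (y - x))\<^sup>2"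
    proof (rule unit_interval_mean_value)
      fix s :: real assume s: "s \<in> {0..1}"
      have "(1 - s) *\<^sub>R x + s *\<^sub>R y \<in> cball p \<rho>"
        by (rule convexD_alt[OF convex_cball xy]) (use s in auto)
      then have z: "x + s *\<^sub>R (y - x) \<in> cball p \<rho>" by (simp add: algebra_simps)
      show "((\<lambda>s. Z (x + s *\<^sub>R (y - x))) has_vector_derivative FD Z (x + s *\<^sub>R (y - x)) (y - x)) (at s)"
        by (rule line_has_vector_derivative[OF csmooth_has_derivative[OF Z subsetD[OF K z]]])
      have "norm (FD Z (x + s *\<^sub>R (y - x)) (y - x) - FD Z x (y - x)) \<le> B * norm (x + s *\<^sub>R (y - x) - x) * norm (y - x)"
        by (rule L[OF z xy(1)])
      also have "\<dots> = s * (B * (norm (y - x))\<^sup>2)" using s by (simp add: power2_eq_square)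
      also have "\<dots> \<le> 1 * (B * (norm (y - x))\<^sup>2)" using s B by (intro mult_right_mono) auto
      finally show "norm (FD Z (x + s *\<^sub>R (y - x)) (y - x) - FD Z x (y - x)) \<le> B * (norm (y - x))\<^sup>2" by simp
    qed
    then show ?thesis by simp
  qed
  have "c11 B (cball p \<rho>) Z"
    unfolding c11_def
  proof (intro conjI ballI allI B(1))
    fix x assume x: "x \<in> cball p \<rho>"
    show "norm (Z x) \<le> B" using M[OF x] B by linarith
    show "linear (FD Z x)" using has_derivative_linear[OF csmooth_has_derivative[OF Z]] x K by blast
    show "norm (FD Z x w) \<le> B * norm w" for w
      using C(2)[OF x, of w] mult_right_mono[OF B(3), of "norm w"] by simp
    fix y assume y: "y \<in> cball p \<rho>"
    show "norm (Z x - Z y) \<le> B * norm (x - y)"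
      using C(3)[OF x y] mult_right_mono[OF B(3), of "norm (x - y)"] by simp
  qed (use L T in auto)
  then show ?thesis by blast
qed

lemma finite_common_bound:
  fixes P :: "real \<Rightarrow> 'i \<Rightarrow> bool"
  assumes "finite I" "\<And>i. i \<in> I \<Longrightarrow> \<exists>B. P B i" "\<And>B B' i. P B i \<Longrightarrow> B \<le> B' \<Longrightarrow> P B' i"
  shows "\<exists>B\<ge>b. \<forall>i\<in>I. P B i"
  using assms(1,2)
proof (induction I)
  case (insert i I)
  then obtain B1 B2 where "P B1 i" "B2 \<ge> b" "\<forall>i\<in>I. P B2 i" by blast
  then show ?case
    using assms(3) by (intro exI[of _ "max B1 B2"]) (auto simp: le_max_iff_disj)
qed auto

lemma c11_trunc:
  assumes "c11 B (cball p \<rho>) Z" "0 \<le> \<rho>"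
  shows "lip B (trunc (cball p \<rho>) Z)" "norm (trunc (cball p \<rho>) Z x) \<le> B"
proof -
  note D = c11D[OF assms(1)]
  have ne: "cball p \<rho> \<noteq> {}" using assms(2) by auto
  show "lip B (trunc (cball p \<rho>) Z)"
    by (rule trunc_lip[OF closed_cball convex_cball ne]) (use D in auto)
  show "norm (trunc (cball p \<rho>) Z x) \<le> B"
    using trunc_all[OF closed_cball ne, of "\<lambda>v. norm v \<le> B" Z x] D(2) by blast
qed

text \<open>
  The difference of two nearby flow curves is compared with its initial value \<open>w\<close>, and the result is
  inserted into the integral equation to obtain the next order. This takes the place of the
  differentiability of the flow with respect to the initial value: in the second estimate
  every error term is quadratic in \<open>w\<close> or quadratic in \<open>s\<close>.
\<close>

lemma flow_second_order:
  fixes p :: "real^'n"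
  assumes Z: "c11 B (cball p \<rho>) Z" and \<rho>: "0 \<le> \<rho>" and s: "B * \<bar>s\<bar> \<le> 1"
    and y: "norm (y - p) + B * \<bar>s\<bar> \<le> \<rho>" and yw: "norm (y + w - p) + B * \<bar>s\<bar> \<le> \<rho>"
  defines "T \<equiv> trunc (cball p \<rho>) Z"
  shows "norm (flow T s (y + w) - flow T s y - w) \<le> 3 * \<bar>s\<bar> * B * norm w"
    and "norm (flow T s (y + w) - flow T s y - w - s *\<^sub>R FD Z y w)
      \<le> \<bar>s\<bar> * (9 * B * (norm w)\<^sup>2 + 6 * B\<^sup>2 * \<bar>s\<bar> * norm w)"
proof -
  note D = c11D[OF Z]
  have lT: "lip B T" and bT: "\<And>x. norm (T x) \<le> B"
    using c11_trunc[OF Z \<rho>] by (auto simp: T_def)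
  define a where "a = flow_curve T s y"
  define b where "b = flow_curve T s (y + w)"
  have a: "solves (\<lambda>_ z. s *\<^sub>R T z) y a" and b: "solves (\<lambda>_ z. s *\<^sub>R T z) (y + w) b"
    by (auto simp: a_def b_def flow_curve_solves[OF lT])
  have amv: "norm (a t - y) \<le> B * \<bar>s\<bar>" and bmv: "norm (b t - (y + w)) \<le> B * \<bar>s\<bar>" if "t \<in> {0..1}" for t
    using that by (auto simp: a_def b_def intro!: flow_curve_move[OF lT bT])
  have aK: "a t \<in> cball p \<rho>" if "t \<in> {0..1}" for t
    using amv[OF that] y norm_triangle_ineq[of "a t - y" "y - p"] by (simp add: dist_norm norm_minus_commute)
  have bK: "b t \<in> cball p \<rho>" if "t \<in> {0..1}" for t
    using bmv[OF that] yw norm_triangle_ineq[of "b t - (y + w)" "y + w - p"] by (simp add: dist_norm norm_minus_commute)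
  have yK: "y \<in> cball p \<rho>" using y D(1) by (simp add: dist_norm norm_minus_commute)
      (smt (verit) mult_nonneg_nonneg abs_ge_zero)
  define u where "u t = b t - a t" for t
  have u3: "norm (u t) \<le> 3 * norm w" if t: "t \<in> {0..1}" for t
  proof -
    have "norm (b t - a t) \<le> (norm (y + w - y) + 0) * exp (\<bar>s\<bar> * B)"
      by (rule solutions_close[OF b a _ _ _ t]) (use lip_scaleR_le[OF lT] D(1) in auto)
    also have "\<dots> \<le> norm w * exp 1"
      using s by (simp add: mult.commute mult_left_mono)
    also have "\<dots> \<le> norm w * 3" using exp_le by (intro mult_left_mono) auto
    finally show ?thesis by (simp add: u_def mult.commute)
  qed
  have ui: "((\<lambda>r. s *\<^sub>R T (b r) - s *\<^sub>R T (a r)) has_integral (u t - w)) {0..t}" if t: "t \<in> {0..1}" for t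
  proof -
    have "((\<lambda>r. s *\<^sub>R T (b r) - s *\<^sub>R T (a r)) has_integral ((b t - (y + w)) - (a t - y))) {0..t}"
      using a b t unfolding solves_def by (intro has_integral_diff) auto
    moreover have "(b t - (y + w)) - (a t - y) = u t - w" by (simp add: u_def)
    ultimately show ?thesis by metis
  qed
  have uw: "norm (u t - w) \<le> 3 * \<bar>s\<bar> * B * norm w" if t: "t \<in> {0..1}" for t
  proof -
    have "norm (u t - w) \<le> (3 * \<bar>s\<bar> * B * norm w) * measure lborel (cbox 0 t)"
    proof (rule has_integral_bound)
      show "((\<lambda>r. s *\<^sub>R T (b r) - s *\<^sub>R T (a r)) has_integral (u t - w)) (cbox 0 t)" using ui[OF t] by simp
      show "0 \<le> 3 * \<bar>s\<bar> * B * norm w" using D(1) by simp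
      fix r assume "r \<in> cbox 0 t"
      then have r: "r \<in> {0..1}" using t by auto
      have "norm (s *\<^sub>R T (b r) - s *\<^sub>R T (a r)) \<le> (\<bar>s\<bar> * B) * norm (u r)"
        unfolding u_def by (rule lip_scaleR_le[OF lT])
      also have "\<dots> \<le> (\<bar>s\<bar> * B) * (3 * norm w)" by (intro mult_left_mono u3 r) (use D(1) in auto)
      finally show "norm (s *\<^sub>R T (b r) - s *\<^sub>R T (a r)) \<le> 3 * \<bar>s\<bar> * B * norm w" by (simp add: mult_ac)
    qed
    also have "\<dots> \<le> (3 * \<bar>s\<bar> * B * norm w) * 1" using t D(1) by (intro mult_left_mono) auto
    finally show ?thesis by simp
  qed
  have u1: "u 1 = flow T s (y + w) - flow T s y" by (simp add: u_def a_def b_def flow_def)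
  show "norm (flow T s (y + w) - flow T s y - w) \<le> 3 * \<bar>s\<bar> * B * norm w"
    using uw[of 1] by (simp add: u1)
  define E where "E = \<bar>s\<bar> * (9 * B * (norm w)\<^sup>2 + 6 * B\<^sup>2 * \<bar>s\<bar> * norm w)"
  have E0: "0 \<le> E" using D(1) by (simp add: E_def)
  have "norm (u 1 - w - s *\<^sub>R FD Z y w) \<le> E * measure lborel (cbox 0 (1::real))"
  proof (rule has_integral_bound[OF E0])
    show "((\<lambda>r. s *\<^sub>R T (b r) - s *\<^sub>R T (a r) - s *\<^sub>R FD Z y w) has_integral (u 1 - w - s *\<^sub>R FD Z y w)) (cbox 0 1)"
      using has_integral_diff[OF ui[of 1] has_integral_const_real[of "s *\<^sub>R FD Z y w" 0 1]] by simp
    fix r :: real assume "r \<in> cbox 0 1"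
    then have r: "r \<in> {0..1}" by simp
    have lin: "linear (FD Z y)" "linear (FD Z (a r))" using D(4) yK aK[OF r] by auto
    have "T (b r) = Z (b r)" "T (a r) = Z (a r)" using aK[OF r] bK[OF r] by (auto simp: T_def trunc_eq)
    then have eq: "s *\<^sub>R T (b r) - s *\<^sub>R T (a r) - s *\<^sub>R FD Z y w =
       s *\<^sub>R ((Z (b r) - Z (a r) - FD Z (a r) (b r - a r)) + (FD Z (a r) (u r) - FD Z y (u r)) + FD Z y (u r - w))"
    proof -
      have l: "FD Z y (u r - w) = FD Z y (u r) - FD Z y w" by (rule linear_diff[OF lin(1)])
      have ur: "b r - a r = u r" by (simp add: u_def)
      show ?thesis
        unfolding \<open>T (b r) = Z (b r)\<close> \<open>T (a r) = Z (a r)\<close> l ur by (simp add: algebra_simps)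
    qed
    have n1: "norm (Z (b r) - Z (a r) - FD Z (a r) (b r - a r)) \<le> 9 * B * (norm w)\<^sup>2"
    proof -
      have "norm (Z (b r) - Z (a r) - FD Z (a r) (b r - a r)) \<le> B * (norm (u r))\<^sup>2"
        using D(7)[OF aK[OF r] bK[OF r]] by (simp add: u_def)
      also have "\<dots> \<le> B * (3 * norm w)\<^sup>2" using u3[OF r] D(1) by (intro mult_left_mono power_mono) auto
      finally show ?thesis by (simp add: power_mult_distrib)
    qed
    have n2: "norm (FD Z (a r) (u r) - FD Z y (u r)) \<le> 3 * B\<^sup>2 * \<bar>s\<bar> * norm w"
    proof -
      have "norm (FD Z (a r) (u r) - FD Z y (u r)) \<le> B * norm (a r - y) * norm (u r)"
        by (rule D(6)[OF aK[OF r] yK])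
      also have "\<dots> \<le> B * (B * \<bar>s\<bar>) * (3 * norm w)"
        using amv[OF r] u3[OF r] D(1) by (intro mult_mono) auto
      finally show ?thesis by (simp add: power2_eq_square mult_ac)
    qed
    have n3: "norm (FD Z y (u r - w)) \<le> 3 * B\<^sup>2 * \<bar>s\<bar> * norm w"
    proof -
      have "norm (FD Z y (u r - w)) \<le> B * norm (u r - w)" by (rule D(3)[OF yK])
      also have "\<dots> \<le> B * (3 * \<bar>s\<bar> * B * norm w)" using uw[OF r] D(1) by (intro mult_left_mono) auto
      finally show ?thesis by (simp add: power2_eq_square mult_ac)
    qed
    have "norm ((Z (b r) - Z (a r) - FD Z (a r) (b r - a r)) + (FD Z (a r) (u r) - FD Z y (u r)) + FD Z y (u r - w))
        \<le> 9 * B * (norm w)\<^sup>2 + 6 * B\<^sup>2 * \<bar>s\<bar> * norm w"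
      using norm_triangle_le[OF add_mono[OF norm_triangle_le[OF add_mono[OF n1 n2]] n3]] by (simp add: algebra_simps)
    then show "norm (s *\<^sub>R T (b r) - s *\<^sub>R T (a r) - s *\<^sub>R FD Z y w) \<le> E"
      unfolding eq E_def by (simp add: mult_left_mono)
  qed
  then show "norm (flow T s (y + w) - flow T s y - w - s *\<^sub>R FD Z y w)
      \<le> \<bar>s\<bar> * (9 * B * (norm w)\<^sup>2 + 6 * B\<^sup>2 * \<bar>s\<bar> * norm w)"
    by (simp add: u1 E_def)
qed

text \<open>
  The map \<open>\<Phi>\<close> approximates the flow of \<open>V\<close> up to \<open>\<eta> * \<bar>\<tau>\<bar>\<close>. Conjugating it by the flow of \<open>Z\<close> for
  the time \<open>s\<close> replaces \<open>V\<close> by \<open>V + s [Z, V]\<close> up to \<open>s\<^sup>2\<close>, and the last motion removes \<open>V\<close>. Relative to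
  the displacement \<open>s * \<sigma>\<close>, the error is of order \<open>\<eta> / s + \<bar>\<sigma>\<bar> / s + s\<close>, which is small
  if \<open>s\<close> is chosen first and \<open>\<eta>\<close> and \<open>\<sigma>\<close> afterwards.
\<close>

lemma commutator_estimate:
  fixes p :: "real^'n"
  assumes Z: "c11 B (cball p \<rho>) Z" and V: "c11 B (cball p \<rho>) V" and \<rho>: "0 \<le> \<rho>"
    and \<Phi>: "\<And>x \<tau>. x \<in> cball p r' \<Longrightarrow> \<bar>\<tau>\<bar> = \<bar>\<sigma>\<bar> \<Longrightarrow> norm (\<Phi> \<tau> x - x - \<tau> *\<^sub>R V x) \<le> \<eta> * \<bar>\<tau>\<bar>"
    and \<eta>: "0 \<le> \<eta>" "\<eta> \<le> 1" and s: "0 < s" "B * s \<le> 1"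
    and x: "norm (x - p) \<le> r" and r1: "r + B * s \<le> r'" "r + 8 * B * \<bar>\<sigma>\<bar> \<le> r'"
    and r1\<rho>: "r' + 2 * B * \<bar>\<sigma>\<bar> + B * s \<le> \<rho>"
  defines "T \<equiv> trunc (cball p \<rho>) Z"
  shows "norm (\<Phi> (- \<sigma>) (flow T (- s) (\<Phi> \<sigma> (flow T s x))) - x - (s * \<sigma>) *\<^sub>R lie_bracket Z V x)
    \<le> \<bar>\<sigma>\<bar> * ((2 + B) * \<eta> + 44 * B ^ 3 * \<bar>\<sigma>\<bar> + 16 * B ^ 3 * s\<^sup>2)"
proof -
  note D = c11D[OF Z] and DV = c11D[OF V]
  have B1: "1 \<le> B" by (rule D(1))
  then have B0: "0 \<le> B" by simp
  have Bs: "0 \<le> B * s" "0 \<le> 2 * B * \<bar>\<sigma>\<bar>" using B0 s by auto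
  have s1: "s \<le> 1"
  proof -
    have "1 * s \<le> B * s" by (rule mult_right_mono) (use s B1 in auto)
    then show ?thesis using s by linarith
  qed
  have lT: "lip B T" and bT: "\<And>x. norm (T x) \<le> B"
    using c11_trunc[OF Z \<rho>] by (auto simp: T_def)
  define y where "y = flow T s x"
  define w where "w = \<Phi> \<sigma> y - y"
  define z where "z = flow T (- s) (y + w)"
  define f where "f = \<Phi> (- \<sigma>) z"
  have xK: "x \<in> cball p \<rho>" using x r1 r1\<rho> Bs by (simp add: dist_norm norm_minus_commute)
  have yx: "norm (y - x) \<le> B * s" using flow_move[OF lT bT, of s x] s by (simp add: y_def)
  have yx2: "norm (y - x - s *\<^sub>R Z x) \<le> B * B * s\<^sup>2"
    using flow_first_order[OF lT bT, of s x] xK by (simp add: y_def T_def trunc_eq)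
  have yp: "norm (y - p) \<le> r'" using norm_triangle_ineq[of "y - x" "x - p"] yx x r1 by simp
  then have y1: "y \<in> cball p r'" and yK: "y \<in> cball p \<rho>" using r1\<rho> Bs by (auto simp: dist_norm norm_minus_commute)
  have w1: "norm (w - \<sigma> *\<^sub>R V y) \<le> \<eta> * \<bar>\<sigma>\<bar>" unfolding w_def by (rule \<Phi>[OF y1]) simp
  have w2: "norm w \<le> 2 * B * \<bar>\<sigma>\<bar>"
  proof -
    have "norm w \<le> norm (w - \<sigma> *\<^sub>R V y) + norm (\<sigma> *\<^sub>R V y)"
      using norm_triangle_ineq[of "w - \<sigma> *\<^sub>R V y" "\<sigma> *\<^sub>R V y"] by simp
    also have "\<dots> \<le> B * \<bar>\<sigma>\<bar> + \<bar>\<sigma>\<bar> * B"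
    proof (rule add_mono)
      show "norm (w - \<sigma> *\<^sub>R V y) \<le> B * \<bar>\<sigma>\<bar>"
        using w1 mult_right_mono[of \<eta> B "\<bar>\<sigma>\<bar>"] \<eta> B1 by simp
      show "norm (\<sigma> *\<^sub>R V y) \<le> \<bar>\<sigma>\<bar> * B" using DV(2)[OF yK] by (simp add: mult_left_mono)
    qed
    finally show ?thesis by (simp add: mult_ac)
  qed
  have z0: "flow T (- s) y = x" unfolding y_def by (rule flow_inverse[OF lT])
  have c1: "norm (y - p) + B * \<bar>- s\<bar> \<le> \<rho>" using yp r1\<rho> s Bs by simp
  have c2: "norm (y + w - p) + B * \<bar>- s\<bar> \<le> \<rho>"
    using yp w2 r1\<rho> s norm_triangle_ineq[of "y - p" w] by (simp add: algebra_simps)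
  have c3: "B * \<bar>- s\<bar> \<le> 1" using s by simp
  note so = flow_second_order[OF Z \<rho> c3 c1 c2, folded T_def, unfolded z0, folded z_def]
  have zx: "norm (z - x) \<le> 8 * B * \<bar>\<sigma>\<bar>"
  proof -
    have "norm (z - x) \<le> norm (z - x - w) + norm w" using norm_triangle_ineq[of "z - x - w" w] by simp
    also have "\<dots> \<le> 3 * (B * s) * norm w + norm w" using so(1) s by (simp add: mult_ac)
    also have "\<dots> \<le> 3 * 1 * norm w + norm w" using s by (intro add_right_mono mult_right_mono mult_left_mono) auto
    also have "\<dots> \<le> 8 * B * \<bar>\<sigma>\<bar>" using w2 by simp
    finally show ?thesis .
  qed
  have zp: "norm (z - p) \<le> r'" using norm_triangle_ineq[of "z - x" "x - p"] zx x r1 by simp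
  then have z1: "z \<in> cball p r'" and zK: "z \<in> cball p \<rho>" using r1\<rho> Bs by (auto simp: dist_norm norm_minus_commute)
  \<comment> \<open>The six sources of error; their signed sum is the quantity to be estimated.\<close>
  define t1 where "t1 = f - z + \<sigma> *\<^sub>R V z"
  define t2 where "t2 = z - x - w + s *\<^sub>R FD Z y w"
  define t3 where "t3 = w - \<sigma> *\<^sub>R V y"
  define t4 where "t4 = s *\<^sub>R (FD Z y w - \<sigma> *\<^sub>R FD Z x (V x))"
  define t5 where "t5 = \<sigma> *\<^sub>R (V y - V x - s *\<^sub>R FD V x (Z x))"
  define t6 where "t6 = \<sigma> *\<^sub>R (V z - V x)"
  have T1: "norm t1 \<le> \<bar>\<sigma>\<bar> * \<eta>" using \<Phi>[OF z1, of "- \<sigma>"] by (simp add: t1_def f_def mult.commute)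
  have T2: "norm t2 \<le> \<bar>\<sigma>\<bar> * (36 * B ^ 3 * \<bar>\<sigma>\<bar> + 12 * B ^ 3 * s\<^sup>2)"
  proof -
    have "norm t2 \<le> s * (9 * B * (norm w)\<^sup>2 + 6 * B\<^sup>2 * s * norm w)" using so(2) s by (simp add: t2_def)
    also have "\<dots> \<le> s * (9 * B * (2 * B * \<bar>\<sigma>\<bar>)\<^sup>2 + 6 * B\<^sup>2 * s * (2 * B * \<bar>\<sigma>\<bar>))"
      using w2 s B0 by (intro mult_left_mono add_mono power_mono) auto
    also have "\<dots> = \<bar>\<sigma>\<bar> * (s * (36 * B ^ 3 * \<bar>\<sigma>\<bar>) + 12 * B ^ 3 * s\<^sup>2)"
      by (simp add: power2_eq_square power3_eq_cube algebra_simps)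
    also have "\<dots> \<le> \<bar>\<sigma>\<bar> * (1 * (36 * B ^ 3 * \<bar>\<sigma>\<bar>) + 12 * B ^ 3 * s\<^sup>2)"
      using s1 B0 by (intro mult_left_mono add_right_mono mult_right_mono) auto
    finally show ?thesis by simp
  qed
  have T3: "norm t3 \<le> \<bar>\<sigma>\<bar> * \<eta>" using w1 by (simp add: t3_def mult.commute)
  have T4: "norm t4 \<le> \<bar>\<sigma>\<bar> * (B * \<eta> + 2 * B ^ 3 * s\<^sup>2)"
  proof -
    have lin: "linear (FD Z y)" by (rule D(4)[OF yK])
    have eq: "FD Z y w - \<sigma> *\<^sub>R FD Z x (V x) = FD Z y (w - \<sigma> *\<^sub>R V y) + \<sigma> *\<^sub>R FD Z y (V y - V x)
        + \<sigma> *\<^sub>R (FD Z y (V x) - FD Z x (V x))"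
      by (simp add: linear_diff[OF lin] linear_scale[OF lin] algebra_simps)
    have a: "norm (FD Z y (w - \<sigma> *\<^sub>R V y)) \<le> B * (\<eta> * \<bar>\<sigma>\<bar>)"
      using D(3)[OF yK, of "w - \<sigma> *\<^sub>R V y"] mult_left_mono[OF w1 B0] by simp
    have b: "norm (\<sigma> *\<^sub>R FD Z y (V y - V x)) \<le> \<bar>\<sigma>\<bar> * (B * (B * (B * s)))"
    proof -
      have "norm (FD Z y (V y - V x)) \<le> B * (B * (B * s))"
        using D(3)[OF yK, of "V y - V x"] mult_left_mono[OF DV(5)[OF yK xK] B0]
          mult_left_mono[OF mult_left_mono[OF yx B0] B0] by linarith
      then show ?thesis by (simp add: mult_left_mono)
    qed
    have c: "norm (\<sigma> *\<^sub>R (FD Z y (V x) - FD Z x (V x))) \<le> \<bar>\<sigma>\<bar> * (B * (B * s) * B)"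
    proof -
      have "norm (FD Z y (V x) - FD Z x (V x)) \<le> B * norm (y - x) * norm (V x)" by (rule D(6)[OF yK xK])
      also have "\<dots> \<le> B * (B * s) * B" using yx DV(2)[OF xK] B0 s by (intro mult_mono) auto
      finally show ?thesis by (simp add: mult_left_mono)
    qed
    have "norm (FD Z y w - \<sigma> *\<^sub>R FD Z x (V x)) \<le> B * (\<eta> * \<bar>\<sigma>\<bar>) + \<bar>\<sigma>\<bar> * (B * (B * (B * s))) + \<bar>\<sigma>\<bar> * (B * (B * s) * B)"
      unfolding eq by (rule norm_triangle_le[OF add_mono[OF norm_triangle_le[OF add_mono[OF a b]] c]])
    then have "norm t4 \<le> s * (B * (\<eta> * \<bar>\<sigma>\<bar>) + \<bar>\<sigma>\<bar> * (B * (B * (B * s))) + \<bar>\<sigma>\<bar> * (B * (B * s) * B))"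
      using s by (simp add: t4_def mult_left_mono)
    also have "\<dots> = \<bar>\<sigma>\<bar> * (s * (B * \<eta>) + 2 * B ^ 3 * s\<^sup>2)"
      by (simp add: power2_eq_square power3_eq_cube algebra_simps)
    also have "\<dots> \<le> \<bar>\<sigma>\<bar> * (1 * (B * \<eta>) + 2 * B ^ 3 * s\<^sup>2)"
      using s1 B0 \<eta> by (intro mult_left_mono add_right_mono mult_right_mono) auto
    finally show ?thesis by simp
  qed
  have T5: "norm t5 \<le> \<bar>\<sigma>\<bar> * (2 * B ^ 3 * s\<^sup>2)"
  proof -
    have lin: "linear (FD V x)" by (rule DV(4)[OF xK])
    have eq: "V y - V x - s *\<^sub>R FD V x (Z x) = (V y - V x - FD V x (y - x)) + FD V x (y - x - s *\<^sub>R Z x)"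
      by (simp add: linear_diff[OF lin] linear_scale[OF lin])
    have a: "norm (V y - V x - FD V x (y - x)) \<le> B * (B * s)\<^sup>2"
      using DV(7)[OF xK yK] mult_left_mono[OF power_mono[OF yx norm_ge_zero, of 2] B0] by linarith
    have b: "norm (FD V x (y - x - s *\<^sub>R Z x)) \<le> B * (B * B * s\<^sup>2)"
      using DV(3)[OF xK, of "y - x - s *\<^sub>R Z x"] mult_left_mono[OF yx2 B0] by linarith
    have "norm (V y - V x - s *\<^sub>R FD V x (Z x)) \<le> B * (B * s)\<^sup>2 + B * (B * B * s\<^sup>2)"
      unfolding eq by (rule norm_triangle_le[OF add_mono[OF a b]])
    also have "\<dots> = 2 * B ^ 3 * s\<^sup>2" by (simp add: power2_eq_square power3_eq_cube)
    finally show ?thesis by (simp add: t5_def mult_left_mono)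
  qed
  have T6: "norm t6 \<le> \<bar>\<sigma>\<bar> * (8 * B ^ 3 * \<bar>\<sigma>\<bar>)"
  proof -
    have "norm (V z - V x) \<le> B * (8 * B * \<bar>\<sigma>\<bar>)"
      using DV(5)[OF zK xK] mult_left_mono[OF zx B0] by linarith
    also have "\<dots> = 8 * B\<^sup>2 * \<bar>\<sigma>\<bar>" by (simp add: power2_eq_square)
    also have "\<dots> \<le> 8 * B ^ 3 * \<bar>\<sigma>\<bar>"
      using power_increasing[of 2 3 B] B1 by (intro mult_right_mono) auto
    finally show ?thesis by (simp add: t6_def mult_left_mono)
  qed
  have "f - x - (s * \<sigma>) *\<^sub>R lie_bracket Z V x = t1 + t2 + t3 - t4 + t5 - t6"
    by (simp add: t1_def t2_def t3_def t4_def t5_def t6_def lie_bracket_def algebra_simps)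
  also have "norm \<dots> \<le> norm t1 + norm t2 + norm t3 + norm t4 + norm t5 + norm t6"
    by (intro order_trans[OF norm_triangle_ineq] order_trans[OF norm_triangle_ineq4] add_mono order_refl)
  also have "\<dots> \<le> \<bar>\<sigma>\<bar> * \<eta> + \<bar>\<sigma>\<bar> * (36 * B ^ 3 * \<bar>\<sigma>\<bar> + 12 * B ^ 3 * s\<^sup>2) + \<bar>\<sigma>\<bar> * \<eta> + \<bar>\<sigma>\<bar> * (B * \<eta> + 2 * B ^ 3 * s\<^sup>2)
      + \<bar>\<sigma>\<bar> * (2 * B ^ 3 * s\<^sup>2) + \<bar>\<sigma>\<bar> * (8 * B ^ 3 * \<bar>\<sigma>\<bar>)"
    by (intro add_mono T1 T2 T3 T4 T5 T6)
  also have "\<dots> = \<bar>\<sigma>\<bar> * ((2 + B) * \<eta> + 44 * B ^ 3 * \<bar>\<sigma>\<bar> + 16 * B ^ 3 * s\<^sup>2)"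
    by (simp add: algebra_simps)
  finally show ?thesis by (simp add: f_def z_def w_def y_def)
qed


section \<open>Steering along brackets\<close>

text \<open>
  The word moves every point \<open>x\<close> of the ball of radius \<open>r\<close> by \<open>F v x\<close>, up to the relative error \<open>\<eta>\<close>, at
  a cost of at most \<open>\<eta>\<close>. The parameter \<open>v\<close> is a real number when the motion follows a single field, and
  a vector when several directions are combined.
\<close>

definition steers ::
  "nat \<Rightarrow> (nat \<Rightarrow> real^'n \<Rightarrow> real^'n) \<Rightarrow> real^'n \<Rightarrow> real \<Rightarrow> real \<Rightarrow> ('p::real_normed_vector \<Rightarrow> real^'n \<Rightarrow> real^'n) \<Rightarrow>
    real \<Rightarrow> (nat \<times> ('p \<Rightarrow> real)) list \<Rightarrow> bool"
  where "steers m T p r \<eta> F \<delta> W \<longleftrightarrow> 0 < \<delta> \<and>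
    (\<forall>a\<in>set W. fst a \<in> {1..m} \<and> continuous_on UNIV (snd a)) \<and>
    (\<forall>v. norm v \<le> \<delta> \<longrightarrow> wlen (at_param W v) \<le> \<eta> \<and>
      (\<forall>x\<in>cball p r. norm (run T (at_param W v) x - x - F v x) \<le> \<eta> * norm v))"

text \<open>
  The radius \<open>r\<close> ranges over all values below \<open>\<rho>\<close>, so that a motion can be followed by a second one that
  starts at the slightly displaced endpoints.
\<close>

definition steerable ::
  "nat \<Rightarrow> (nat \<Rightarrow> real^'n \<Rightarrow> real^'n) \<Rightarrow> real^'n \<Rightarrow> real \<Rightarrow> ('p::real_normed_vector \<Rightarrow> real^'n \<Rightarrow> real^'n) \<Rightarrow> bool"
  where "steerable m T p \<rho> F \<longleftrightarrow> (\<forall>r<\<rho>. \<forall>\<eta>>0. \<exists>\<delta> W. steers m T p r \<eta> F \<delta> W)"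

lemma steerableD:
  assumes "steerable m T p \<rho> F" "r < \<rho>" "0 < \<eta>"
  obtains \<delta> W where "0 < \<delta>" "\<And>a. a \<in> set W \<Longrightarrow> fst a \<in> {1..m} \<and> continuous_on UNIV (snd a)"
    "\<And>v. norm v \<le> \<delta> \<Longrightarrow> wlen (at_param W v) \<le> \<eta>"
    "\<And>v x. norm v \<le> \<delta> \<Longrightarrow> x \<in> cball p r \<Longrightarrow> norm (run T (at_param W v) x - x - F v x) \<le> \<eta> * norm v"
proof -
  from assms have "\<exists>\<delta> W. steers m T p r \<eta> F \<delta> W"
    unfolding steerable_def by blast
  then show thesis unfolding steers_def by (elim exE conjE) (rule that, assumption, blast+)
qed

lemma steerableI:
  assumes "\<And>r \<eta>. r < \<rho> \<Longrightarrow> 0 < \<eta> \<Longrightarrow> \<exists>\<delta> W. steers m T p r \<eta> F \<delta> W"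
  shows "steerable m T p \<rho> F"
  using assms unfolding steerable_def by blast

lemma steerable_cong:
  assumes "\<And>v x. x \<in> cball p \<rho> \<Longrightarrow> F v x = G v x" "steerable m T p \<rho> F"
  shows "steerable m T p \<rho> G"
proof (rule steerableI)
  fix r \<eta> :: real assume r: "r < \<rho>" "0 < \<eta>"
  then obtain \<delta> W where "steers m T p r \<eta> F \<delta> W" using assms(2) unfolding steerable_def by blast
  moreover have "F v x = G v x" if "x \<in> cball p r" for v x using assms(1) that r by simp
  ultimately have "steers m T p r \<eta> G \<delta> W" unfolding steers_def by simp
  then show "\<exists>\<delta> W. steers m T p r \<eta> G \<delta> W" by blast
qed

lemma steerable_zero: "steerable m T p \<rho> (\<lambda>_ _. 0)"
  by (rule steerableI, rule exI[of _ 1], rule exI[of _ "[]"]) (simp add: steers_def)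

lemma steerable_reparam:
  fixes l :: "'q::real_normed_vector \<Rightarrow> 'p::real_normed_vector"
  assumes F: "steerable m T p \<rho> F" and l: "bounded_linear l"
  shows "steerable m T p \<rho> (\<lambda>v. F (l v))"
proof (rule steerableI)
  fix r \<eta> :: real assume r: "r < \<rho>" and \<eta>: "0 < \<eta>"
  obtain c where c: "c > 0" "\<And>v. norm (l v) \<le> norm v * c"
    using bounded_linear.pos_bounded[OF l] by blast
  define \<eta>1 where "\<eta>1 = min \<eta> (\<eta> / c)"
  have \<eta>1: "0 < \<eta>1" "\<eta>1 \<le> \<eta>" "\<eta>1 * c \<le> \<eta>" using \<eta> c by (auto simp: \<eta>1_def min_def field_simps)
  obtain \<delta> W where W: "0 < \<delta>" "\<And>a. a \<in> set W \<Longrightarrow> fst a \<in> {1..m} \<and> continuous_on UNIV (snd a)"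
    "\<And>v. norm v \<le> \<delta> \<Longrightarrow> wlen (at_param W v) \<le> \<eta>1"
    "\<And>v x. norm v \<le> \<delta> \<Longrightarrow> x \<in> cball p r \<Longrightarrow> norm (run T (at_param W v) x - x - F v x) \<le> \<eta>1 * norm v"
    using steerableD[OF F r \<eta>1(1)] by metis
  define W' where "W' = map (\<lambda>a. (fst a, \<lambda>v. snd a (l v))) W"
  have W': "at_param W' v = at_param W (l v)" for v by (simp add: W'_def at_param_def)
  show "\<exists>\<delta> W. steers m T p r \<eta> (\<lambda>v. F (l v)) \<delta> W"
    unfolding steers_def
  proof (intro exI[of _ "\<delta> / c"] exI[of _ W'] conjI allI impI ballI)
    show "0 < \<delta> / c" using W(1) c by simp
    fix a assume "a \<in> set W'"
    then obtain b where b: "b \<in> set W" "a = (fst b, \<lambda>v. snd b (l v))" by (auto simp: W'_def)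
    show "fst a \<in> {1..m}" using W(2)[OF b(1)] b(2) by simp
    show "continuous_on UNIV (snd a)"
      using continuous_on_compose2[of UNIV "snd b" UNIV l] W(2)[OF b(1)] linear_continuous_on[OF l] b(2) by simp
  next
    fix v :: 'q assume v: "norm v \<le> \<delta> / c"
    have lv: "norm (l v) \<le> \<delta>" using c(2)[of v] v c(1) by (simp add: field_simps)
    show "wlen (at_param W' v) \<le> \<eta>" using W(3)[OF lv] \<eta>1 by (simp add: W')
    fix x assume x: "x \<in> cball p r"
    have "norm (run T (at_param W' v) x - x - F (l v) x) \<le> \<eta>1 * norm (l v)" using W(4)[OF lv x] by (simp add: W')
    also have "\<dots> \<le> \<eta>1 * (norm v * c)" using c(2) \<eta>1 by (intro mult_left_mono) auto
    also have "\<dots> = (\<eta>1 * c) * norm v" by simp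
    also have "\<dots> \<le> \<eta> * norm v" using \<eta>1 by (intro mult_right_mono) auto
    finally show "norm (run T (at_param W' v) x - x - F (l v) x) \<le> \<eta> * norm v" .
  qed
qed

text \<open>
  The second motion starts at the endpoint of the first one, which is displaced by \<open>O(norm v)\<close>. By
  the Lipschitz bound on \<open>G\<close> this changes \<open>G v\<close> only by \<open>O((norm v)\<^sup>2)\<close>.
\<close>

lemma steerable_add:
  fixes F G :: "'p::real_normed_vector \<Rightarrow> real^'n \<Rightarrow> real^'n"
  assumes F: "steerable m T p \<rho> F" and G: "steerable m T p \<rho> G"
    and FB: "\<And>v x. x \<in> cball p \<rho> \<Longrightarrow> norm (F v x) \<le> B * norm v"
    and GB: "\<And>v x y. x \<in> cball p \<rho> \<Longrightarrow> y \<in> cball p \<rho> \<Longrightarrow> norm (G v x - G v y) \<le> B * norm v * norm (x - y)"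
    and B: "1 \<le> B"
  shows "steerable m T p \<rho> (\<lambda>v x. F v x + G v x)"
proof (rule steerableI)
  fix r \<eta> :: real assume r: "r < \<rho>" and \<eta>: "0 < \<eta>"
  define \<eta>1 where "\<eta>1 = \<eta> / 4"
  have \<eta>1: "0 < \<eta>1" using \<eta> by (simp add: \<eta>1_def)
  \<comment> \<open>The second motion needs room for the displacement caused by the first one.\<close>
  define r1 where "r1 = (r + \<rho>) / 2"
  have r1: "r < r1" "r1 < \<rho>" using r by (auto simp: r1_def)
  obtain \<delta>1 W where W: "0 < \<delta>1" "\<And>a. a \<in> set W \<Longrightarrow> fst a \<in> {1..m} \<and> continuous_on UNIV (snd a)"
    "\<And>v. norm v \<le> \<delta>1 \<Longrightarrow> wlen (at_param W v) \<le> \<eta>1"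
    "\<And>v x. norm v \<le> \<delta>1 \<Longrightarrow> x \<in> cball p r \<Longrightarrow> norm (run T (at_param W v) x - x - F v x) \<le> \<eta>1 * norm v"
    using steerableD[OF F r \<eta>1] by metis
  obtain \<delta>2 U where U: "0 < \<delta>2" "\<And>a. a \<in> set U \<Longrightarrow> fst a \<in> {1..m} \<and> continuous_on UNIV (snd a)"
    "\<And>v. norm v \<le> \<delta>2 \<Longrightarrow> wlen (at_param U v) \<le> \<eta>1"
    "\<And>v x. norm v \<le> \<delta>2 \<Longrightarrow> x \<in> cball p r1 \<Longrightarrow> norm (run T (at_param U v) x - x - G v x) \<le> \<eta>1 * norm v"
    using steerableD[OF G r1(2) \<eta>1] by metis
  define Q where "Q = B * (B + \<eta>1)"
  have Q: "0 < Q" "B + \<eta>1 \<le> Q" using B \<eta>1 mult_right_mono[of 1 B "B + \<eta>1"] by (auto simp: Q_def)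
  define \<delta> where "\<delta> = min (min \<delta>1 \<delta>2) (min ((r1 - r) / Q) (\<eta> / (2 * Q)))"
  have \<delta>: "0 < \<delta>" using W(1) U(1) r1 Q \<eta> by (simp add: \<delta>_def)
  show "\<exists>\<delta> W. steers m T p r \<eta> (\<lambda>v x. F v x + G v x) \<delta> W"
    unfolding steers_def
  proof (intro exI[of _ \<delta>] exI[of _ "W @ U"] conjI allI impI \<delta>)
    show "\<forall>a\<in>set (W @ U). fst a \<in> {1..m} \<and> continuous_on UNIV (snd a)" using W(2) U(2) by auto
    fix v :: 'p assume v: "norm v \<le> \<delta>"
    have v1: "norm v \<le> \<delta>1" "norm v \<le> \<delta>2" "norm v * Q \<le> r1 - r" "norm v * Q \<le> \<eta> / 2"
      using v Q by (auto simp: \<delta>_def field_simps)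
    show "wlen (at_param (W @ U) v) \<le> \<eta>" using W(3)[OF v1(1)] U(3)[OF v1(2)] \<eta> by (simp add: \<eta>1_def)
    show "\<forall>x\<in>cball p r. norm (run T (at_param (W @ U) v) x - x - (F v x + G v x)) \<le> \<eta> * norm v"
    proof
      fix x assume x: "x \<in> cball p r"
      then have xK: "x \<in> cball p \<rho>" using r by simp
      define y where "y = run T (at_param W v) x"
      define z where "z = run T (at_param U v) y"
      have y1: "norm (y - x - F v x) \<le> \<eta>1 * norm v" using W(4)[OF v1(1) x] by (simp add: y_def)
      have "norm (y - x) \<le> norm (y - x - F v x) + norm (F v x)"
        using norm_triangle_ineq[of "y - x - F v x" "F v x"] by simp
      also have "\<dots> \<le> \<eta>1 * norm v + B * norm v" by (intro add_mono y1 FB xK)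
      finally have yx: "norm (y - x) \<le> (B + \<eta>1) * norm v" by (simp add: algebra_simps)
      also have "\<dots> \<le> r1 - r" using v1(3) mult_right_mono[OF Q(2), of "norm v"] by (simp add: mult.commute)
      finally have "norm (y - x) \<le> r1 - r" .
      then have y: "y \<in> cball p r1" using x norm_triangle_ineq[of "y - x" "x - p"]
        by (simp add: dist_norm norm_minus_commute)
      then have yK: "y \<in> cball p \<rho>" using r1 by simp
      have z1: "norm (z - y - G v y) \<le> \<eta>1 * norm v" using U(4)[OF v1(2) y] by (simp add: z_def)
      have g: "norm (G v y - G v x) \<le> (\<eta> / 2) * norm v"
      proof -
        have "norm (G v y - G v x) \<le> B * norm v * norm (y - x)" by (rule GB[OF yK xK])
        also have "\<dots> \<le> B * norm v * ((B + \<eta>1) * norm v)" using yx B by (intro mult_left_mono) auto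
        also have "\<dots> = (norm v * Q) * norm v" by (simp add: Q_def)
        also have "\<dots> \<le> (\<eta> / 2) * norm v" using v1(4) by (intro mult_right_mono) auto
        finally show ?thesis .
      qed
      have "z - x - (F v x + G v x) = (z - y - G v y) + (y - x - F v x) + (G v y - G v x)" by simp
      also have "norm \<dots> \<le> \<eta>1 * norm v + \<eta>1 * norm v + (\<eta> / 2) * norm v"
        by (rule norm_triangle_le[OF add_mono[OF norm_triangle_le[OF add_mono[OF z1 y1]] g]])
      also have "\<dots> = \<eta> * norm v" by (simp add: \<eta>1_def)
      finally show "norm (run T (at_param (W @ U) v) x - x - (F v x + G v x)) \<le> \<eta> * norm v"
        by (simp add: run_append z_def y_def)
    qed
  qed
qed

lemma steerable_field:
  assumes X: "c11 B (cball p \<rho>) (X i)" and \<rho>: "0 \<le> \<rho>" and i: "i \<in> {1..m}"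
  shows "steerable m (\<lambda>i. trunc (cball p \<rho>) (X i)) p \<rho> (\<lambda>t x. t *\<^sub>R X i x)"
proof (rule steerableI)
  fix r \<eta> :: real assume r: "r < \<rho>" and \<eta>: "0 < \<eta>"
  note l = c11_trunc[OF X \<rho>]
  have B: "1 \<le> B" by (rule c11D(1)[OF X])
  show "\<exists>\<delta> W. steers m (\<lambda>i. trunc (cball p \<rho>) (X i)) p r \<eta> (\<lambda>v x. v *\<^sub>R X i x) \<delta> W"
    unfolding steers_def
  proof (intro exI[of _ "\<eta> / (B * B)"] exI[of _ "[(i, \<lambda>t. t)]"] conjI allI impI ballI)
    show "0 < \<eta> / (B * B)" using \<eta> B by simp
    fix t :: real assume t: "norm t \<le> \<eta> / (B * B)"
    have t': "B * B * \<bar>t\<bar> \<le> \<eta>" using t B by (simp add: field_simps)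
    have "1 * 1 \<le> B * B" using B by (intro mult_mono) auto
    then have "1 * \<bar>t\<bar> \<le> B * B * \<bar>t\<bar>" by (intro mult_right_mono) auto
    then show "wlen (at_param [(i, \<lambda>t. t)] t) \<le> \<eta>" using t' by simp
    fix x assume x: "x \<in> cball p r"
    then have "trunc (cball p \<rho>) (X i) x = X i x" using r by (intro trunc_eq) simp
    then have "norm (flow (trunc (cball p \<rho>) (X i)) t x - x - t *\<^sub>R X i x) \<le> B * B * t\<^sup>2"
      using flow_first_order[OF l, of t x] by simp
    also have "\<dots> = (B * B * \<bar>t\<bar>) * \<bar>t\<bar>" by (simp add: power2_eq_square)
    also have "\<dots> \<le> \<eta> * \<bar>t\<bar>" using t' by (intro mult_right_mono) auto
    finally show "norm (run (\<lambda>i. trunc (cball p \<rho>) (X i)) (at_param [(i, \<lambda>t. t)] t) x - x - t *\<^sub>R X i x) \<le> \<eta> * norm t"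
      by simp
  qed (use i in auto)
qed

text \<open>
  The word is the one of \<open>commutator_estimate\<close> with \<open>\<sigma> = t / s\<close>. The time \<open>s\<close> spent on \<open>X i\<close> is fixed in
  terms of \<open>\<eta>\<close> and does not tend to \<open>0\<close> with \<open>t\<close>: the flow and the backward flow cancel exactly, and the
  cost has to be small, not of the order of \<open>t\<close>.
\<close>

lemma steerable_bracket:
  assumes X: "c11 B (cball p \<rho>) (X i)" and V: "c11 B (cball p \<rho>) V" and \<rho>: "0 \<le> \<rho>" and i: "i \<in> {1..m}"
    and st: "steerable m (\<lambda>i. trunc (cball p \<rho>) (X i)) p \<rho> (\<lambda>t x. t *\<^sub>R V x)"
  shows "steerable m (\<lambda>i. trunc (cball p \<rho>) (X i)) p \<rho> (\<lambda>t x. t *\<^sub>R lie_bracket (X i) V x)"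
proof (rule steerableI)
  let ?T = "\<lambda>i. trunc (cball p \<rho>) (X i)"
  fix r \<eta> :: real assume r: "r < \<rho>" and \<eta>: "0 < \<eta>"
  have B: "1 \<le> B" by (rule c11D(1)[OF X])
  then have B3: "0 < B ^ 3" by simp
  define d where "d = \<rho> - r"
  have d: "0 < d" using r by (simp add: d_def)
  define r1 where "r1 = r + d / 4"
  have r1: "r1 < \<rho>" using r by (simp add: r1_def d_def field_simps)
  \<comment> \<open>The third entry makes \<open>16 * B ^ 3 * s\<^sup>2\<close> a quarter of \<open>\<eta> * s\<close>; \<open>\<eta>1\<close> and \<open>\<sigma>0\<close> do the same for the other errors.\<close>
  define s where "s = min (min (1 / B) (d / (4 * B))) (min (\<eta> / (64 * B ^ 3)) (\<eta> / 4))"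
  have s: "0 < s" "B * s \<le> 1" "B * s \<le> d / 4" "16 * B ^ 3 * s \<le> \<eta> / 4" "s \<le> \<eta> / 4"
  proof -
    show "0 < s" using B d \<eta> B3 by (simp add: s_def)
    have "s \<le> 1 / B" "s \<le> d / (4 * B)" "s \<le> \<eta> / (64 * B ^ 3)" by (auto simp: s_def)
    then show "B * s \<le> 1" "B * s \<le> d / 4" "16 * B ^ 3 * s \<le> \<eta> / 4"
      using B B3 by (auto simp: field_simps)
  qed (simp add: s_def)
  define \<eta>1 where "\<eta>1 = min (min 1 (\<eta> / 4)) (\<eta> * s / (12 * B))"
  have \<eta>1: "0 < \<eta>1" "\<eta>1 \<le> 1" "\<eta>1 \<le> \<eta> / 4" "(2 + B) * \<eta>1 \<le> \<eta> * s / 4"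
  proof -
    show "0 < \<eta>1" "\<eta>1 \<le> 1" "\<eta>1 \<le> \<eta> / 4" using \<eta> s B by (auto simp: \<eta>1_def)
    have "\<eta>1 \<le> \<eta> * s / (12 * B)" by (simp add: \<eta>1_def)
    then have "3 * B * \<eta>1 \<le> \<eta> * s / 4" using B by (simp add: field_simps)
    moreover have "(2 + B) * \<eta>1 \<le> 3 * B * \<eta>1" using B \<open>0 < \<eta>1\<close> by (intro mult_right_mono) auto
    ultimately show "(2 + B) * \<eta>1 \<le> \<eta> * s / 4" by linarith
  qed
  obtain \<delta>1 W where W: "0 < \<delta>1" "\<And>a. a \<in> set W \<Longrightarrow> fst a \<in> {1..m} \<and> continuous_on UNIV (snd a)"
    "\<And>v. norm v \<le> \<delta>1 \<Longrightarrow> wlen (at_param W v) \<le> \<eta>1"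
    "\<And>v x. norm v \<le> \<delta>1 \<Longrightarrow> x \<in> cball p r1 \<Longrightarrow> norm (run ?T (at_param W v) x - x - v *\<^sub>R V x) \<le> \<eta>1 * norm v"
    using steerableD[OF st r1 \<eta>1(1)] by metis
  define \<sigma>0 where "\<sigma>0 = min \<delta>1 (min (d / (32 * B)) (\<eta> * s / (176 * B ^ 3)))"
  have \<sigma>0: "0 < \<sigma>0" "\<sigma>0 \<le> \<delta>1" using W(1) d B \<eta> s B3 by (auto simp: \<sigma>0_def)
  define scaled where "scaled c = map (\<lambda>a. (fst a, \<lambda>t::real. snd a (c * t))) W" for c :: real
  have scaled: "at_param (scaled c) t = at_param W (c * t)" for c t by (simp add: scaled_def at_param_def)
  define U where "U = [(i, \<lambda>t::real. s)] @ scaled (1 / s) @ [(i, \<lambda>t. - s)] @ scaled (- 1 / s)"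
  show "\<exists>\<delta> W. steers m ?T p r \<eta> (\<lambda>v x. v *\<^sub>R lie_bracket (X i) V x) \<delta> W"
    unfolding steers_def
  proof (intro exI[of _ "s * \<sigma>0"] exI[of _ U] conjI allI impI ballI)
    show "0 < s * \<sigma>0" using s \<sigma>0 by simp
    fix a assume a: "a \<in> set U"
    have sc: "fst a \<in> {1..m} \<and> continuous_on UNIV (snd a)" if ac: "a \<in> set (scaled c)" for c
    proof -
      obtain b where b: "b \<in> set W" "a = (fst b, \<lambda>t::real. snd b (c * t))" using ac by (auto simp: scaled_def)
      have "continuous_on UNIV (\<lambda>t::real. snd b (c * t))"
        by (rule continuous_on_compose2[of UNIV "snd b"]) (use W(2)[OF b(1)] in \<open>auto intro!: continuous_intros\<close>)
      then show ?thesis using W(2)[OF b(1)] b(2) by simp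
    qed
    show "fst a \<in> {1..m}" "continuous_on UNIV (snd a)"
      using a sc[of "1/s"] sc[of "-1/s"] i by (auto simp: U_def)
  next
    fix t :: real assume t: "norm t \<le> s * \<sigma>0"
    define \<sigma> where "\<sigma> = t / s"
    have \<sigma>: "\<bar>\<sigma>\<bar> \<le> \<sigma>0" "t = s * \<sigma>" using t s by (auto simp: \<sigma>_def field_simps)
    have apU: "at_param U t = [(i, s)] @ at_param W \<sigma> @ [(i, - s)] @ at_param W (- \<sigma>)"
      by (simp add: U_def scaled \<sigma>_def)
    have \<sigma>\<delta>: "norm \<sigma> \<le> \<delta>1" "norm (- \<sigma>) \<le> \<delta>1" using \<sigma> \<sigma>0 by auto
    show "wlen (at_param U t) \<le> \<eta>"
      using W(3)[OF \<sigma>\<delta>(1)] W(3)[OF \<sigma>\<delta>(2)] s \<eta>1 by (simp add: apU)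
    fix x assume x: "x \<in> cball p r"
    have \<sigma>b: "8 * B * \<bar>\<sigma>\<bar> \<le> d / 4" "44 * B ^ 3 * \<bar>\<sigma>\<bar> \<le> \<eta> * s / 4"
    proof -
      have "\<bar>\<sigma>\<bar> \<le> d / (32 * B)" "\<bar>\<sigma>\<bar> \<le> \<eta> * s / (176 * B ^ 3)" using \<sigma> by (auto simp: \<sigma>0_def)
      then show "8 * B * \<bar>\<sigma>\<bar> \<le> d / 4" "44 * B ^ 3 * \<bar>\<sigma>\<bar> \<le> \<eta> * s / 4"
        using B B3 by (auto simp: field_simps)
    qed
    have "norm (run ?T (at_param W (- \<sigma>)) (flow (?T i) (- s) (run ?T (at_param W \<sigma>) (flow (?T i) s x))) - x
        - (s * \<sigma>) *\<^sub>R lie_bracket (X i) V x)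
      \<le> \<bar>\<sigma>\<bar> * ((2 + B) * \<eta>1 + 44 * B ^ 3 * \<bar>\<sigma>\<bar> + 16 * B ^ 3 * s\<^sup>2)"
    proof (rule commutator_estimate[OF X V \<rho>, where \<Phi> = "\<lambda>\<tau>. run ?T (at_param W \<tau>)" and r' = r1 and r = r])
      show "norm (run ?T (at_param W \<tau>) x - x - \<tau> *\<^sub>R V x) \<le> \<eta>1 * \<bar>\<tau>\<bar>"
        if "x \<in> cball p r1" "\<bar>\<tau>\<bar> = \<bar>\<sigma>\<bar>" for x \<tau>
        using W(4)[of \<tau> x] that \<sigma>\<delta> by simp
      show "norm (x - p) \<le> r" using x by (simp add: dist_norm norm_minus_commute)
      show "r1 + 2 * B * \<bar>\<sigma>\<bar> + B * s \<le> \<rho>" using s \<sigma>b d unfolding r1_def d_def by (simp add: field_simps)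
    qed (use \<eta>1 s \<sigma>b in \<open>auto simp: r1_def\<close>)
    also have "\<dots> \<le> \<bar>\<sigma>\<bar> * (\<eta> * s / 4 + \<eta> * s / 4 + \<eta> * s / 4)"
    proof (intro mult_left_mono add_mono \<eta>1 \<sigma>b)
      have "16 * B ^ 3 * s\<^sup>2 = (16 * B ^ 3 * s) * s" by (simp add: power2_eq_square)
      also have "\<dots> \<le> (\<eta> / 4) * s" using s by (intro mult_right_mono) auto
      finally show "16 * B ^ 3 * s\<^sup>2 \<le> \<eta> * s / 4" by simp
    qed simp
    also have "\<dots> \<le> \<bar>\<sigma>\<bar> * (\<eta> * s)" using \<eta> s by (intro mult_left_mono) auto
    also have "\<dots> = \<eta> * norm t" using \<sigma>(2) s by (simp add: abs_mult)
    finally show "norm (run ?T (at_param U t) x - x - t *\<^sub>R lie_bracket (X i) V x) \<le> \<eta> * norm t"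
      unfolding \<sigma>(2)[symmetric] by (simp add: apU run_append)
  qed
qed


section \<open>A stable form of Chow's theorem\<close>

lemma steerable_scaleR:
  assumes "steerable m T p \<rho> (\<lambda>t x. t *\<^sub>R V x)"
  shows "steerable m T p \<rho> (\<lambda>t x. t *\<^sub>R (c *\<^sub>R V x))"
  using steerable_reparam[OF assms bounded_linear_mult_left[of c]] by simp

lemma steerable_add_fields:
  assumes V: "steerable m T p \<rho> (\<lambda>t x. t *\<^sub>R V x)" "c11 B (cball p \<rho>) V"
    and W: "steerable m T p \<rho> (\<lambda>t x. t *\<^sub>R W x)" "c11 B (cball p \<rho>) W"
  shows "steerable m T p \<rho> (\<lambda>t x. t *\<^sub>R (V x + W x))"
proof -
  have "steerable m T p \<rho> (\<lambda>t x. t *\<^sub>R V x + t *\<^sub>R W x)"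
  proof (rule steerable_add[OF V(1) W(1), of B])
    show "norm (v *\<^sub>R V x) \<le> B * norm v" if "x \<in> cball p \<rho>" for v x
      using c11D(2)[OF V(2) that] by (simp add: mult_left_mono mult.commute[of B])
    show "norm (v *\<^sub>R W x - v *\<^sub>R W y) \<le> B * norm v * norm (x - y)" if "x \<in> cball p \<rho>" "y \<in> cball p \<rho>" for v x y
      using mult_left_mono[OF c11D(5)[OF W(2) that], of "\<bar>v\<bar>"]
      by (simp flip: scaleR_diff_right add: mult_ac)
  qed (rule c11D(1)[OF V(2)])
  then show ?thesis by (simp add: scaleR_add_right)
qed

definition steerable_fields ::
  "nat \<Rightarrow> (real^'n) set \<Rightarrow> (nat \<Rightarrow> real^'n \<Rightarrow> real^'n) \<Rightarrow> real^'n \<Rightarrow> real \<Rightarrow> (real^'n \<Rightarrow> real^'n) set"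
  where "steerable_fields m \<Omega> X p \<rho> = {V. csmooth \<Omega> V \<and>
    steerable m (\<lambda>i. trunc (cball p \<rho>) (X i)) p \<rho> (\<lambda>t x. t *\<^sub>R V x)}"

context
  fixes m :: nat and \<Omega> :: "(real^'n) set" and X :: "nat \<Rightarrow> real^'n \<Rightarrow> real^'n" and p :: "real^'n" and \<rho> :: real
  assumes \<Omega>: "open \<Omega>" and X: "\<And>i. i \<in> {1..m} \<Longrightarrow> csmooth \<Omega> (X i)"
    and \<rho>: "0 < \<rho>" and K: "cball p \<rho> \<subseteq> \<Omega>"
begin

lemma common_c11:
  assumes "csmooth \<Omega> V" "csmooth \<Omega> W"
  obtains B where "c11 B (cball p \<rho>) V" "c11 B (cball p \<rho>) W"
proof -
  obtain B1 B2 where B: "c11 B1 (cball p \<rho>) V" "c11 B2 (cball p \<rho>) W"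
    using csmooth_imp_c11[OF assms(1) K] csmooth_imp_c11[OF assms(2) K] by blast
  show thesis
    by (rule that[of "max B1 B2"]) (use B in \<open>auto intro: c11_mono\<close>)
qed

lemma steerable_fields_add:
  assumes "V \<in> steerable_fields m \<Omega> X p \<rho>" "W \<in> steerable_fields m \<Omega> X p \<rho>"
  shows "(\<lambda>x. V x + W x) \<in> steerable_fields m \<Omega> X p \<rho>"
proof -
  have VW: "csmooth \<Omega> V" "csmooth \<Omega> W" using assms by (auto simp: steerable_fields_def)
  obtain B where "c11 B (cball p \<rho>) V" "c11 B (cball p \<rho>) W" using common_c11[OF VW] by blast
  then show ?thesis
    using assms by (auto simp: steerable_fields_def intro: csmooth_add[OF \<Omega>] steerable_add_fields)
qed

lemma steerable_fields_scaleR: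
  "V \<in> steerable_fields m \<Omega> X p \<rho> \<Longrightarrow> (\<lambda>x. c *\<^sub>R V x) \<in> steerable_fields m \<Omega> X p \<rho>"
  by (auto simp: steerable_fields_def intro: csmooth_scale[OF \<Omega>] steerable_scaleR simp del: scaleR_scaleR)

lemma steerable_fields_cong:
  assumes "V \<in> steerable_fields m \<Omega> X p \<rho>" "\<And>x. x \<in> \<Omega> \<Longrightarrow> V x = W x"
  shows "W \<in> steerable_fields m \<Omega> X p \<rho>"
proof -
  have "csmooth \<Omega> W" using csmooth_cong[OF \<Omega> assms(2)] assms(1) by (auto simp: steerable_fields_def)
  moreover have "steerable m (\<lambda>i. trunc (cball p \<rho>) (X i)) p \<rho> (\<lambda>t x. t *\<^sub>R W x)"
    by (rule steerable_cong[where F = "\<lambda>t x. t *\<^sub>R V x"]) (use assms K in \<open>auto simp: steerable_fields_def\<close>)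
  ultimately show ?thesis by (simp add: steerable_fields_def)
qed

lemma frame_in_steerable_fields:
  assumes "i \<in> {1..m}" shows "X i \<in> steerable_fields m \<Omega> X p \<rho>"
  using csmooth_imp_c11[OF X[OF assms] K] steerable_field[of _ p \<rho> X i m] assms X \<rho>
  by (auto simp: steerable_fields_def)

lemma bracket_in_steerable_fields:
  assumes i: "i \<in> {1..m}" and V: "V \<in> steerable_fields m \<Omega> X p \<rho>"
  shows "lie_bracket (X i) V \<in> steerable_fields m \<Omega> X p \<rho>"
proof -
  have sV: "csmooth \<Omega> V" using V by (simp add: steerable_fields_def)
  obtain B where "c11 B (cball p \<rho>) (X i)" "c11 B (cball p \<rho>) V" using common_c11[OF X[OF i] sV] by blast
  then show ?thesis
    using V i \<rho> csmooth_lie_bracket[OF \<Omega> X[OF i] sV]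
    by (auto simp: steerable_fields_def intro!: steerable_bracket)
qed

text \<open>
  The bracket of a frame field with a steerable field is steerable. To pass to arbitrary brackets,
  the induction carries along that \<open>A\<close> maps steerable fields to steerable fields under the bracket; by the
  Jacobi identity this property is inherited by \<open>[Y, Z]\<close> from \<open>Y\<close> and \<open>Z\<close>.
\<close>

lemma iterated_brackets_steerable:
  assumes "A \<in> iterated_brackets m X k"
  shows "A \<in> steerable_fields m \<Omega> X p \<rho> \<and>
    (\<forall>V\<in>steerable_fields m \<Omega> X p \<rho>. lie_bracket A V \<in> steerable_fields m \<Omega> X p \<rho>)"
  using assms
proof (induction k arbitrary: A)
  case 0
  then show ?case using frame_in_steerable_fields bracket_in_steerable_fields by auto
next
  case (Suc k)
  let ?S = "steerable_fields m \<Omega> X p \<rho>"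
  consider "A \<in> iterated_brackets m X k"
    | Y Z where "Y \<in> iterated_brackets m X k" "Z \<in> iterated_brackets m X k" "A = lie_bracket Y Z"
    using Suc.prems by auto
  then show ?case
  proof cases
    case 1 then show ?thesis by (rule Suc.IH)
  next
    case 2
    note Y = Suc.IH[OF 2(1)] and Z = Suc.IH[OF 2(2)]
    have sm: "csmooth \<Omega> Y" "csmooth \<Omega> Z" using Y Z by (auto simp: steerable_fields_def)
    have "lie_bracket A V \<in> ?S" if V: "V \<in> ?S" for V
    proof -
      have sV: "csmooth \<Omega> V" using V by (simp add: steerable_fields_def)
      have a: "lie_bracket Y (lie_bracket Z V) \<in> ?S" and b: "lie_bracket Z (lie_bracket Y V) \<in> ?S"
        using Y Z V by auto
      have "(\<lambda>x. lie_bracket Y (lie_bracket Z V) x + (-1) *\<^sub>R lie_bracket Z (lie_bracket Y V) x) \<in> ?S"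
        by (intro steerable_fields_add steerable_fields_scaleR a b)
      then show ?thesis
        by (rule steerable_fields_cong) (simp add: 2(3) lie_bracket_jacobi[OF \<Omega> sm sV])
    qed
    then show ?thesis using Y Z 2(3) by auto
  qed
qed

text \<open>
  The values at \<open>p\<close> of the steerable fields form a subspace, and this subspace contains a spanning set.
\<close>

lemma steerable_fields_all_directions:
  assumes "span ((\<lambda>Y. Y p) ` iterated_brackets m X k) = UNIV"
  shows "\<exists>V\<in>steerable_fields m \<Omega> X p \<rho>. V p = v"
proof -
  have "(\<lambda>x. 0) \<in> steerable_fields m \<Omega> X p \<rho>"
  proof -
    have "csmooth \<Omega> (\<lambda>x. 0 :: real^'n)" by (simp add: csmooth_def cdiff_const[OF \<Omega>])
    then show ?thesis using steerable_zero by (simp add: steerable_fields_def)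
  qed
  moreover have "subspace ((\<lambda>V. V p) ` steerable_fields m \<Omega> X p \<rho>)"
    unfolding subspace_def
  proof (intro conjI ballI allI)
    show "0 \<in> (\<lambda>V. V p) ` steerable_fields m \<Omega> X p \<rho>" using calculation by force
    fix a assume a: "a \<in> (\<lambda>V. V p) ` steerable_fields m \<Omega> X p \<rho>"
    then show "c *\<^sub>R a \<in> (\<lambda>V. V p) ` steerable_fields m \<Omega> X p \<rho>" for c
      using steerable_fields_scaleR by force
    show "a + b \<in> (\<lambda>V. V p) ` steerable_fields m \<Omega> X p \<rho>" if "b \<in> (\<lambda>V. V p) ` steerable_fields m \<Omega> X p \<rho>" for b
      using a that steerable_fields_add by force
  qed
  moreover have "(\<lambda>Y. Y p) ` iterated_brackets m X k \<subseteq> (\<lambda>V. V p) ` steerable_fields m \<Omega> X p \<rho>"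
    using iterated_brackets_steerable by auto
  ultimately have "span ((\<lambda>Y. Y p) ` iterated_brackets m X k) \<subseteq> (\<lambda>V. V p) ` steerable_fields m \<Omega> X p \<rho>"
    by (intro span_minimal)
  then have "v \<in> (\<lambda>V. V p) ` steerable_fields m \<Omega> X p \<rho>" using assms by blast
  then show ?thesis by auto
qed

text \<open>
  Steerable fields \<open>V j\<close> that take the values of the standard basis at \<open>p\<close> are combined to the family
  \<open>v \<mapsto> \<Sum>j. v $ j *\<^sub>R V j\<close>, whose value at \<open>p\<close> is \<open>v\<close>.
\<close>

lemma steerable_to_all_nearby:
  assumes sp: "span ((\<lambda>Y. Y p) ` iterated_brackets m X k) = UNIV" and \<epsilon>: "0 < \<epsilon>"
  obtains \<delta> and W :: "(nat \<times> (real^'n \<Rightarrow> real)) list" where "0 < \<delta>" 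
    "\<And>a. a \<in> set W \<Longrightarrow> fst a \<in> {1..m} \<and> continuous_on UNIV (snd a)"
    "\<And>v. norm v \<le> \<delta> \<Longrightarrow> wlen (at_param W v) \<le> \<epsilon>"
    "\<And>v. norm v \<le> \<delta> \<Longrightarrow> norm (run (\<lambda>i. trunc (cball p \<rho>) (X i)) (at_param W v) p - p - v) \<le> \<delta> / 4"
proof -
  let ?S = "steerable_fields m \<Omega> X p \<rho>"
  let ?T = "\<lambda>i. trunc (cball p \<rho>) (X i)"
  have "\<forall>j. \<exists>V\<in>?S. V p = axis j 1" using steerable_fields_all_directions[OF sp] by blast
  then obtain V where V: "\<And>j. V j \<in> ?S" "\<And>j. V j p = axis j 1" by metis
  have "\<exists>B\<ge>1. \<forall>j\<in>UNIV. c11 B (cball p \<rho>) (V j)"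
    by (rule finite_common_bound) (use csmooth_imp_c11[OF _ K] V c11_mono in \<open>auto simp: steerable_fields_def\<close>)
  then obtain B where B: "1 \<le> B" "\<And>j. c11 B (cball p \<rho>) (V j)" by auto
  have comp: "bounded_linear (\<lambda>v::real^'n. v $ j)" for j by (rule bounded_linear_vec_nth)
  have "steerable m ?T p \<rho> (\<lambda>v x. \<Sum>j\<in>J. v $ j *\<^sub>R V j x)" if "finite J" for J
    using that
  proof (induction J)
    case empty
    then show ?case using steerable_zero by simp
  next
    case (insert j J)
    define B' where "B' = (1 + real (card J)) * B"
    have B': "B \<le> B'" "real (card J) * B \<le> B'" "1 \<le> B'"
      using B(1) by (auto simp: B'_def algebra_simps add_increasing2)
    have vj: "\<bar>v $ i\<bar> \<le> norm v" for v :: "real^'n" and i by (rule component_le_norm_cart)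
    have "steerable m ?T p \<rho> (\<lambda>v x. v $ j *\<^sub>R V j x + (\<Sum>j\<in>J. v $ j *\<^sub>R V j x))"
    proof (rule steerable_add[OF _ insert.IH, of _ B'])
      show "steerable m ?T p \<rho> (\<lambda>v x. v $ j *\<^sub>R V j x)"
        using steerable_reparam[OF _ comp[of j], of m ?T p \<rho> "\<lambda>t x. t *\<^sub>R V j x"] V(1)[of j]
        by (simp add: steerable_fields_def)
      show "norm (v $ j *\<^sub>R V j x) \<le> B' * norm v" if "x \<in> cball p \<rho>" for v :: "real^'n" and x
      proof -
        have "\<bar>v $ j\<bar> * norm (V j x) \<le> norm v * B'"
          using c11D(2)[OF B(2)[of j] that] B' by (intro mult_mono vj) auto
        then show ?thesis by (simp add: mult.commute)
      qed
      show "norm ((\<Sum>j\<in>J. v $ j *\<^sub>R V j x) - (\<Sum>j\<in>J. v $ j *\<^sub>R V j y)) \<le> B' * norm v * norm (x - y)"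
        if xy: "x \<in> cball p \<rho>" "y \<in> cball p \<rho>" for v :: "real^'n" and x y
      proof -
        have "norm (\<Sum>j\<in>J. v $ j *\<^sub>R (V j x - V j y)) \<le> (\<Sum>j\<in>J. norm v * (B * norm (x - y)))"
        proof (rule sum_norm_le)
          fix i
          have "\<bar>v $ i\<bar> * norm (V i x - V i y) \<le> norm v * (B * norm (x - y))"
            by (intro mult_mono vj c11D(5)[OF B(2) xy]) auto
          then show "norm (v $ i *\<^sub>R (V i x - V i y)) \<le> norm v * (B * norm (x - y))" by simp
        qed
        also have "\<dots> = (real (card J) * B) * (norm v * norm (x - y))" by simp
        also have "\<dots> \<le> B' * (norm v * norm (x - y))" by (intro mult_right_mono B') auto
        finally show ?thesis by (simp add: sum_subtractf scaleR_diff_right mult.assoc)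
      qed
    qed (rule B'(3))
    then show ?case using insert.hyps by simp
  qed
  then have st: "steerable m ?T p \<rho> (\<lambda>v x. \<Sum>j\<in>UNIV. v $ j *\<^sub>R V j x)" by simp
  have m0: "0 < min \<epsilon> (1/4)" using \<epsilon> by simp
  obtain \<delta> W where W: "0 < \<delta>" "\<And>a. a \<in> set W \<Longrightarrow> fst a \<in> {1..m} \<and> continuous_on UNIV (snd a)"
    "\<And>v. norm v \<le> \<delta> \<Longrightarrow> wlen (at_param W v) \<le> min \<epsilon> (1/4)"
    "\<And>v x. norm v \<le> \<delta> \<Longrightarrow> x \<in> cball p 0 \<Longrightarrow> norm (run ?T (at_param W v) x - x - (\<Sum>j\<in>UNIV. v $ j *\<^sub>R V j x)) \<le> min \<epsilon> (1/4) * norm v"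
    by (rule steerableD[OF st \<rho> m0]) blast
  show thesis
  proof (rule that[OF W(1) W(2)])
    fix v :: "real^'n" assume v: "norm v \<le> \<delta>"
    show "wlen (at_param W v) \<le> \<epsilon>" using W(3)[OF v] by simp
    have "(\<Sum>j\<in>UNIV. v $ j *\<^sub>R V j p) = v"
      using basis_expansion[of v] by (simp add: V(2) scalar_mult_eq_scaleR)
    then have "norm (run ?T (at_param W v) p - p - v) \<le> min \<epsilon> (1/4) * norm v"
      using W(4)[OF v, of p] by simp
    also have "\<dots> \<le> (1/4) * \<delta>" using v by (intro mult_mono) auto
    finally show "norm (run ?T (at_param W v) p - p - v) \<le> \<delta> / 4" by simp
  qed
qed

text \<open>
  For a target \<open>y\<close> near \<open>p\<close>, the map that sends \<open>v\<close> to \<open>v\<close> minus the deviation of the endpoint from \<open>y\<close>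
  takes the ball of radius \<open>\<delta>\<close> to itself, because the endpoint is \<open>p + v\<close> up to \<open>\<delta> / 2\<close>. Its fixed point
  given by Brouwer's theorem is a parameter with endpoint \<open>y\<close>. Perturbing
  the frame and the starting point moves the endpoint by at most \<open>\<delta> / 4\<close>, and the other \<open>\<delta> / 4\<close> is
  the error of steering in the unperturbed frame.
\<close>

theorem stable_local_controllability:
  assumes sp: "span ((\<lambda>Y. Y p) ` iterated_brackets m X k) = UNIV" and \<epsilon>: "0 < \<epsilon>"
  shows "\<exists>\<theta>>0. \<forall>Y.
    (\<forall>i\<in>{1..m}. \<exists>L. \<forall>x\<in>cball p \<rho>. \<forall>y\<in>cball p \<rho>. norm (Y i x - Y i y) \<le> L * norm (x - y)) \<longrightarrow>
    (\<forall>i\<in>{1..m}. \<forall>x\<in>cball p \<rho>. norm (Y i x - X i x) \<le> \<theta>) \<longrightarrow>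
    (\<forall>x\<in>ball p \<theta>. \<forall>y\<in>ball p \<theta>. reach m \<Omega> Y \<epsilon> x y)"
proof -
  let ?K = "cball p \<rho>"
  have ne: "?K \<noteq> {}" using \<rho> by auto
  have "\<exists>B\<ge>1. \<forall>i\<in>{1..m}. c11 B ?K (X i)"
    by (rule finite_common_bound) (use csmooth_imp_c11[OF X K] c11_mono in auto)
  then obtain B where B: "1 \<le> B" "\<And>i. i \<in> {1..m} \<Longrightarrow> c11 B ?K (X i)" by blast
  \<comment> \<open>The second bound keeps all the curves in the ball of radius \<open>\<rho>\<close>.\<close>
  define \<epsilon>' where "\<epsilon>' = min \<epsilon> (\<rho> / (2 * (B + 1)))"
  have \<epsilon>': "0 < \<epsilon>'" "\<epsilon>' \<le> \<epsilon>" "(B + 1) * \<epsilon>' \<le> \<rho> / 2"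
  proof -
    show "0 < \<epsilon>'" "\<epsilon>' \<le> \<epsilon>" using \<epsilon> \<rho> B by (auto simp: \<epsilon>'_def)
    have "\<epsilon>' \<le> \<rho> / (2 * (B + 1))" by (simp add: \<epsilon>'_def)
    then show "(B + 1) * \<epsilon>' \<le> \<rho> / 2" using B by (simp add: field_simps)
  qed
  obtain \<delta> W where W: "0 < \<delta>" "\<And>a. a \<in> set W \<Longrightarrow> fst a \<in> {1..m} \<and> continuous_on UNIV (snd a)"
    "\<And>v. norm v \<le> \<delta> \<Longrightarrow> wlen (at_param W v) \<le> \<epsilon>'"
    "\<And>v. norm v \<le> \<delta> \<Longrightarrow> norm (run (\<lambda>i. trunc ?K (X i)) (at_param W v) p - p - v) \<le> \<delta> / 4"
    using steerable_to_all_nearby[OF sp \<epsilon>'(1)] by metis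
  \<comment> \<open>The factor by which \<open>run_close\<close> enlarges an error of size \<open>\<theta>\<close>.\<close>
  define E where "E = (1 + \<epsilon>') * exp (B * \<epsilon>')"
  have E: "0 < E" using \<epsilon>' by (simp add: E_def)
  define \<theta> where "\<theta> = min (min 1 (\<rho> / 2)) (min (\<delta> / 2) (\<delta> / (4 * E)))"
  have \<theta>: "0 < \<theta>" "\<theta> \<le> 1" "\<theta> \<le> \<rho> / 2" "\<theta> \<le> \<delta> / 2" "\<theta> * E \<le> \<delta> / 4"
  proof -
    show "0 < \<theta>" "\<theta> \<le> 1" "\<theta> \<le> \<rho> / 2" "\<theta> \<le> \<delta> / 2" using \<rho> W(1) E by (auto simp: \<theta>_def)
    have "\<theta> \<le> \<delta> / (4 * E)" by (simp add: \<theta>_def)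
    then show "\<theta> * E \<le> \<delta> / 4" using E by (simp add: field_simps)
  qed
  show ?thesis
  proof (intro exI[of _ \<theta>] conjI \<theta>(1) allI impI ballI)
    fix Y :: "nat \<Rightarrow> real^'n \<Rightarrow> real^'n" and x y
    assume YL: "\<forall>i\<in>{1..m}. \<exists>L. \<forall>x\<in>?K. \<forall>y\<in>?K. norm (Y i x - Y i y) \<le> L * norm (x - y)"
      and YX': "\<forall>i\<in>{1..m}. \<forall>x\<in>?K. norm (Y i x - X i x) \<le> \<theta>"
      and xb: "x \<in> ball p \<theta>" and yb: "y \<in> ball p \<theta>"
    have YX: "norm (Y i x - X i x) \<le> \<theta>" if "i \<in> {1..m}" "x \<in> ?K" for i x using YX' that by blast
    have "\<exists>L\<ge>0. \<forall>i\<in>{1..m}. \<forall>x\<in>?K. \<forall>y\<in>?K. norm (Y i x - Y i y) \<le> L * norm (x - y)"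
    proof (rule finite_common_bound[where P = "\<lambda>L i. \<forall>x\<in>?K. \<forall>y\<in>?K. norm (Y i x - Y i y) \<le> L * norm (x - y)"])
      show "\<forall>x\<in>?K. \<forall>y\<in>?K. norm (Y i x - Y i y) \<le> L' * norm (x - y)"
        if "\<forall>x\<in>?K. \<forall>y\<in>?K. norm (Y i x - Y i y) \<le> L * norm (x - y)" "L \<le> L'" for L L' i
        using that by (meson mult_right_mono norm_ge_zero order_trans)
    qed (use YL in auto)
    then obtain L where L: "0 \<le> L" "\<And>i x y. i \<in> {1..m} \<Longrightarrow> x \<in> ?K \<Longrightarrow> y \<in> ?K \<Longrightarrow> norm (Y i x - Y i y) \<le> L * norm (x - y)"
      by blast
    let ?TX = "\<lambda>i. trunc ?K (X i)" and ?TY = "\<lambda>i. trunc ?K (Y i)"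
    have lX: "lip B (?TX i)" if "i \<in> {1..m}" for i using c11_trunc[OF B(2)[OF that]] \<rho> by simp
    have lY: "lip L (?TY i)" if "i \<in> {1..m}" for i
      by (rule trunc_lip[OF closed_cball convex_cball ne L(1)]) (use L(2) that in auto)
    have bY: "norm (?TY i z) \<le> B + 1" if "i \<in> {1..m}" for i z
    proof (rule trunc_all[OF closed_cball ne, of "\<lambda>v. norm v \<le> B + 1"])
      fix z assume z: "z \<in> ?K"
      show "norm (Y i z) \<le> B + 1"
        using norm_triangle_ineq[of "Y i z - X i z" "X i z"] YX[OF that z] \<theta> c11D(2)[OF B(2)[OF that] z] by simp
    qed
    have dXY: "norm (?TX i z - ?TY i z) \<le> \<theta>" if "i \<in> {1..m}" for i z
      by (rule trunc_diff_le[OF closed_cball ne]) (use YX[OF that] in \<open>simp add: norm_minus_commute\<close>)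
    have fsts: "fst a \<in> {1..m}" if "a \<in> set (at_param W v)" for a v
      using that W(2) by (auto simp: at_param_def)
    have close: "norm (run ?TY (at_param W v) x - p - v) \<le> \<delta> / 2" if v: "norm v \<le> \<delta>" for v
    proof -
      have "norm (run ?TX (at_param W v) p - run ?TY (at_param W v) x)
          \<le> (norm (p - x) + \<theta> * wlen (at_param W v)) * exp (B * wlen (at_param W v))"
        by (rule run_close[where L' = L]) (use fsts lX lY dXY \<theta> B in auto)
      also have "\<dots> \<le> (\<theta> + \<theta> * \<epsilon>') * exp (B * \<epsilon>')"
        using xb W(3)[OF v] \<theta> B \<epsilon>' wlen_nonneg by (intro mult_mono add_mono) (auto simp: dist_norm)
      also have "\<dots> = \<theta> * E" by (simp add: E_def algebra_simps)
      also have "\<dots> \<le> \<delta> / 4" by (rule \<theta>)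
      finally have "norm (run ?TY (at_param W v) x - run ?TX (at_param W v) p) \<le> \<delta> / 4"
        by (simp add: norm_minus_commute)
      then have "norm ((run ?TY (at_param W v) x - run ?TX (at_param W v) p) + (run ?TX (at_param W v) p - p - v)) \<le> \<delta> / 4 + \<delta> / 4"
        by (rule norm_triangle_le[OF add_mono[OF _ W(4)[OF v]]])
      moreover have "(run ?TY (at_param W v) x - run ?TX (at_param W v) p) + (run ?TX (at_param W v) p - p - v)
          = run ?TY (at_param W v) x - p - v" by simp
      ultimately show ?thesis by simp
    qed
    \<comment> \<open>A fixed point of \<open>H\<close> is a parameter whose endpoint is \<open>y\<close>.\<close>
    define H where "H v = v - (run ?TY (at_param W v) x - y)" for v
    have "continuous_on (cball 0 \<delta>) H"
      unfolding H_def
    proof (intro continuous_intros continuous_on_run[where L = L and M = "B + 1"])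
      fix a assume a: "a \<in> set W"
      then have "fst a \<in> {1..m}" "continuous_on (cball 0 \<delta>) (snd a)"
        using W(2) continuous_on_subset by blast+
      then show "lip L (?TY (fst a)) \<and> (\<forall>y. norm (?TY (fst a) y) \<le> B + 1) \<and> continuous_on (cball 0 \<delta>) (snd a)"
        using lY bY by blast
    qed
    moreover have "H \<in> cball 0 \<delta> \<rightarrow> cball 0 \<delta>"
    proof
      fix v :: "real^'n" assume "v \<in> cball 0 \<delta>"
      then have v: "norm v \<le> \<delta>" by simp
      have "H v = (y - p) - (run ?TY (at_param W v) x - p - v)" by (simp add: H_def)
      also have "norm \<dots> \<le> norm (y - p) + norm (run ?TY (at_param W v) x - p - v)" by (rule norm_triangle_ineq4)
      also have "\<dots> \<le> \<delta> / 2 + \<delta> / 2"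
        using yb \<theta> close[OF v] by (intro add_mono) (auto simp: dist_norm norm_minus_commute)
      finally show "H v \<in> cball 0 \<delta>" by simp
    qed
    ultimately obtain v where v: "v \<in> cball 0 \<delta>" "H v = v"
      using brouwer[of "cball 0 \<delta>" H] W(1) by auto
    then have end_y: "run ?TY (at_param W v) x = y" by (simp add: H_def)
    have vn: "norm v \<le> \<delta>" using v by simp
    have "reach m \<Omega> Y (wlen (at_param W v)) x (run ?TY (at_param W v) x)"
    proof (rule reach_run[OF K, where M = "B + 1" and L = L])
      show "0 \<le> B + 1" using B by simp
      show "fst a \<in> {1..m} \<and> lip L (?TY (fst a)) \<and> (\<forall>y. norm (?TY (fst a) y) \<le> B + 1)"
        if "a \<in> set (at_param W v)" for a
        using fsts[OF that] lY bY by blast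
      show "x \<in> ?K" using xb \<theta> \<rho> by (simp add: dist_norm)
      show "cball x ((B + 1) * wlen (at_param W v)) \<subseteq> ?K"
      proof
        fix z assume "z \<in> cball x ((B + 1) * wlen (at_param W v))"
        then have "norm (x - z) \<le> (B + 1) * wlen (at_param W v)" by (simp add: dist_norm)
        also have "\<dots> \<le> (B + 1) * \<epsilon>'" using W(3)[OF vn] B by (intro mult_left_mono) auto
        also have "\<dots> \<le> \<rho> / 2" by (rule \<epsilon>')
        finally have "norm (x - z) \<le> \<rho> / 2" .
        moreover have "norm (p - x) \<le> \<rho> / 2" using xb \<theta> by (simp add: dist_norm)
        ultimately show "z \<in> ?K" using norm_triangle_ineq[of "p - x" "x - z"] by (simp add: dist_norm)
      qed
    qed
    then show "reach m \<Omega> Y \<epsilon> x y"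
      unfolding end_y by (rule reach_mono) (use wlen_nonneg W(3)[OF vn] \<epsilon>' in auto)
  qed
qed

end

section \<open>Convergence of the distances\<close>

text \<open>
  The frame \<open>T\<close> is driven by the control of a curve of \<open>S\<close>. The condition on \<open>x\<close> keeps both curves in
  the ball on which the bounds hold.
\<close>

lemma solution_transfer:
  fixes S T :: "nat \<Rightarrow> real^'n \<Rightarrow> real^'n"
  assumes K: "cball x0 R \<subseteq> \<Omega>"
    and SM: "\<And>i z. i \<in> {1..m} \<Longrightarrow> z \<in> cball x0 R \<Longrightarrow> norm (S i z) \<le> M"
    and TM: "\<And>i z. i \<in> {1..m} \<Longrightarrow> z \<in> cball x0 R \<Longrightarrow> norm (T i z) \<le> M"
    and TL: "\<And>i z w. i \<in> {1..m} \<Longrightarrow> z \<in> cball x0 R \<Longrightarrow> w \<in> cball x0 R \<Longrightarrow> norm (T i z - T i w) \<le> L * norm (z - w)"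
    and L: "0 \<le> L" and M: "0 \<le> M"
    and close: "\<And>i z. i \<in> {1..m} \<Longrightarrow> z \<in> cball x0 R \<Longrightarrow> norm (T i z - S i z) \<le> \<eta>"
    and r: "reach m \<Omega> S l x y" and l: "0 \<le> l" and x: "norm (x - x0) + real m * l * M < R"
  shows "y \<in> cball x0 R \<and> (\<exists>z\<in>cball x0 R. reach m \<Omega> T l x z \<and> norm (z - y) \<le> real m * l * \<eta> * exp (real m * l * L))"
proof -
  let ?K = "cball x0 R"
  have B0: "0 \<le> real m * l * M" "0 \<le> real m * l * L" using l M L by auto
  have "0 \<le> R" using x B0(1) norm_ge_zero[of "x - x0"] by linarith
  then have ne: "?K \<noteq> {}" by auto
  obtain \<gamma> h where h: "\<And>j. j \<in> {1..m} \<Longrightarrow> h j integrable_on {0..1}"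
    and hl: "\<And>t. t \<in> {0..1} \<Longrightarrow> (\<Sum>j=1..m. (h j t)\<^sup>2) \<le> l\<^sup>2"
    and \<gamma>: "solves (drive m S h) x \<gamma>" "\<gamma> ` {0..1} \<subseteq> \<Omega>" "\<gamma> 1 = y"
    using r unfolding reach_def by blast
  have bS: "norm (drive m S h s z) \<le> real m * l * M" if "s \<in> {0..1}" "z \<in> ?K" for s z
    by (rule norm_drive_le[where Y = S and h = h, OF hl[OF that(1)] l SM[OF _ that(2)]])
  have \<gamma>K: "\<gamma> t \<in> ?K" if t: "t \<in> {0..1}" for t
    using solution_stays_in_ball[OF \<gamma>(1) bS x t B0(1)]
    by (simp add: dist_norm norm_minus_commute)
  let ?T = "\<lambda>i. trunc ?K (T i)"
  have lT: "lip L (?T i)" if "i \<in> {1..m}" for i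
    by (rule trunc_lip[OF closed_cball convex_cball ne L]) (rule TL[OF that])
  have bT: "norm (?T i z) \<le> M" if "i \<in> {1..m}" for i z
    by (rule trunc_all[OF closed_cball ne, of "\<lambda>v. norm v \<le> M"]) (rule TM[OF that])
  have dL: "norm (drive m ?T h s z - drive m ?T h s w) \<le> real m * l * L * norm (z - w)" if s: "s \<in> {0..1}" for s z w
    using norm_drive_diff_le[where h = h and Y = ?T and Z = ?T and x = z and y = w, OF hl[OF s] l lipD[OF lT]]
    by (simp add: mult_ac)
  have bTd: "norm (drive m ?T h s z) \<le> real m * l * M" if "s \<in> {0..1}" for s z
    by (rule norm_drive_le[where Y = ?T and h = h, OF hl[OF that] l bT])
  have "\<exists>\<delta>. solves (drive m ?T h) x \<delta>"
  proof (rule solution_exists[OF _ dL B0(2)])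
    fix \<delta> :: "real \<Rightarrow> real^'n" assume "continuous_on {0..1} \<delta>"
    then show "(\<lambda>s. drive m ?T h s (\<delta> s)) integrable_on {0..1}"
      using drive_integrable[OF h hl l, of UNIV ?T \<delta>] lip_imp_continuous_on[OF lT] by simp
  qed
  then obtain \<delta> where \<delta>: "solves (drive m ?T h) x \<delta>" by blast
  have \<delta>K: "\<delta> t \<in> ?K" if t: "t \<in> {0..1}" for t
    using solution_stays_in_ball[OF \<delta> _ x t B0(1)] bTd
    by (simp add: dist_norm norm_minus_commute)
  have "norm (\<delta> 1 - \<gamma> 1) \<le> (norm (x - x) + real m * l * \<eta>) * exp (real m * l * L)"
  proof (rule solutions_close[OF \<delta> \<gamma>(1) dL _ B0(2)])
    fix s :: real assume s: "s \<in> {0..1}"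
    show "norm (drive m ?T h s (\<gamma> s) - drive m S h s (\<gamma> s)) \<le> real m * l * \<eta>"
      by (rule norm_drive_diff_le[where h = h, OF hl[OF s] l]) (use close \<gamma>K[OF s] in \<open>simp add: trunc_eq\<close>)
  qed auto
  moreover have "reach m \<Omega> T l x (\<delta> 1)"
  proof -
    have "drive m ?T h s (\<delta> s) = drive m T h s (\<delta> s)" if "s \<in> {0..1}" for s
      using \<delta>K[OF that] by (simp add: drive_def trunc_eq)
    then have "solves (drive m T h) x \<delta>"
      using \<delta> unfolding solves_def by (auto elim!: has_integral_eq[rotated])
    then show ?thesis unfolding reach_def using h hl \<delta>K K by blast
  qed
  ultimately show ?thesis using \<gamma>K[of 1] \<delta>K[of 1] \<gamma>(3) by auto
qed

text \<open>
  Otherwise there are points at distances tending to \<open>0\<close> that cannot be joined in frames with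
  indices tending to infinity. Along a subsequence the points converge to some \<open>p\<close> and the parameters to
  some \<open>q0\<close>, and then the frames converge uniformly near \<open>p\<close> to \<open>X q0\<close>, which contradicts stable local
  controllability at \<open>p\<close>.
\<close>

lemma uniform_local_controllability:
  fixes X :: "'q::metric_space \<Rightarrow> nat \<Rightarrow> real^'n \<Rightarrow> real^'n"
    and Xj :: "nat \<Rightarrow> 'q \<Rightarrow> nat \<Rightarrow> real^'n \<Rightarrow> real^'n"
  assumes \<Omega>: "open \<Omega>" and C: "compact C" "C \<subseteq> \<Omega>" and \<Xi>: "compact \<Xi>"
    and smX: "\<And>q i. q \<in> \<Xi> \<Longrightarrow> i \<in> {1..m} \<Longrightarrow> csmooth \<Omega> (X q i)"
    and smXj: "\<And>j q i. q \<in> \<Xi> \<Longrightarrow> i \<in> {1..m} \<Longrightarrow> csmooth \<Omega> (Xj j q i)"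
    and chow: "\<And>q. q \<in> \<Xi> \<Longrightarrow> chow_condition m \<Omega> (X q)"
    and cont: "\<And>i. i \<in> {1..m} \<Longrightarrow> continuous_on (\<Omega> \<times> \<Xi>) (\<lambda>(x, q). X q i x)"
    and conv: "\<And>i K. i \<in> {1..m} \<Longrightarrow> compact K \<Longrightarrow> K \<subseteq> \<Omega> \<Longrightarrow>
      uniform_limit (K \<times> \<Xi>) (\<lambda>j (x, q). Xj j q i x) (\<lambda>(x, q). X q i x) sequentially"
    and \<epsilon>: "0 < \<epsilon>"
  shows "\<exists>\<delta>>0. \<exists>J. \<forall>j\<ge>J. \<forall>q\<in>\<Xi>. \<forall>x\<in>C. \<forall>y\<in>C. dist x y < \<delta> \<longrightarrow> reach m \<Omega> (Xj j q) \<epsilon> x y"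
proof (rule ccontr)
  assume contra: "\<not> ?thesis"
  have "\<exists>j q x y. n \<le> j \<and> q \<in> \<Xi> \<and> x \<in> C \<and> y \<in> C \<and> dist x y < inverse (real (Suc n)) \<and> \<not> reach m \<Omega> (Xj j q) \<epsilon> x y" for n
  proof -
    have "0 < inverse (real (Suc n))" by simp
    then show ?thesis using contra by blast
  qed
  then obtain jn qn xn yn where seq: "\<And>n. n \<le> jn n" "\<And>n. qn n \<in> \<Xi>" "\<And>n. xn n \<in> C" "\<And>n. yn n \<in> C"
    "\<And>n. dist (xn n) (yn n) < inverse (real (Suc n))" "\<And>n. \<not> reach m \<Omega> (Xj (jn n) (qn n)) \<epsilon> (xn n) (yn n)"
    by metis
  have "seq_compact (C \<times> \<Xi>)" by (rule compact_imp_seq_compact[OF compact_Times[OF C(1) \<Xi>]])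
  then obtain l r where l: "l \<in> C \<times> \<Xi>" and r: "strict_mono r" and lim: "((\<lambda>n. (xn n, qn n)) \<circ> r) \<longlonglongrightarrow> l"
    by (rule seq_compactE[of _ "\<lambda>n. (xn n, qn n)"]) (use seq in auto)
  obtain p q0 where pq: "l = (p, q0)" by fastforce
  have xlim: "(\<lambda>n. xn (r n)) \<longlonglongrightarrow> p" using tendsto_fst[OF lim] by (simp add: o_def pq)
  have qlim: "(\<lambda>n. qn (r n)) \<longlonglongrightarrow> q0" using tendsto_snd[OF lim] by (simp add: o_def pq)
  have p: "p \<in> \<Omega>" and q0: "q0 \<in> \<Xi>" using l pq C by auto
  obtain \<rho> where \<rho>: "0 < \<rho>" "cball p \<rho> \<subseteq> \<Omega>" using \<Omega> p open_contains_cball by blast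
  obtain k where sp: "span ((\<lambda>Y. Y p) ` iterated_brackets m (X q0) k) = UNIV"
    using chow[OF q0] p unfolding chow_condition_def by blast
  obtain \<theta> where \<theta>: "0 < \<theta>" and \<theta>_reach: "\<forall>Y.
      (\<forall>i\<in>{1..m}. \<exists>L. \<forall>x\<in>cball p \<rho>. \<forall>y\<in>cball p \<rho>. norm (Y i x - Y i y) \<le> L * norm (x - y)) \<longrightarrow>
      (\<forall>i\<in>{1..m}. \<forall>x\<in>cball p \<rho>. norm (Y i x - X q0 i x) \<le> \<theta>) \<longrightarrow>
      (\<forall>x\<in>ball p \<theta>. \<forall>y\<in>ball p \<theta>. reach m \<Omega> Y \<epsilon> x y)"
    using stable_local_controllability[OF \<Omega> smX[OF q0] \<rho> sp \<epsilon>] by blast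
  have e1: "\<forall>\<^sub>F n in sequentially. dist (xn (r n)) p < \<theta> / 2"
    using tendstoD[OF xlim, of "\<theta> / 2"] \<theta> by simp
  have e2: "\<forall>\<^sub>F n in sequentially. inverse (real (Suc n)) < \<theta> / 2"
    using order_tendstoD(2)[OF LIMSEQ_inverse_real_of_nat, of "\<theta> / 2"] \<theta> by simp
  have e3: "\<forall>\<^sub>F n in sequentially. \<forall>i\<in>{1..m}. \<forall>x\<in>cball p \<rho>. norm (X (qn (r n)) i x - X q0 i x) \<le> \<theta> / 2"
  proof (rule eventually_ball_finite; (intro ballI)?)
    fix i assume i: "i \<in> {1..m}"
    have "uniformly_continuous_on (cball p \<rho> \<times> \<Xi>) (\<lambda>(x, q). X q i x)"
      by (intro compact_uniformly_continuous compact_Times compact_cball \<Xi> continuous_on_subset[OF cont[OF i]])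
         (use \<rho> in auto)
    then obtain d where d: "d > 0" "\<And>z z'. z \<in> cball p \<rho> \<times> \<Xi> \<Longrightarrow> z' \<in> cball p \<rho> \<times> \<Xi> \<Longrightarrow> dist z' z < d \<Longrightarrow>
        dist ((\<lambda>(x, q). X q i x) z') ((\<lambda>(x, q). X q i x) z) < \<theta> / 2"
      using half_gt_zero[OF \<theta>] unfolding uniformly_continuous_on_def by blast
    have "\<forall>\<^sub>F n in sequentially. dist (qn (r n)) q0 < d" by (rule tendstoD[OF qlim d(1)])
    then show "\<forall>\<^sub>F n in sequentially. \<forall>x\<in>cball p \<rho>. norm (X (qn (r n)) i x - X q0 i x) \<le> \<theta> / 2"
    proof eventually_elim
      fix n assume n: "dist (qn (r n)) q0 < d"
      show "\<forall>x\<in>cball p \<rho>. norm (X (qn (r n)) i x - X q0 i x) \<le> \<theta> / 2"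
      proof
        fix x assume x: "x \<in> cball p \<rho>"
        show "norm (X (qn (r n)) i x - X q0 i x) \<le> \<theta> / 2"
          using d(2)[of "(x, q0)" "(x, qn (r n))"] x q0 seq(2) n by (simp add: dist_Pair_Pair dist_norm)
      qed
    qed
  qed simp
  have jtop: "filterlim (\<lambda>n. jn (r n)) at_top sequentially"
  proof (rule filterlim_at_top_mono[OF filterlim_ident])
    show "\<forall>\<^sub>F n in sequentially. n \<le> jn (r n)"
      using seq_suble[OF r] seq(1) by (intro always_eventually allI) (meson order_trans)
  qed
  have e4: "\<forall>\<^sub>F n in sequentially. \<forall>i\<in>{1..m}. \<forall>z\<in>cball p \<rho> \<times> \<Xi>. dist ((\<lambda>(x, q). Xj (jn (r n)) q i x) z) ((\<lambda>(x, q). X q i x) z) < \<theta> / 2"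
  proof (rule eventually_ball_finite; (intro ballI)?)
    fix i assume i: "i \<in> {1..m}"
    have "\<forall>\<^sub>F j in sequentially. \<forall>z\<in>cball p \<rho> \<times> \<Xi>. dist ((\<lambda>(x, q). Xj j q i x) z) ((\<lambda>(x, q). X q i x) z) < \<theta> / 2"
      using uniform_limitD[OF conv[OF i compact_cball \<rho>(2)], of "\<theta> / 2"] \<theta> by simp
    then show "\<forall>\<^sub>F n in sequentially. \<forall>z\<in>cball p \<rho> \<times> \<Xi>. dist ((\<lambda>(x, q). Xj (jn (r n)) q i x) z) ((\<lambda>(x, q). X q i x) z) < \<theta> / 2"
      by (rule eventually_compose_filterlim[OF _ jtop])
  qed simp
  have "\<forall>\<^sub>F n in sequentially. False"
    using e1 e2 e3 e4
  proof eventually_elim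
    fix n assume n: "dist (xn (r n)) p < \<theta> / 2" "inverse (real (Suc n)) < \<theta> / 2"
      "\<forall>i\<in>{1..m}. \<forall>x\<in>cball p \<rho>. norm (X (qn (r n)) i x - X q0 i x) \<le> \<theta> / 2"
      "\<forall>i\<in>{1..m}. \<forall>z\<in>cball p \<rho> \<times> \<Xi>. dist ((\<lambda>(x, q). Xj (jn (r n)) q i x) z) ((\<lambda>(x, q). X q i x) z) < \<theta> / 2"
    have "inverse (real (Suc (r n))) \<le> inverse (real (Suc n))"
      using seq_suble[OF r, of n] by (intro le_imp_inverse_le) auto
    then have xy: "dist (xn (r n)) (yn (r n)) < \<theta> / 2" using seq(5)[of "r n"] n(2) by linarith
    have "reach m \<Omega> (Xj (jn (r n)) (qn (r n))) \<epsilon> (xn (r n)) (yn (r n))"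
    proof (rule \<theta>_reach[rule_format])
      show "\<exists>L. \<forall>x\<in>cball p \<rho>. \<forall>y\<in>cball p \<rho>. norm (Xj (jn (r n)) (qn (r n)) i x - Xj (jn (r n)) (qn (r n)) i y) \<le> L * norm (x - y)"
        if "i \<in> {1..m}" for i
        using csmooth_bounds_cball[OF smXj[OF seq(2) that] \<rho>(2)] by blast
      show "norm (Xj (jn (r n)) (qn (r n)) i x - X q0 i x) \<le> \<theta>" if i: "i \<in> {1..m}" and x: "x \<in> cball p \<rho>" for i x
      proof -
        have "norm (X (qn (r n)) i x - X q0 i x) \<le> \<theta> / 2" using n(3) i x by blast
        moreover have "norm (Xj (jn (r n)) (qn (r n)) i x - X (qn (r n)) i x) \<le> \<theta> / 2"
          using n(4)[rule_format, OF i, of "(x, qn (r n))"] x seq(2) by (simp add: dist_norm)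
        ultimately show ?thesis
          using norm_triangle_ineq[of "Xj (jn (r n)) (qn (r n)) i x - X (qn (r n)) i x" "X (qn (r n)) i x - X q0 i x"] by simp
      qed
      show "xn (r n) \<in> ball p \<theta>" using n(1) \<theta> by (simp add: dist_commute)
      show "yn (r n) \<in> ball p \<theta>"
        using n(1) xy dist_triangle[of p "yn (r n)" "xn (r n)"] by (simp add: dist_commute)
    qed
    then show False using seq(6) by blast
  qed
  then show False by simp
qed

text \<open>
  A segment is divided into \<open>n + 1\<close> equal parts.
\<close>

lemma reach_chain:
  assumes C: "convex C" and loc: "\<And>x y. x \<in> C \<Longrightarrow> y \<in> C \<Longrightarrow> dist x y < \<delta> \<Longrightarrow> reach m \<Omega> Y \<epsilon> x y"
    and \<epsilon>: "0 < \<epsilon>"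
  shows "x \<in> C \<Longrightarrow> y \<in> C \<Longrightarrow> dist x y < real (Suc n) * \<delta> \<Longrightarrow> reach m \<Omega> Y (real (Suc n) * \<epsilon>) x y"
proof (induction n arbitrary: x)
  case 0
  then show ?case using loc by simp
next
  case (Suc n)
  define u where "u = 1 / real (Suc (Suc n))"
  define z where "z = (1 - u) *\<^sub>R x + u *\<^sub>R y"
  have u: "0 \<le> u" "u \<le> 1" by (auto simp: u_def)
  have u1: "real (Suc (Suc n)) * u = 1" "real (Suc (Suc n)) * (1 - u) = real (Suc n)"
    by (auto simp: u_def field_simps)
  have z: "z \<in> C" unfolding z_def by (rule convexD_alt[OF C Suc.prems(1,2) u])
  have "x - z = u *\<^sub>R (x - y)" "z - y = (1 - u) *\<^sub>R (x - y)" by (simp_all add: z_def algebra_simps)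
  then have d: "dist x z = u * dist x y" "dist z y = (1 - u) * dist x y"
    using u by (simp_all add: dist_norm)
  have "0 < u" by (simp add: u_def)
  then have "u * dist x y < u * (real (Suc (Suc n)) * \<delta>)" using Suc.prems(3) by (rule mult_strict_left_mono[rotated])
  also have "\<dots> = (real (Suc (Suc n)) * u) * \<delta>" by (simp only: mult_ac)
  also have "\<dots> = \<delta>" by (simp only: u1 mult_1)
  finally have 1: "reach m \<Omega> Y \<epsilon> x z" using loc Suc.prems(1) z d by simp
  have "0 < 1 - u" by (simp add: u_def field_simps)
  then have "(1 - u) * dist x y < (1 - u) * (real (Suc (Suc n)) * \<delta>)" using Suc.prems(3) by (rule mult_strict_left_mono[rotated])
  also have "\<dots> = (real (Suc (Suc n)) * (1 - u)) * \<delta>" by (simp only: mult_ac)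
  also have "\<dots> = real (Suc n) * \<delta>" by (simp only: u1)
  finally have 2: "reach m \<Omega> Y (real (Suc n) * \<epsilon>) z y" using Suc.IH[OF z Suc.prems(2)] d by simp
  have "reach m \<Omega> Y (\<epsilon> + real (Suc n) * \<epsilon>) x y" by (rule reach_trans[OF 1 2]) (use \<epsilon> in auto)
  then show ?case by (simp add: algebra_simps)
qed

text \<open>
  The value is an infimum of extended reals, which would be negative if some essential supremum were
  taken over a null space; here the space of times has measure \<open>1\<close>.
\<close>

lemma sr_dist_nonneg: "0 \<le> sr_dist m \<Omega> Y x y"
  unfolding sr_dist_def
proof (rule Inf_greatest, clarify)
  fix h :: "nat \<Rightarrow> real \<Rightarrow> real"
  let ?M = "lebesgue_on {0..1::real}"
  let ?f = "\<lambda>t. ereal (sqrt (\<Sum>j=1..m. (h j t)\<^sup>2))"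
  show "0 \<le> control_norm m h"
  proof (cases "?f \<in> borel_measurable ?M")
    case True
    have "emeasure ?M (space ?M) \<noteq> 0" by (simp add: emeasure_restrict_space)
    then have "0 = esssup ?M (\<lambda>_. 0 :: ereal)" by (simp add: esssup_const)
    also have "\<dots> \<le> esssup ?M ?f" by (rule esssup_mono) (auto simp: sum_nonneg)
    finally show ?thesis by (simp add: control_norm_def)
  next
    case False
    then show ?thesis by (simp add: control_norm_def esssup_non_measurable)
  qed
qed

lemma sr_dist_triangle_reach:
  assumes "sr_dist m \<Omega> Y x y = ereal a" and r: "reach m \<Omega> Y l y z" and l: "0 < l"
    and Y: "\<And>j. j \<in> {1..m} \<Longrightarrow> continuous_on \<Omega> (Y j)"
  shows "sr_dist m \<Omega> Y x z \<le> ereal (a + l)"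
proof -
  have a: "0 \<le> a" using sr_dist_nonneg[of m \<Omega> Y x y] assms(1) by simp
  have "sr_dist m \<Omega> Y x z \<le> ereal (a + l) + ereal e" if e: "0 < e" for e
  proof -
    have "reach m \<Omega> Y (a + e) x y" by (rule sr_dist_less_imp_reach) (use assms(1) e in simp)
    then have "reach m \<Omega> Y (a + e + l) x z" by (rule reach_trans[OF _ r]) (use a e l in auto)
    then show ?thesis using reach_imp_sr_dist_le[OF _ _ Y] a e l by (simp add: algebra_simps)
  qed
  then show ?thesis by (rule ereal_le_epsilon2[rule_format]) 
qed

text \<open>
  By Chow's theorem the distance is finite and continuous on the larger ball, hence bounded and
  measurable on the smaller one.
\<close>

lemma in_Linf_sr_dist:
  fixes Y :: "nat \<Rightarrow> real^'n \<Rightarrow> real^'n"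
  assumes sm: "\<And>i. i \<in> {1..m} \<Longrightarrow> csmooth (ball x0 R) (Y i)" and chow: "chow_condition m (ball x0 R) Y"
    and r: "0 < r" "r < R"
  shows "in_Linf (ball x0 r \<times> ball x0 r) (\<lambda>(x, y). sr_dist m (ball x0 R) Y x y)"
proof -
  let ?\<Omega> = "ball x0 R" and ?C = "cball x0 r"
  let ?d = "sr_dist m ?\<Omega> Y"
  have Yc: "continuous_on ?\<Omega> (Y j)" if "j \<in> {1..m}" for j using csmooth_continuous_on[OF sm[OF that]] by blast
  have C: "compact ?C" "?C \<subseteq> ?\<Omega>" using r by auto
  have loc: "\<exists>\<delta>>0. \<forall>x\<in>?C. \<forall>y\<in>?C. dist x y < \<delta> \<longrightarrow> reach m ?\<Omega> Y \<epsilon> x y" if \<epsilon>: "0 < \<epsilon>" for \<epsilon>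
  proof -
    have "\<exists>\<delta>>0. \<exists>J. \<forall>j\<ge>J. \<forall>q\<in>{0::real}. \<forall>x\<in>?C. \<forall>y\<in>?C. dist x y < \<delta> \<longrightarrow> reach m ?\<Omega> ((\<lambda>_ _. Y) (j::nat) q) \<epsilon> x y"
    proof (rule uniform_local_controllability[OF open_ball C, where X = "\<lambda>_. Y"])
      fix i assume i: "i \<in> {1..m}"
      show "continuous_on (?\<Omega> \<times> {0::real}) (\<lambda>(x, q). Y i x)"
        unfolding split_def by (intro continuous_on_compose2[OF Yc[OF i]] continuous_intros) auto
      show "uniform_limit (K \<times> {0::real}) (\<lambda>_ (x, q). Y i x) (\<lambda>(x, q). Y i x) sequentially" for K
        by (rule uniform_limit_const)
    qed (use sm chow \<epsilon> in auto)
    then show ?thesis by blast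
  qed
  obtain \<delta>1 where \<delta>1: "\<delta>1 > 0" "\<And>x y. x \<in> ?C \<Longrightarrow> y \<in> ?C \<Longrightarrow> dist x y < \<delta>1 \<Longrightarrow> reach m ?\<Omega> Y 1 x y"
    using loc[of 1] by auto
  obtain n where "2 * r < real n * \<delta>1"
    using ex_less_of_nat_mult[OF \<delta>1(1), of "2 * r"] by blast
  then have n: "2 * r < real (Suc n) * \<delta>1" using \<delta>1(1) by (simp add: algebra_simps)
  have bound: "?d x y \<le> ereal (real (Suc n))" if xy: "x \<in> ?C" "y \<in> ?C" for x y
  proof -
    have "dist x y \<le> 2 * r" using xy dist_triangle[of x y x0] by (simp add: dist_commute)
    from le_less_trans[OF this n] have dxy: "dist x y < real (Suc n) * \<delta>1" .
    have "reach m ?\<Omega> Y (real (Suc n) * 1) x y"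
    proof (rule reach_chain[where C = ?C and \<delta> = \<delta>1, OF convex_cball _ zero_less_one xy])
      show "dist x y < real (Suc n) * \<delta>1" by (rule dxy)
    qed (rule \<delta>1(2))
    then show ?thesis using reach_imp_sr_dist_le[OF _ _ Yc, where l = "real (Suc n)"] by simp
  qed
  define f where "f z = real_of_ereal (?d (fst z) (snd z))" for z
  have df: "?d x y = ereal (f (x, y))" if xy: "x \<in> ?C" "y \<in> ?C" for x y
  proof -
    have "?d x y \<noteq> \<infinity>" "?d x y \<noteq> - \<infinity>" using bound[OF xy] sr_dist_nonneg[of m ?\<Omega> Y x y] by auto
    then show ?thesis by (cases "?d x y") (auto simp: f_def)
  qed
  have step: "f (x, z) \<le> f (x, y) + \<epsilon>" if "x \<in> ?C" "y \<in> ?C" "z \<in> ?C" "reach m ?\<Omega> Y \<epsilon> y z" "0 < \<epsilon>" for x y z \<epsilon>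
    using sr_dist_triangle_reach[OF df[OF that(1,2)] that(4,5) Yc] df[OF that(1,3)] by simp
  have step': "f (y, z) \<le> f (x, z) + \<epsilon>" if h: "x \<in> ?C" "y \<in> ?C" "z \<in> ?C" "reach m ?\<Omega> Y \<epsilon> y x" "0 < \<epsilon>" for x y z \<epsilon>
  proof -
    have "f (y, z) \<le> (f (x, z) + \<epsilon>) + e" if e: "0 < e" for e
    proof -
      have f0: "0 \<le> f (x, z)" using sr_dist_nonneg[of m ?\<Omega> Y x z] df[OF h(1,3)] by simp
      have "reach m ?\<Omega> Y (f (x, z) + e) x z" by (rule sr_dist_less_imp_reach) (use df[OF h(1,3)] e in simp)
      then have "reach m ?\<Omega> Y (\<epsilon> + (f (x, z) + e)) y z" by (rule reach_trans[OF h(4)]) (use h(5) f0 e in auto)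
      then have "?d y z \<le> ereal (\<epsilon> + (f (x, z) + e))" using reach_imp_sr_dist_le[OF _ _ Yc] h(5) f0 e by simp
      then show ?thesis using df[OF h(2,3)] by simp
    qed
    then show ?thesis by (rule field_le_epsilon)
  qed
  have "continuous_on (ball x0 r \<times> ball x0 r) f"
    unfolding continuous_on_iff
  proof (intro ballI allI impI)
    fix z e assume z: "z \<in> ball x0 r \<times> ball x0 r" and e: "0 < (e::real)"
    obtain x y where zz: "z = (x, y)" and xy: "x \<in> ?C" "y \<in> ?C" using z by auto
    obtain \<delta> where \<delta>: "\<delta> > 0" "\<And>x y. x \<in> ?C \<Longrightarrow> y \<in> ?C \<Longrightarrow> dist x y < \<delta> \<Longrightarrow> reach m ?\<Omega> Y (e / 3) x y"
      using loc[of "e / 3"] e by auto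
    show "\<exists>d>0. \<forall>z'\<in>ball x0 r \<times> ball x0 r. dist z' z < d \<longrightarrow> dist (f z') (f z) < e"
    proof (intro exI[of _ \<delta>] conjI ballI impI \<delta>(1))
      fix z' assume z': "z' \<in> ball x0 r \<times> ball x0 r" "dist z' z < \<delta>"
      obtain x' y' where zz': "z' = (x', y')" and xy': "x' \<in> ?C" "y' \<in> ?C" using z' by auto
      have dd: "dist x' x < \<delta>" "dist y' y < \<delta>"
        using z'(2) dist_fst_le[of z' z] dist_snd_le[of z' z] by (auto simp: zz zz')
      have r1: "reach m ?\<Omega> Y (e / 3) x' x" "reach m ?\<Omega> Y (e / 3) x x'" "reach m ?\<Omega> Y (e / 3) y y'" "reach m ?\<Omega> Y (e / 3) y' y"
        using dd xy xy' by (auto intro!: \<delta>(2) simp: dist_commute)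
      have e3: "0 < e / 3" using e by simp
      have "f (x', y') \<le> f (x, y') + e / 3" "f (x, y') \<le> f (x, y) + e / 3"
        using step'[OF xy(1) xy'(1) xy'(2) r1(1) e3] step[OF xy(1) xy(2) xy'(2) r1(3) e3] by auto
      moreover have "f (x, y) \<le> f (x', y) + e / 3" "f (x', y) \<le> f (x', y') + e / 3"
        using step'[OF xy'(1) xy(1) xy(2) r1(2) e3] step[OF xy'(1) xy'(2) xy(2) r1(4) e3] by auto
      ultimately show "dist (f z') (f z) < e" using e by (simp add: zz zz' dist_real_def)
    qed
  qed
  then have "f \<in> borel_measurable (lebesgue_on (ball x0 r \<times> ball x0 r))"
    by (rule continuous_imp_measurable_on_sets_lebesgue) (simp add: open_Times borel_open)
  then have "(\<lambda>z. ereal (f z)) \<in> borel_measurable (lebesgue_on (ball x0 r \<times> ball x0 r))"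
    by (rule borel_measurable_ereal)
  then have meas: "(\<lambda>(x, y). ?d x y) \<in> borel_measurable (lebesgue_on (ball x0 r \<times> ball x0 r))"
    by (rule measurable_cong[THEN iffD1, rotated]) (auto simp: df)
  have "Linf_norm (ball x0 r \<times> ball x0 r) (\<lambda>(x, y). ?d x y) \<le> ereal (real (Suc n))"
    unfolding Linf_norm_def
  proof (rule esssup_I)
    show "(\<lambda>z. \<bar>case z of (x, y) \<Rightarrow> ?d x y\<bar>) \<in> borel_measurable (lebesgue_on (ball x0 r \<times> ball x0 r))"
      using meas by measurable
    show "AE z in lebesgue_on (ball x0 r \<times> ball x0 r). \<bar>case z of (x, y) \<Rightarrow> ?d x y\<bar> \<le> ereal (real (Suc n))"
    proof (rule AE_I2)
      fix z assume "z \<in> space (lebesgue_on (ball x0 r \<times> ball x0 r))"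
      then obtain x y where "z = (x, y)" "x \<in> ?C" "y \<in> ?C" by auto
      then show "\<bar>case z of (x, y) \<Rightarrow> ?d x y\<bar> \<le> ereal (real (Suc n))"
        using bound sr_dist_nonneg[of m ?\<Omega> Y x y] by simp
    qed
  qed
  also have "\<dots> < \<infinity>" by simp
  finally show ?thesis using meas by (simp add: in_Linf_def)
qed

text \<open>
  An almost optimal control of \<open>S\<close> is run in \<open>T\<close>, and the endpoint is corrected by a curve of length \<open>\<epsilon>\<close>.
  The bound \<open>2 * \<epsilon>0\<close> on the length of the first curve makes the Gronwall constants independent of the points.
\<close>

lemma sr_dist_le_perturbed:
  fixes S T :: "nat \<Rightarrow> real^'n \<Rightarrow> real^'n"
  assumes K: "cball x0 R \<subseteq> \<Omega>"
    and SM: "\<And>i z. i \<in> {1..m} \<Longrightarrow> z \<in> cball x0 R \<Longrightarrow> norm (S i z) \<le> M"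
    and TM: "\<And>i z. i \<in> {1..m} \<Longrightarrow> z \<in> cball x0 R \<Longrightarrow> norm (T i z) \<le> M"
    and TL: "\<And>i z w. i \<in> {1..m} \<Longrightarrow> z \<in> cball x0 R \<Longrightarrow> w \<in> cball x0 R \<Longrightarrow> norm (T i z - T i w) \<le> L * norm (z - w)"
    and L: "0 \<le> L" and M: "0 \<le> M" and Tc: "\<And>i. i \<in> {1..m} \<Longrightarrow> continuous_on \<Omega> (T i)"
    and close: "\<And>i z. i \<in> {1..m} \<Longrightarrow> z \<in> cball x0 R \<Longrightarrow> norm (T i z - S i z) \<le> \<eta>"
    and \<eta>: "0 \<le> \<eta>" "real m * (2 * \<epsilon>0) * \<eta> * exp (real m * (2 * \<epsilon>0) * L) < \<delta>"
    and loc: "\<And>z w. z \<in> cball x0 R \<Longrightarrow> w \<in> cball x0 R \<Longrightarrow> dist z w < \<delta> \<Longrightarrow> reach m \<Omega> T \<epsilon> z w"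
    and \<epsilon>: "0 < \<epsilon>" "\<epsilon> \<le> \<epsilon>0"
    and x: "norm (x - x0) + real m * (2 * \<epsilon>0) * M < R"
    and d: "sr_dist m \<Omega> S x y = ereal d" "d \<le> \<epsilon>0"
  shows "sr_dist m \<Omega> T x y \<le> ereal (d + 2 * \<epsilon>)"
proof -
  define l where "l = d + \<epsilon>"
  have d0: "0 \<le> d" using sr_dist_nonneg[of m \<Omega> S x y] d by simp
  have l: "0 < l" "l \<le> 2 * \<epsilon>0" using d0 \<epsilon> d by (auto simp: l_def)
  have r: "reach m \<Omega> S l x y" by (rule sr_dist_less_imp_reach) (use d \<epsilon> in \<open>simp add: l_def\<close>)
  have "real m * l * M \<le> real m * (2 * \<epsilon>0) * M" using l M by (intro mult_right_mono mult_left_mono) auto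
  then have x': "norm (x - x0) + real m * l * M < R" using x by linarith
  obtain z where y: "y \<in> cball x0 R" and z: "z \<in> cball x0 R" "reach m \<Omega> T l x z"
    "norm (z - y) \<le> real m * l * \<eta> * exp (real m * l * L)"
    using solution_transfer[OF K SM TM TL L M close r less_imp_le[OF l(1)] x'] by blast
  have "real m * l * \<eta> * exp (real m * l * L) \<le> real m * (2 * \<epsilon>0) * \<eta> * exp (real m * (2 * \<epsilon>0) * L)"
    using l \<eta>(1) L by (intro mult_mono mult_right_mono mult_left_mono iffD2[OF exp_le_cancel_iff]) auto
  then have "dist z y < \<delta>" using z(3) \<eta>(2) by (simp add: dist_norm)
  then have "reach m \<Omega> T \<epsilon> z y" by (rule loc[OF z(1) y])
  then have "reach m \<Omega> T (l + \<epsilon>) x y" by (rule reach_trans[OF z(2)]) (use l \<epsilon> in auto)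
  then show ?thesis using reach_imp_sr_dist_le[OF _ _ Tc, where l = "l + \<epsilon>"] l \<epsilon> by (simp add: l_def algebra_simps)
qed


lemma partial_deriv_bounded_on_compact:
  fixes X :: "'q::metric_space \<Rightarrow> real^'n \<Rightarrow> real^'n"
  assumes K: "compact K" "K \<subseteq> \<Omega>" and \<Xi>: "compact \<Xi>"
    and cont: "continuous_on (\<Omega> \<times> \<Xi>) (\<lambda>(x, q). iter_partial w (X q) x)"
  shows "\<exists>b. \<forall>x\<in>K. \<forall>q\<in>\<Xi>. norm (iter_partial w (X q) x) \<le> b"
proof -
  have "continuous_on (K \<times> \<Xi>) (\<lambda>(x, q). iter_partial w (X q) x)"
    by (rule continuous_on_subset[OF cont]) (use K in auto)
  then have "bounded ((\<lambda>(x, q). iter_partial w (X q) x) ` (K \<times> \<Xi>))"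
    by (rule compact_imp_bounded[OF compact_continuous_image[OF _ compact_Times[OF K(1) \<Xi>]]])
  then obtain b where "\<forall>z\<in>(\<lambda>(x, q). iter_partial w (X q) x) ` (K \<times> \<Xi>). norm z \<le> b"
    unfolding bounded_iff by blast
  then show ?thesis by (intro exI[of _ b]) auto
qed

theorem theorem4p1:
  fixes m :: nat
    and x0 :: "real^'n" and R0 :: real
    and \<Xi> :: "'q::metric_space set"
    and Xj :: "nat \<Rightarrow> 'q \<Rightarrow> nat \<Rightarrow> real^'n \<Rightarrow> real^'n"
    and X :: "'q \<Rightarrow> nat \<Rightarrow> real^'n \<Rightarrow> real^'n"
  assumes "m \<le> CARD('n)"
    and "0 < R0"
    and "compact \<Xi>"
    and "\<And>j q. q \<in> \<Xi> \<Longrightarrow>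
           is_frame m (ball x0 R0) (Xj j q) \<and> chow_condition m (ball x0 R0) (Xj j q)"
    and "\<And>q. q \<in> \<Xi> \<Longrightarrow>
           is_frame m (ball x0 R0) (X q) \<and> chow_condition m (ball x0 R0) (X q)"
    and "\<And>i w. i \<in> {1..m} \<Longrightarrow>
           continuous_on (ball x0 R0 \<times> \<Xi>) (\<lambda>(x, q). iter_partial w (X q i) x)"
    and "\<And>i j w. i \<in> {1..m} \<Longrightarrow>
           continuous_on (ball x0 R0 \<times> \<Xi>) (\<lambda>(x, q). iter_partial w (Xj j q i) x)"
    and "\<And>i w K. i \<in> {1..m} \<Longrightarrow> compact K \<Longrightarrow> K \<subseteq> ball x0 R0 \<Longrightarrow>
           uniform_limit (K \<times> \<Xi>)
             (\<lambda>j (x, q). iter_partial w (Xj j q i) x)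
             (\<lambda>(x, q). iter_partial w (X q i) x) sequentially"
  shows "\<exists>r0. 0 < r0 \<and> r0 < R0 \<and>
    Linf_convergent_uniformly (ball x0 r0 \<times> ball x0 r0) \<Xi>
      (\<lambda>j q (x, y). sr_dist m (ball x0 R0) (Xj j q) x y)
      (\<lambda>q (x, y). sr_dist m (ball x0 R0) (X q) x y)"
proof -
  let ?\<Omega> = "ball x0 R0"
  have smX: "csmooth ?\<Omega> (X q i)" if "q \<in> \<Xi>" "i \<in> {1..m}" for q i
    using assms(5)[OF that(1)] that(2) by (intro smooth_on_imp_csmooth) (auto simp: is_frame_def)
  have smXj: "csmooth ?\<Omega> (Xj j q i)" if "q \<in> \<Xi>" "i \<in> {1..m}" for j q i
    using assms(4)[OF that(1)] that(2) by (intro smooth_on_imp_csmooth) (auto simp: is_frame_def)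
  have chowX: "chow_condition m ?\<Omega> (X q)" if "q \<in> \<Xi>" for q using assms(5)[OF that] by blast
  have chowXj: "chow_condition m ?\<Omega> (Xj j q)" if "q \<in> \<Xi>" for j q using assms(4)[OF that] by blast
  have Xc: "continuous_on ?\<Omega> (X q i)" if "q \<in> \<Xi>" "i \<in> {1..m}" for q i
    by (rule csmooth_continuous_on[OF smX[OF that]]) simp
  have Xjc: "continuous_on ?\<Omega> (Xj j q i)" if "q \<in> \<Xi>" "i \<in> {1..m}" for j q i
    by (rule csmooth_continuous_on[OF smXj[OF that]]) simp
  have ip0: "iter_partial [] f = f" for f :: "real^'n \<Rightarrow> real^'n" by (simp add: iter_partial_def)
  have contX: "continuous_on (?\<Omega> \<times> \<Xi>) (\<lambda>(x, q). X q i x)" if "i \<in> {1..m}" for i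
    using assms(6)[OF that, of "[]"] by (simp add: ip0)
  have conv: "uniform_limit (K \<times> \<Xi>) (\<lambda>j (x, q). Xj j q i x) (\<lambda>(x, q). X q i x) sequentially"
    if "i \<in> {1..m}" "compact K" "K \<subseteq> ?\<Omega>" for i K
    using assms(8)[OF that, of "[]"] by (simp add: ip0)
  \<comment> \<open>All bounds are taken on the closed ball \<open>?K\<close>; near the boundary of \<open>?\<Omega>\<close> there are none.\<close>
  define R1 where "R1 = R0 / 2"
  have R1: "0 < R1" "R1 < R0" using assms(2) by (auto simp: R1_def)
  let ?K = "cball x0 R1"
  have K: "compact ?K" "?K \<subseteq> ?\<Omega>" using R1 by auto
  have locXj: "\<exists>\<delta>>0. \<exists>J. \<forall>j\<ge>J. \<forall>q\<in>\<Xi>. \<forall>x\<in>?K. \<forall>y\<in>?K. dist x y < \<delta> \<longrightarrow> reach m ?\<Omega> (Xj j q) \<epsilon> x y"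
    if "0 < \<epsilon>" for \<epsilon>
    by (rule uniform_local_controllability[OF open_ball K assms(3) smX smXj chowX contX conv that])
  \<comment> \<open>The limit frames are treated as a constant sequence.\<close>
  have locX: "\<exists>\<delta>>0. \<exists>J::nat. \<forall>j\<ge>J. \<forall>q\<in>\<Xi>. \<forall>x\<in>?K. \<forall>y\<in>?K. dist x y < \<delta> \<longrightarrow> reach m ?\<Omega> (X q) \<epsilon> x y"
    if "0 < \<epsilon>" for \<epsilon>
    by (rule uniform_local_controllability[OF open_ball K assms(3) smX smX chowX contX uniform_limit_const that])
  have loc: "\<exists>\<delta>>0. \<exists>J. (\<forall>j\<ge>J. \<forall>q\<in>\<Xi>. \<forall>x\<in>?K. \<forall>y\<in>?K. dist x y < \<delta> \<longrightarrow> reach m ?\<Omega> (Xj j q) \<epsilon> x y) \<and>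
      (\<forall>q\<in>\<Xi>. \<forall>x\<in>?K. \<forall>y\<in>?K. dist x y < \<delta> \<longrightarrow> reach m ?\<Omega> (X q) \<epsilon> x y)" if "0 < \<epsilon>" for \<epsilon>
  proof -
    obtain \<delta>1 J where "\<delta>1 > 0" "\<forall>j\<ge>J. \<forall>q\<in>\<Xi>. \<forall>x\<in>?K. \<forall>y\<in>?K. dist x y < \<delta>1 \<longrightarrow> reach m ?\<Omega> (Xj j q) \<epsilon> x y"
      using locXj[OF \<open>0 < \<epsilon>\<close>] by blast
    moreover obtain \<delta>2 where "\<delta>2 > 0" "\<forall>q\<in>\<Xi>. \<forall>x\<in>?K. \<forall>y\<in>?K. dist x y < \<delta>2 \<longrightarrow> reach m ?\<Omega> (X q) \<epsilon> x y"
      using locX[OF \<open>0 < \<epsilon>\<close>] by blast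
    ultimately show ?thesis by (intro exI[of _ "min \<delta>1 \<delta>2"] conjI exI[of _ J]) auto
  qed
  have "\<exists>M\<ge>0. \<forall>i\<in>{1..m}. \<forall>x\<in>?K. \<forall>q\<in>\<Xi>. norm (X q i x) \<le> M"
    by (rule finite_common_bound)
       (use partial_deriv_bounded_on_compact[OF K assms(3) assms(6), of _ "[]"] in \<open>force simp: ip0\<close>)+
  then obtain M0 where M0: "0 \<le> M0" "\<And>i x q. i \<in> {1..m} \<Longrightarrow> x \<in> ?K \<Longrightarrow> q \<in> \<Xi> \<Longrightarrow> norm (X q i x) \<le> M0"
    by blast
  have "\<exists>b\<ge>0. \<forall>k\<in>UNIV. \<forall>i\<in>{1..m}. \<forall>x\<in>?K. \<forall>q\<in>\<Xi>. norm (iter_partial [k] (X q i) x) \<le> b"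
  proof (rule finite_common_bound)
    fix k :: 'n
    have "\<exists>b\<ge>0. \<forall>i\<in>{1..m}. \<forall>x\<in>?K. \<forall>q\<in>\<Xi>. norm (iter_partial [k] (X q i) x) \<le> b"
      by (rule finite_common_bound)
         (use partial_deriv_bounded_on_compact[OF K assms(3) assms(6), of _ "[k]"] in force)+
    then show "\<exists>b. \<forall>i\<in>{1..m}. \<forall>x\<in>?K. \<forall>q\<in>\<Xi>. norm (iter_partial [k] (X q i) x) \<le> b" by blast
  qed force+
  then obtain b where b: "0 \<le> b" "\<And>k i x q. i \<in> {1..m} \<Longrightarrow> x \<in> ?K \<Longrightarrow> q \<in> \<Xi> \<Longrightarrow> norm (iter_partial [k] (X q i) x) \<le> b"
    by blast
  define L where "L = (\<Sum>k\<in>(UNIV::'n set). b + 1)"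
  have L: "0 \<le> L" using b(1) by (simp add: L_def)
  have lipschitz: "norm (F x - F y) \<le> L * norm (x - y)"
    if F: "csmooth ?\<Omega> F" and Fb: "\<And>k x. x \<in> ?K \<Longrightarrow> norm (iter_partial [k] F x) \<le> b + 1" and xy: "x \<in> ?K" "y \<in> ?K"
    for F :: "real^'n \<Rightarrow> real^'n" and x y
  proof -
    have "norm (FD F x (axis k 1)) \<le> b + 1" if x: "x \<in> ?K" for k x
    proof -
      have "iter_partial [k] F x = FD F x (axis k 1)"
        using partial_deriv_eq_FD[OF csmooth_differentiable[OF F subsetD[OF K(2) x]]] by (simp add: iter_partial_def)
      then show ?thesis using Fb[OF x, of k] by simp
    qed
    from FD_bounds_from_partials(2)[OF F K(2) this xy] show ?thesis using b(1) by (simp add: L_def)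
  qed
  have "\<forall>\<^sub>F j in sequentially. \<forall>k\<in>UNIV. \<forall>i\<in>{1..m}. \<forall>z\<in>?K \<times> \<Xi>.
      dist ((\<lambda>(x, q). iter_partial [k] (Xj j q i) x) z) ((\<lambda>(x, q). iter_partial [k] (X q i) x) z) < 1"
    by (intro eventually_ball_finite ballI uniform_limitD[OF assms(8)] K) auto
  then obtain J1 where J1: "\<And>j k i x q. j \<ge> J1 \<Longrightarrow> i \<in> {1..m} \<Longrightarrow> x \<in> ?K \<Longrightarrow> q \<in> \<Xi> \<Longrightarrow>
      dist (iter_partial [k] (Xj j q i) x) (iter_partial [k] (X q i) x) < 1"
    unfolding eventually_sequentially by fastforce
  have closeX: "\<exists>J. \<forall>j\<ge>J. \<forall>i\<in>{1..m}. \<forall>x\<in>?K. \<forall>q\<in>\<Xi>. norm (Xj j q i x - X q i x) \<le> \<eta>" if \<eta>: "0 < \<eta>" for \<eta>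
  proof -
    have "\<forall>\<^sub>F j in sequentially. \<forall>i\<in>{1..m}. \<forall>z\<in>?K \<times> \<Xi>. dist ((\<lambda>(x, q). Xj j q i x) z) ((\<lambda>(x, q). X q i x) z) < \<eta>"
      by (intro eventually_ball_finite ballI uniform_limitD[OF conv] K \<eta>) auto
    then show ?thesis unfolding eventually_sequentially dist_norm by (fastforce intro: less_imp_le)
  qed
  obtain J2 where J2: "\<And>j i x q. j \<ge> J2 \<Longrightarrow> i \<in> {1..m} \<Longrightarrow> x \<in> ?K \<Longrightarrow> q \<in> \<Xi> \<Longrightarrow> norm (Xj j q i x - X q i x) \<le> 1"
    using closeX[OF zero_less_one] by blast
  define M where "M = M0 + 1"
  have M: "0 \<le> M" using M0 by (simp add: M_def)
  have XM: "norm (X q i x) \<le> M" if "i \<in> {1..m}" "x \<in> ?K" "q \<in> \<Xi>" for i x q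
    using M0(2)[OF that] by (simp add: M_def)
  have XjM: "norm (Xj j q i x) \<le> M" if "j \<ge> J2" "i \<in> {1..m}" "x \<in> ?K" "q \<in> \<Xi>" for j i x q
    using M0(2)[OF that(2-4)] J2[OF that] norm_triangle_ineq[of "Xj j q i x - X q i x" "X q i x"] by (simp add: M_def)
  have XL: "norm (X q i x - X q i y) \<le> L * norm (x - y)" if "i \<in> {1..m}" "x \<in> ?K" "y \<in> ?K" "q \<in> \<Xi>" for i x y q
    by (rule lipschitz[OF smX[OF that(4,1)] _ that(2,3)]) (use b(2)[OF that(1) _ that(4)] in \<open>force intro: add_increasing2\<close>)
  have XjL: "norm (Xj j q i x - Xj j q i y) \<le> L * norm (x - y)"
    if "j \<ge> J1" "i \<in> {1..m}" "x \<in> ?K" "y \<in> ?K" "q \<in> \<Xi>" for j i x y q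
  proof (rule lipschitz[OF smXj[OF that(5,2)] _ that(3,4)])
    fix k x assume x: "x \<in> ?K"
    show "norm (iter_partial [k] (Xj j q i) x) \<le> b + 1"
      using b(2)[OF that(2) x that(5), of k] J1[OF that(1,2) x that(5), of k]
        norm_triangle_ineq[of "iter_partial [k] (Xj j q i) x - iter_partial [k] (X q i) x" "iter_partial [k] (X q i) x"]
      by (simp add: dist_norm)
  qed
  \<comment> \<open>A curve of length at most \<open>2 * \<epsilon>0\<close> moves by at most \<open>R1 / 2\<close>.\<close>
  define \<epsilon>0 where "\<epsilon>0 = R1 / (4 * (real m * M + 1))"
  have mM: "0 \<le> real m * M" using M by simp
  have \<epsilon>0: "0 < \<epsilon>0" "real m * (2 * \<epsilon>0) * M \<le> R1 / 2"
  proof -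
    show "0 < \<epsilon>0" using R1 mM by (simp add: \<epsilon>0_def)
    have "real m * (2 * \<epsilon>0) * M = 2 * \<epsilon>0 * (real m * M)" by simp
    also have "\<dots> \<le> 2 * \<epsilon>0 * (real m * M + 1)" using \<open>0 < \<epsilon>0\<close> by simp
    also have "\<dots> = R1 / 2" using mM by (simp add: \<epsilon>0_def field_simps)
    finally show "real m * (2 * \<epsilon>0) * M \<le> R1 / 2" .
  qed
  obtain \<delta>0 J0 where \<delta>0: "0 < \<delta>0"
    "\<And>j q x y. j \<ge> J0 \<Longrightarrow> q \<in> \<Xi> \<Longrightarrow> x \<in> ?K \<Longrightarrow> y \<in> ?K \<Longrightarrow> dist x y < \<delta>0 \<Longrightarrow> reach m ?\<Omega> (Xj j q) \<epsilon>0 x y"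
    "\<And>q x y. q \<in> \<Xi> \<Longrightarrow> x \<in> ?K \<Longrightarrow> y \<in> ?K \<Longrightarrow> dist x y < \<delta>0 \<Longrightarrow> reach m ?\<Omega> (X q) \<epsilon>0 x y"
    using loc[OF \<epsilon>0(1)] by blast
  define r0 where "r0 = min (\<delta>0 / 2) (R1 / 2)"
  have r0: "0 < r0" "r0 < R0" "r0 \<le> R1 / 2" "2 * r0 \<le> \<delta>0" using \<delta>0(1) R1 by (auto simp: r0_def)
  let ?B = "ball x0 r0"
  have BK: "x \<in> ?K" if "x \<in> ?B" for x using that r0 R1 by auto
  have Bd: "dist x y < \<delta>0" if "x \<in> ?B" "y \<in> ?B" for x y
    using that r0(4) dist_triangle[of x y x0] by (simp add: dist_commute)
  have start: "norm (x - x0) + real m * (2 * \<epsilon>0) * M < R1" if "x \<in> ?B" for x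
    using that r0(3) \<epsilon>0(2) by (simp add: dist_norm norm_minus_commute)
  have finite_dist: "\<exists>d. sr_dist m ?\<Omega> Y x y = ereal d \<and> d \<le> \<epsilon>0"
    if "reach m ?\<Omega> Y \<epsilon>0 x y" "\<And>i. i \<in> {1..m} \<Longrightarrow> continuous_on ?\<Omega> (Y i)" for Y x y
  proof -
    have "sr_dist m ?\<Omega> Y x y \<le> ereal \<epsilon>0" using reach_imp_sr_dist_le[OF that(1) _ that(2)] \<epsilon>0(1) by simp
    moreover have "0 \<le> sr_dist m ?\<Omega> Y x y" by (rule sr_dist_nonneg)
    ultimately show ?thesis by (cases "sr_dist m ?\<Omega> Y x y") auto
  qed
  have LinfX: "in_Linf (?B \<times> ?B) (\<lambda>(x, y). sr_dist m ?\<Omega> (X q) x y)" if "q \<in> \<Xi>" for q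
    by (rule in_Linf_sr_dist[OF smX[OF that] chowX[OF that] r0(1,2)])
  have LinfXj: "in_Linf (?B \<times> ?B) (\<lambda>(x, y). sr_dist m ?\<Omega> (Xj j q) x y)" if "q \<in> \<Xi>" for j q
    by (rule in_Linf_sr_dist[OF smXj[OF that] chowXj[OF that] r0(1,2)])
  have "\<exists>J. \<forall>j\<ge>J. \<forall>q\<in>\<Xi>. Linf_norm (?B \<times> ?B)
      (\<lambda>z. (\<lambda>(x, y). sr_dist m ?\<Omega> (Xj j q) x y) z - (\<lambda>(x, y). sr_dist m ?\<Omega> (X q) x y) z) < ereal \<epsilon>" if \<epsilon>: "0 < \<epsilon>" for \<epsilon>
  proof -
    define \<epsilon>1 where "\<epsilon>1 = min (\<epsilon> / 4) \<epsilon>0"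
    have \<epsilon>1: "0 < \<epsilon>1" "\<epsilon>1 \<le> \<epsilon>0" "2 * \<epsilon>1 \<le> \<epsilon> / 2" using \<epsilon> \<epsilon>0 by (auto simp: \<epsilon>1_def)
    obtain \<delta> J3 where \<delta>: "0 < \<delta>"
      "\<And>j q x y. j \<ge> J3 \<Longrightarrow> q \<in> \<Xi> \<Longrightarrow> x \<in> ?K \<Longrightarrow> y \<in> ?K \<Longrightarrow> dist x y < \<delta> \<Longrightarrow> reach m ?\<Omega> (Xj j q) \<epsilon>1 x y"
      "\<And>q x y. q \<in> \<Xi> \<Longrightarrow> x \<in> ?K \<Longrightarrow> y \<in> ?K \<Longrightarrow> dist x y < \<delta> \<Longrightarrow> reach m ?\<Omega> (X q) \<epsilon>1 x y"
      using loc[OF \<epsilon>1(1)] by blast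
    define Q where "Q = real m * (2 * \<epsilon>0) * exp (real m * (2 * \<epsilon>0) * L)"
    have Q: "0 \<le> Q" using \<epsilon>0 by (simp add: Q_def)
    \<comment> \<open>If the frames differ by at most \<open>\<eta>\<close>, endpoints differ by less than \<open>\<delta>\<close>.\<close>
    define \<eta> where "\<eta> = \<delta> / (2 * (Q + 1))"
    have \<eta>: "0 < \<eta>" "real m * (2 * \<epsilon>0) * \<eta> * exp (real m * (2 * \<epsilon>0) * L) < \<delta>"
    proof -
      show "0 < \<eta>" using \<delta>(1) Q by (simp add: \<eta>_def)
      have "Q * \<eta> \<le> (Q + 1) * \<eta>" using \<open>0 < \<eta>\<close> by simp
      also have "\<dots> = \<delta> / 2" using Q by (simp add: \<eta>_def field_simps)
      also have "\<dots> < \<delta>" using \<delta>(1) by simp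
      finally show "real m * (2 * \<epsilon>0) * \<eta> * exp (real m * (2 * \<epsilon>0) * L) < \<delta>" by (simp add: Q_def mult_ac)
    qed
    obtain J4 where J4: "\<And>j i x q. j \<ge> J4 \<Longrightarrow> i \<in> {1..m} \<Longrightarrow> x \<in> ?K \<Longrightarrow> q \<in> \<Xi> \<Longrightarrow> norm (Xj j q i x - X q i x) \<le> \<eta>"
      using closeX[OF \<eta>(1)] by blast
    show ?thesis
    proof (intro exI[of _ "max (max J0 J1) (max (max J2 J3) J4)"] allI impI ballI)
      fix j q assume j: "max (max J0 J1) (max (max J2 J3) J4) \<le> j" and q: "q \<in> \<Xi>"
      then have js: "J0 \<le> j" "J1 \<le> j" "J2 \<le> j" "J3 \<le> j" "J4 \<le> j" by auto
      let ?d = "sr_dist m ?\<Omega> (X q)" and ?dj = "sr_dist m ?\<Omega> (Xj j q)"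
      have est: "\<bar>?dj x y - ?d x y\<bar> \<le> ereal (\<epsilon> / 2)" if xy: "x \<in> ?B" "y \<in> ?B" for x y
      proof -
        obtain d where d: "?d x y = ereal d" "d \<le> \<epsilon>0"
          using finite_dist[OF \<delta>0(3)[OF q BK[OF xy(1)] BK[OF xy(2)] Bd[OF xy]] Xc[OF q]] by blast
        obtain dj where dj: "?dj x y = ereal dj" "dj \<le> \<epsilon>0"
          using finite_dist[OF \<delta>0(2)[OF js(1) q BK[OF xy(1)] BK[OF xy(2)] Bd[OF xy]] Xjc[OF q]] by blast
        have J4': "norm (X q i z - Xj j q i z) \<le> \<eta>" if "i \<in> {1..m}" "z \<in> ?K" for i z
          using J4[OF js(5) that q] by (subst norm_minus_commute)
        have "?dj x y \<le> ereal (d + 2 * \<epsilon>1)"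
          by (rule sr_dist_le_perturbed[OF K(2) XM[OF _ _ q] XjM[OF js(3) _ _ q] XjL[OF js(2) _ _ _ q] L M Xjc[OF q]
                J4[OF js(5) _ _ q] less_imp_le[OF \<eta>(1)] \<eta>(2) \<delta>(2)[OF js(4) q] \<epsilon>1(1,2) start[OF xy(1)] d])
        moreover have "?d x y \<le> ereal (dj + 2 * \<epsilon>1)"
          by (rule sr_dist_le_perturbed[OF K(2) XjM[OF js(3) _ _ q] XM[OF _ _ q] XL[OF _ _ _ q] L M Xc[OF q]
                J4' less_imp_le[OF \<eta>(1)] \<eta>(2) \<delta>(3)[OF q] \<epsilon>1(1,2) start[OF xy(1)] dj])
        ultimately have "dj \<le> d + 2 * \<epsilon>1" "d \<le> dj + 2 * \<epsilon>1" by (simp_all add: d dj)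
        then have "\<bar>dj - d\<bar> \<le> \<epsilon> / 2" using \<epsilon>1(3) by linarith
        then show ?thesis by (simp add: d dj)
      qed
      have meas: "(\<lambda>(x, y). ?dj x y) \<in> borel_measurable (lebesgue_on (?B \<times> ?B))"
        "(\<lambda>(x, y). ?d x y) \<in> borel_measurable (lebesgue_on (?B \<times> ?B))"
        using LinfX[OF q] LinfXj[OF q] by (auto simp: in_Linf_def)
      have "Linf_norm (?B \<times> ?B) (\<lambda>z. (\<lambda>(x, y). ?dj x y) z - (\<lambda>(x, y). ?d x y) z) \<le> ereal (\<epsilon> / 2)"
        unfolding Linf_norm_def
      proof (rule esssup_I)
        show "(\<lambda>z. \<bar>(case z of (x, y) \<Rightarrow> ?dj x y) - (case z of (x, y) \<Rightarrow> ?d x y)\<bar>) \<in> borel_measurable (lebesgue_on (?B \<times> ?B))"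
          using meas by measurable
        show "AE z in lebesgue_on (?B \<times> ?B). \<bar>(case z of (x, y) \<Rightarrow> ?dj x y) - (case z of (x, y) \<Rightarrow> ?d x y)\<bar> \<le> ereal (\<epsilon> / 2)"
        proof (rule AE_I2)
          fix z assume "z \<in> space (lebesgue_on (?B \<times> ?B))"
          then obtain x y where "z = (x, y)" "x \<in> ?B" "y \<in> ?B" by auto
          then show "\<bar>(case z of (x, y) \<Rightarrow> ?dj x y) - (case z of (x, y) \<Rightarrow> ?d x y)\<bar> \<le> ereal (\<epsilon> / 2)"
            using est by simp
        qed
      qed
      also have "\<dots> < ereal \<epsilon>" using \<epsilon> by simp
      finally show "Linf_norm (?B \<times> ?B) (\<lambda>z. (\<lambda>(x, y). ?dj x y) z - (\<lambda>(x, y). ?d x y) z) < ereal \<epsilon>" .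
    qed
  qed
  then have "Linf_convergent_uniformly (?B \<times> ?B) \<Xi>
      (\<lambda>j q (x, y). sr_dist m ?\<Omega> (Xj j q) x y) (\<lambda>q (x, y). sr_dist m ?\<Omega> (X q) x y)"
    unfolding Linf_convergent_uniformly_def using LinfX LinfXj by blast
  then show ?thesis using r0(1,2) by blast
qed

end
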